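(* Suppose that $1\le p<\infty$, $1<q<\infty$, and let $(\eta)=\{\eta_n\}_{n=0}^\infty$ be a sequence of complex numbers. Then the following conditions are equivalent. (i) $\mathcal R_{(\eta)}\in\mathcal B(S^p,S^q)$. (ii) $\mathcal R_{(\eta)}\in\mathcal K(S^p,S^q)$. (iii) $F_{(\eta)}\in S^q$.
   Context: $\mathbb D$ is the open unit disc in $\mathbb C$, and $\mathrm{Hol}(\mathbb D)$ is the space of analytic functions in $\mathbb D$. For $0<p<\infty$, the Hardy space $H^p$ consists of those $f\in\mathrm{Hol}(\mathbb D)$ with $\|f\|_{H^p}=\sup_{0<r<1}\left(\frac1{2\pi}\int_0^{2\pi}|f(re^{it})|^p\,dt\right)^{1/p}<\infty$. The derivative-Hardy space $S^p$ consists of those $f\in\mathrm{Hol}(\mathbb D)$ with $f'\in H^p$, normed by $\|f\|_{S^p}^p=|f(0)|^p+\|f'\|_{H^p}^p$. Rhaly operator: for a complex sequence $(\eta)=\{\eta_n\}_{n=0}^\infty$ and $f(z)=\sum_{n=0}^\infty a_nz^n\in\mathrm{Hol}(\mathbb D)$, formally $\mathcal R_{(\eta)}(f)(z)=\sum_{n=0}^\infty\eta_n\left(\sum_{k=0}^na_k\right)z^n$, whenever the right-hand side defines an analytic function in $\mathbb D$. If the power series $\sum\eta_nz^n$ defines an analytic function in $\mathbb D$, set $F_{(\eta)}(z)=\sum_{n=0}^\infty\eta_nz^n$. (On a subspace of $\mathrm{Hol}(\mathbb D)$ containing the constants, $\mathcal R_{(\eta)}$ is well defined into $\mathrm{Hol}(\mathbb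 D)$ if and only if this power series defines an analytic function in $\mathbb D$; the condition $F_{(\eta)}\in S^q$ includes that it does.) For Banach spaces $X,Y$, $\mathcal B(X,Y)$ (resp. $\mathcal K(X,Y)$) denotes the continuous (resp. compact) linear operators from $X$ into $Y$; $\mathcal R_{(\eta)}\in\mathcal B(X,Y)$ (resp. $\mathcal K(X,Y)$) means that $\mathcal R_{(\eta)}$ is well defined on $X$, maps $X$ into $Y$, and is bounded (resp. compact). *)

theory Defs
  imports "HOL-Complex_Analysis.Complex_Analysis"
begin

text \<open>
  An element of $\mathrm{Hol}(\mathbb{D})$ is represented by a total function that is holomorphic
  on the unit disc; its values outside the disc are irrelevant. All spaces, norms and operator
  properties below depend only on the values in the disc, so functions that agree there represent
  the same element.
\<close>

definition integral_mean :: "real \<Rightarrow> (complex \<Rightarrow> complex) \<Rightarrow> real \<Rightarrow> real" where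
  "integral_mean p f r =
     ((1 / (2 * pi)) *
       integral {0..2 * pi} (\<lambda>t. norm (f (complex_of_real r * cis t)) powr p)) powr (1 / p)"

definition hardy_space :: "real \<Rightarrow> (complex \<Rightarrow> complex) set" where
  "hardy_space p =
     {f. f holomorphic_on ball 0 1 \<and> bdd_above (integral_mean p f ` {0<..<1})}"

definition hardy_norm :: "real \<Rightarrow> (complex \<Rightarrow> complex) \<Rightarrow> real" where
  "hardy_norm p f = (SUP r\<in>{0<..<1}. integral_mean p f r)"

definition deriv_hardy_space :: "real \<Rightarrow> (complex \<Rightarrow> complex) set" where
  "deriv_hardy_space p = {f. f holomorphic_on ball 0 1 \<and> deriv f \<in> hardy_space p}"

definition deriv_hardy_norm :: "real \<Rightarrow> (complex \<Rightarrow> complex) \<Rightarrow> real" where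
  "deriv_hardy_norm p f =
     (norm (f 0) powr p + hardy_norm p (deriv f) powr p) powr (1 / p)"

definition analytic_series :: "(nat \<Rightarrow> complex) \<Rightarrow> bool" where
  "analytic_series c \<longleftrightarrow> (\<forall>z\<in>ball 0 1. summable (\<lambda>n. c n * z ^ n))"

definition series_fun :: "(nat \<Rightarrow> complex) \<Rightarrow> complex \<Rightarrow> complex" where
  "series_fun c z = (\<Sum>n. c n * z ^ n)"

definition rhaly_coeff :: "(nat \<Rightarrow> complex) \<Rightarrow> (complex \<Rightarrow> complex) \<Rightarrow> nat \<Rightarrow> complex" where
  "rhaly_coeff \<eta> f n = \<eta> n * (\<Sum>k\<le>n. fps_nth (fps_expansion f 0) k)"

definition rhaly :: "(nat \<Rightarrow> complex) \<Rightarrow> (complex \<Rightarrow> complex) \<Rightarrow> complex \<Rightarrow> complex" where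
  "rhaly \<eta> f = series_fun (rhaly_coeff \<eta> f)"

definition rhaly_defined_on :: "(nat \<Rightarrow> complex) \<Rightarrow> (complex \<Rightarrow> complex) set \<Rightarrow> bool" where
  "rhaly_defined_on \<eta> X \<longleftrightarrow> (\<forall>f\<in>X. analytic_series (rhaly_coeff \<eta> f))"

definition linear_operator ::
  "(complex \<Rightarrow> complex) set \<Rightarrow> (complex \<Rightarrow> complex) set \<Rightarrow>
   ((complex \<Rightarrow> complex) \<Rightarrow> (complex \<Rightarrow> complex)) \<Rightarrow> bool" where
  "linear_operator X Y T \<longleftrightarrow>
     (\<forall>f\<in>X. T f \<in> Y) \<and>
     (\<forall>f\<in>X. \<forall>g\<in>X. \<forall>z\<in>ball 0 1. T (\<lambda>w. f w + g w) z = T f z + T g z) \<and>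
     (\<forall>c. \<forall>f\<in>X. \<forall>z\<in>ball 0 1. T (\<lambda>w. c * f w) z = c * T f z)"

definition bounded_operator ::
  "(complex \<Rightarrow> complex) set \<Rightarrow> ((complex \<Rightarrow> complex) \<Rightarrow> real) \<Rightarrow>
   (complex \<Rightarrow> complex) set \<Rightarrow> ((complex \<Rightarrow> complex) \<Rightarrow> real) \<Rightarrow>
   ((complex \<Rightarrow> complex) \<Rightarrow> (complex \<Rightarrow> complex)) \<Rightarrow> bool" where
  "bounded_operator X normX Y normY T \<longleftrightarrow>
     linear_operator X Y T \<and> (\<exists>C. \<forall>f\<in>X. normY (T f) \<le> C * normX f)"

text \<open>Compactness: the image of every norm-bounded sequence has a subsequence converging in
  the norm of the target space to an element of the target space.\<close>

definition compact_operator ::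
  "(complex \<Rightarrow> complex) set \<Rightarrow> ((complex \<Rightarrow> complex) \<Rightarrow> real) \<Rightarrow>
   (complex \<Rightarrow> complex) set \<Rightarrow> ((complex \<Rightarrow> complex) \<Rightarrow> real) \<Rightarrow>
   ((complex \<Rightarrow> complex) \<Rightarrow> (complex \<Rightarrow> complex)) \<Rightarrow> bool" where
  "compact_operator X normX Y normY T \<longleftrightarrow>
     linear_operator X Y T \<and>
     (\<forall>f :: nat \<Rightarrow> complex \<Rightarrow> complex.
        (\<forall>n. f n \<in> X) \<and> (\<exists>C. \<forall>n. normX (f n) \<le> C) \<longrightarrow>
        (\<exists>(s :: nat \<Rightarrow> nat) g. strict_mono s \<and> g \<in> Y \<and>
           (\<lambda>n. normY (\<lambda>z. T (f (s n)) z - g z)) \<longlonglongrightarrow> 0))"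

definition rhaly_bounded :: "(nat \<Rightarrow> complex) \<Rightarrow> real \<Rightarrow> real \<Rightarrow> bool" where
  "rhaly_bounded \<eta> p q \<longleftrightarrow>
     rhaly_defined_on \<eta> (deriv_hardy_space p) \<and>
     bounded_operator (deriv_hardy_space p) (deriv_hardy_norm p)
       (deriv_hardy_space q) (deriv_hardy_norm q) (rhaly \<eta>)"

definition rhaly_compact :: "(nat \<Rightarrow> complex) \<Rightarrow> real \<Rightarrow> real \<Rightarrow> bool" where
  "rhaly_compact \<eta> p q \<longleftrightarrow>
     rhaly_defined_on \<eta> (deriv_hardy_space p) \<and>
     compact_operator (deriv_hardy_space p) (deriv_hardy_norm p)
       (deriv_hardy_space q) (deriv_hardy_norm q) (rhaly \<eta>)"

end

theory Submission
  imports Defs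
begin

text \<open>
  Applying the operator to the constant function 1 gives $F_{(\eta)}$, so each of (i), (ii)
  implies (iii). Conversely, let $h = F_{(\eta)}' \in H^q$ and let $f = \sum a_n z^n$ be in $S^p$.
  Hardy's inequality for $f' \in H^1$ gives $\sum |a_n| \le C \|f\|_{S^p}$, so the derivative of
  $\mathcal{R}_{(\eta)} f$ arises from $h$ by a coefficient multiplier of bounded variation. Summation
  by parts writes it as an absolutely convergent combination of the Taylor tails of $h$, which are
  uniformly bounded in $H^q$ by M. Riesz's theorem and even tend to 0 there. Boundedness of the
  tails gives (i). For (ii), a bounded sequence in $S^p$ has a subsequence whose coefficients
  converge, and the convergence of the tails to 0 absorbs the remaining ones.

  M. Riesz's theorem is proved for $1 < q \le 2$ by Stein's comparison of the Laplacians of $|F|^q$ and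
  $|\mathrm{Re}\, F|^q$, and extended by passing from $q$ to $2q$ through $F^2$. The tails tend to 0
  because the dilations of $h$ converge to $h$ in $H^q$, which follows from uniform convexity.
\<close>

section \<open>Means over circles\<close>

text \<open>No boundary values are used: every estimate is made on a circle inside the disc with a
  constant independent of its radius, and suprema over radii come last. \<open>circle_mean\<close>
  leaves out the outer root of the integral mean, so that averages are linear in the integrand and
  norm inequalities become inequalities between q-th powers.

  The restriction q > 1 enters with the Riesz theorem, whose constant 2 / (q - 1) blows up at 1, and
  with strict convexity. Stein's comparison works for q <= 2 because q/2 - 1 is then not positive;
  squaring F takes the place of the usual duality argument. The exponent p acts only through
  Jensen's inequality, which leads to H^1, so p and q are independent of each other.

  Convergence of dilations is usually proved with boundary functions. Here the means of the midpoint
  of h and its dilation increase with the radius, so one good circle controls all larger ones, and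
  uniform convexity turns this into closeness.\<close>

definition circle_mean :: "(complex \<Rightarrow> real) \<Rightarrow> real \<Rightarrow> real" where
  "circle_mean \<phi> r = (1 / (2 * pi)) * integral {0..2 * pi} (\<lambda>t. \<phi> (complex_of_real r * cis t))"

lemma continuous_on_circle:
  fixes \<phi> :: "complex \<Rightarrow> 'a::topological_space"
  assumes "continuous_on (sphere 0 r) \<phi>" "0 \<le> r"
  shows "continuous_on S (\<lambda>t. \<phi> (complex_of_real r * cis t))"
  by (rule continuous_on_compose2[OF assms(1)])
     (use assms(2) in \<open>auto intro!: continuous_intros simp: norm_mult\<close>)

lemma circle_integrable:
  fixes \<phi> :: "complex \<Rightarrow> 'a::euclidean_space"
  assumes "continuous_on (sphere 0 r) \<phi>" "0 \<le> r"
  shows "(\<lambda>t. \<phi> (complex_of_real r * cis t)) integrable_on {0..2 * pi}"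
  by (intro integrable_continuous_interval continuous_on_circle assms)

lemma circle_mean_mono:
  assumes "continuous_on (sphere 0 r) \<phi>" "continuous_on (sphere 0 r) \<psi>" "0 \<le> r"
    and "\<And>z. norm z = r \<Longrightarrow> \<phi> z \<le> \<psi> z"
  shows "circle_mean \<phi> r \<le> circle_mean \<psi> r"
  unfolding circle_mean_def
  by (intro mult_left_mono integral_le circle_integrable assms)
     (use assms(3) in \<open>auto simp: norm_mult\<close>)

lemma circle_mean_cong:
  assumes "\<And>z. norm z = r \<Longrightarrow> \<phi> z = \<psi> z" "0 \<le> r"
  shows "circle_mean \<phi> r = circle_mean \<psi> r"
  unfolding circle_mean_def using assms by (simp add: norm_mult)

lemma circle_mean_const [simp]: "circle_mean (\<lambda>_. c) r = c"
  by (simp add: circle_mean_def)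

lemma circle_mean_nonneg:
  assumes "continuous_on (sphere 0 r) \<phi>" "0 \<le> r" "\<And>z. norm z = r \<Longrightarrow> 0 \<le> \<phi> z"
  shows "0 \<le> circle_mean \<phi> r"
  using circle_mean_mono[of r "\<lambda>_. 0" \<phi>] assms by simp

lemma circle_mean_add:
  assumes "continuous_on (sphere 0 r) \<phi>" "continuous_on (sphere 0 r) \<psi>" "0 \<le> r"
  shows "circle_mean (\<lambda>z. \<phi> z + \<psi> z) r = circle_mean \<phi> r + circle_mean \<psi> r"
  unfolding circle_mean_def
  by (subst integral_add) (auto intro!: circle_integrable assms simp: distrib_left right_diff_distrib)

lemma circle_mean_cmult: "circle_mean (\<lambda>z. c * \<phi> z) r = c * circle_mean \<phi> r"
  by (simp add: circle_mean_def)

lemma circle_mean_sum: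
  assumes "\<And>i. i \<in> I \<Longrightarrow> continuous_on (sphere 0 r) (\<phi> i)" "0 \<le> r" "finite I"
  shows "circle_mean (\<lambda>z. \<Sum>i\<in>I. \<phi> i z) r = (\<Sum>i\<in>I. circle_mean (\<phi> i) r)"
  using assms(3,1)
proof (induction I rule: finite_induct)
  case (insert i I)
  then show ?case
    by (simp add: circle_mean_add continuous_on_sum assms(2))
qed simp

lemma circle_mean_scale: "circle_mean \<phi> (r * s) = circle_mean (\<lambda>z. \<phi> (of_real r * z)) s"
  by (simp add: circle_mean_def mult.assoc)

lemma circle_mean_scale1: "circle_mean \<phi> r = circle_mean (\<lambda>z. \<phi> (of_real r * z)) 1"
  using circle_mean_scale[of \<phi> r 1] by simp

lemma circle_mean_0 [simp]: "circle_mean \<phi> 0 = \<phi> 0"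
  by (simp add: circle_mean_def)

lemma circle_mean_dominated:
  assumes "\<And>n. continuous_on (sphere 0 r) (\<phi> n)" "0 \<le> r"
    and "\<And>n z. norm z = r \<Longrightarrow> \<bar>\<phi> n z\<bar> \<le> B"
    and "\<And>z. norm z = r \<Longrightarrow> (\<lambda>n. \<phi> n z) \<longlonglongrightarrow> \<psi> z"
  shows "(\<lambda>n. circle_mean (\<phi> n) r) \<longlonglongrightarrow> circle_mean \<psi> r"
  unfolding circle_mean_def
  by (intro tendsto_mult tendsto_const dominated_convergence(2)[where h = "\<lambda>_. B"])
     (use assms in \<open>auto intro!: circle_integrable simp: norm_mult\<close>)

lemma continuous_on_circle_mean:
  assumes "continuous_on (ball 0 R) \<phi>"
  shows "continuous_on {0..<R} (circle_mean \<phi>)"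
proof -
  have "continuous_on ({0..<R} \<times> {0..2*pi}) (\<lambda>x. \<phi> (complex_of_real (fst x) * cis (snd x)))"
    by (rule continuous_on_compose2[OF assms]) (auto intro!: continuous_intros simp: norm_mult)
  then have "continuous_on {0..<R} (\<lambda>r. integral (cbox 0 (2*pi)) (\<lambda>t. \<phi> (complex_of_real r * cis t)))"
    by (intro integral_continuous_on_param) (simp add: case_prod_unfold)
  then show ?thesis
    unfolding circle_mean_def by (auto intro!: continuous_intros)
qed

section \<open>Convexity of powers and Jensen's inequality\<close>

lemma powr_ge_tangent:
  fixes x m p :: real
  assumes "1 \<le> p" "0 \<le> x" "0 < m"
  shows "m powr p + p * m powr (p - 1) * (x - m) \<le> x powr p"
proof (cases "x = 0")
  case True
  have "m powr p = m powr (p - 1) * m" using assms by (simp add: powr_mult_base powr_diff)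
  then have "m powr p + p * m powr (p - 1) * (x - m) = (1 - p) * m powr p"
    using True by (simp add: algebra_simps)
  also have "\<dots> \<le> 0" using assms by (simp add: mult_nonpos_nonneg)
  finally show ?thesis using True by simp
next
  case False
  with assms have x: "x > 0" by simp
  \<comment> \<open>Weighted AM-GM for the numbers (x/m)^p and 1 with weights 1/p and 1 - 1/p;
    multiplying by p m^p turns it into the tangent inequality.\<close>
  have "((x / m) powr p) powr (1 / p) * 1 powr (1 - 1 / p) \<le> (1 / p) * (x / m) powr p + (1 - 1 / p) * 1"
    by (rule Youngs_inequality_0) (use assms x in auto)
  then have "x / m \<le> (1 / p) * (x powr p / m powr p) + (1 - 1 / p)"
    using assms x by (simp add: powr_powr powr_divide)
  then have "m powr p * p * (x / m) \<le> m powr p * p * ((1 / p) * (x powr p / m powr p) + (1 - 1 / p))"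
    by (rule mult_left_mono) (use assms in auto)
  then have "p * (m powr p / m) * x \<le> x powr p + m powr p * (p - 1)"
    using assms by (simp add: algebra_simps)
  moreover have "m powr p / m = m powr (p - 1)" using assms by (simp add: powr_diff)
  moreover have "m powr (p - 1) * m = m powr p" using assms by (simp add: powr_diff)
  ultimately show ?thesis by (simp add: algebra_simps)
qed

text \<open>The tangent of the p-th power at the mean \<open>m\<close> lies below the power, and its
  linear term averages to zero. For \<open>m = 0\<close> there is no tangent, but the left side
  vanishes.\<close>

lemma circle_mean_jensen:
  assumes "continuous_on (sphere 0 r) g" "0 \<le> r" "\<And>z. norm z = r \<Longrightarrow> 0 \<le> g z" "1 \<le> p"
  shows "circle_mean g r powr p \<le> circle_mean (\<lambda>z. g z powr p) r"
proof -
  define m where "m = circle_mean g r"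
  have cp: "continuous_on (sphere 0 r) (\<lambda>z. g z powr p)"
    by (rule continuous_on_powr'[OF assms(1)]) (use assms in \<open>auto intro!: continuous_intros\<close>)
  show ?thesis
  proof (cases "m = 0")
    case True
    then show ?thesis unfolding m_def using assms cp by (auto intro!: circle_mean_nonneg)
  next
    case False
    with circle_mean_nonneg[OF assms(1-3)] have m: "m > 0" by (simp add: m_def)
    have "circle_mean (\<lambda>z. (m powr p - p * m powr (p - 1) * m) + p * m powr (p - 1) * g z) r
        \<le> circle_mean (\<lambda>z. g z powr p) r"
    proof (rule circle_mean_mono)
      fix z :: complex assume "norm z = r"
      then show "(m powr p - p * m powr (p - 1) * m) + p * m powr (p - 1) * g z \<le> g z powr p"
        using powr_ge_tangent[OF assms(4) assms(3) m, of z] by (simp add: algebra_simps)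
    qed (use assms cp in \<open>auto intro!: continuous_intros\<close>)
    also have "circle_mean (\<lambda>z. (m powr p - p * m powr (p - 1) * m) + p * m powr (p - 1) * g z) r = m powr p"
      by (subst circle_mean_add)
         (use assms in \<open>auto intro!: continuous_intros simp: circle_mean_cmult m_def[symmetric]\<close>)
    finally show ?thesis by (simp add: m_def)
  qed
qed

section \<open>Subharmonic means\<close>

text \<open>In the coordinates s = log r and t = angle, the sum of the second s- and t-derivatives
  is r^2 times the Laplacian. Here \<open>v1\<close> and \<open>v2\<close> stand for the first and
  second t-derivatives of \<open>w\<close>. Integration over a period removes \<open>v2\<close>, so
  the mean is convex in s; being bounded above as s tends to minus infinity, it cannot
  decrease.\<close>

lemma log_mean_mono:
  fixes w w1 w2 v1 v2 :: "real \<Rightarrow> real \<Rightarrow> real"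
  assumes w: "\<And>s t. s < S \<Longrightarrow> ((\<lambda>s. w s t) has_real_derivative w1 s t) (at s)"
    and w1: "\<And>s t. s < S \<Longrightarrow> ((\<lambda>s. w1 s t) has_real_derivative w2 s t) (at s)"
    and v1: "\<And>s t. s < S \<Longrightarrow> ((\<lambda>t. v1 s t) has_real_derivative v2 s t) (at t)"
    and periodic: "\<And>s. s < S \<Longrightarrow> v1 s (2 * pi) = v1 s 0"
    and lap: "\<And>s t. s < S \<Longrightarrow> 0 \<le> w2 s t + v2 s t"
    and cw: "continuous_on ({..<S} \<times> UNIV) (\<lambda>(s, t). w s t)"
    and cw1: "continuous_on ({..<S} \<times> UNIV) (\<lambda>(s, t). w1 s t)"
    and cw2: "continuous_on ({..<S} \<times> UNIV) (\<lambda>(s, t). w2 s t)"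
    and bound: "\<And>s. s \<le> S0 \<Longrightarrow> integral {0..2*pi} (w s) \<le> B"
    and "s1 \<le> s2" "s2 < S"
  shows "integral {0..2*pi} (w s1) \<le> integral {0..2*pi} (w s2)"
proof -
  define M M1 M2 where "M s = integral {0..2*pi} (w s)" and "M1 s = integral {0..2*pi} (w1 s)"
    and "M2 s = integral {0..2*pi} (w2 s)" for s
  have slice: "continuous_on {0..2*pi} (f s)" if "continuous_on ({..<S} \<times> UNIV) (\<lambda>(s, t). f s t)" "s < S"
    for f :: "real \<Rightarrow> real \<Rightarrow> real" and s
  proof -
    have "continuous_on {0..2*pi} (\<lambda>t. (\<lambda>(s, t). f s t) (s, t))"
      by (rule continuous_on_compose2[OF that(1)]) (use that in \<open>auto intro!: continuous_intros\<close>)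
    then show ?thesis by simp
  qed
  have dM: "(M has_real_derivative M1 s) (at s)" if "s < S" for s
  proof -
    have "((\<lambda>s. integral (cbox 0 (2*pi)) (w s)) has_field_derivative integral (cbox 0 (2*pi)) (w1 s)) (at s within {..<S})"
      by (rule leibniz_rule_field_derivative)
         (use that in \<open>auto intro!: has_field_derivative_at_within w integrable_continuous_interval slice cw
            intro: continuous_on_subset[OF cw1]\<close>)
    with that show ?thesis unfolding M_def M1_def by (simp add: at_within_open[of _ "{..<S}"])
  qed
  have dM1: "(M1 has_real_derivative M2 s) (at s)" if "s < S" for s
  proof -
    have "((\<lambda>s. integral (cbox 0 (2*pi)) (w1 s)) has_field_derivative integral (cbox 0 (2*pi)) (w2 s)) (at s within {..<S})"
      by (rule leibniz_rule_field_derivative)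
         (use that in \<open>auto intro!: has_field_derivative_at_within w1 integrable_continuous_interval slice cw1
            intro: continuous_on_subset[OF cw2]\<close>)
    with that show ?thesis unfolding M2_def M1_def by (simp add: at_within_open[of _ "{..<S}"])
  qed
  have M2: "0 \<le> M2 s" if "s < S" for s
  proof -
    have "(v2 s has_integral (v1 s (2*pi) - v1 s 0)) {0..2*pi}"
      by (rule fundamental_theorem_of_calculus)
         (use v1[OF that] in \<open>auto simp: has_real_derivative_iff_has_vector_derivative
            intro: has_vector_derivative_at_within\<close>)
    then have v2: "(v2 s has_integral 0) {0..2*pi}" using periodic that by simp
    have "((\<lambda>t. w2 s t + v2 s t) has_integral (M2 s + 0)) {0..2*pi}"
      unfolding M2_def
      by (intro has_integral_add v2 integrable_integral integrable_continuous_interval slice cw2 that)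
    then show ?thesis using has_integral_nonneg[of _ "M2 s + 0" "{0..2*pi}"] lap that by force
  qed
  have M1_mono: "M1 x \<le> M1 y" if "x \<le> y" "y < S" for x y
    using that by (intro DERIV_nonneg_imp_nondecreasing[of x y M1] exI[where x = "M2 _"]) (auto intro!: dM1 M2)
  have M1: "0 \<le> M1 s" if "s < S" for s
  proof (rule ccontr)
    assume "\<not> 0 \<le> M1 s"
    then have neg: "M1 s < 0" by simp
    \<comment> \<open>Going back by \<open>k\<close> reaches the region below \<open>S0\<close>.
      Slopes further left are at most \<open>M1 s\<close>, so this also lifts the mean above the
      bound \<open>B\<close>.\<close>
    define k where "k = max (max 1 (s - S0)) ((\<bar>B - M s\<bar> + 1) / (- M1 s))"
    have k: "k > 0" "s - k \<le> S0" "(\<bar>B - M s\<bar> + 1) \<le> k * (- M1 s)"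
    proof -
      have "(\<bar>B - M s\<bar> + 1) / (- M1 s) \<le> k" by (simp add: k_def)
      then show "(\<bar>B - M s\<bar> + 1) \<le> k * (- M1 s)" using neg by (subst (asm) pos_divide_le_eq) auto
    qed (auto simp: k_def)
    have "\<exists>\<xi>. s - k < \<xi> \<and> \<xi> < s \<and> M s - M (s - k) = (s - (s - k)) * M1 \<xi>"
      by (rule MVT2) (use k that dM in auto)
    then obtain \<xi> where \<xi>: "s - k < \<xi>" "\<xi> < s" "M s - M (s - k) = k * M1 \<xi>" by auto
    have "k * M1 \<xi> \<le> k * M1 s" using k M1_mono[of \<xi> s] \<xi> that by (intro mult_left_mono) auto
    with \<xi> k have "M (s - k) \<ge> M s + \<bar>B - M s\<bar> + 1" by linarith
    moreover have "M (s - k) \<le> B" using bound k by (simp add: M_def)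
    ultimately show False by linarith
  qed
  have "M s1 \<le> M s2"
    using assms(10,11) by (intro DERIV_nonneg_imp_nondecreasing[of s1 s2 M] exI[where x = "M1 _"]) (auto intro!: dM M1)
  then show ?thesis by (simp add: M_def)
qed

section \<open>Laplacians of powers in logarithmic coordinates\<close>

lemma has_real_derivative_slices:
  assumes "(H has_field_derivative D) (at (Complex s t))"
  shows "((\<lambda>s. Re (H (Complex s t))) has_real_derivative Re D) (at s)"
    and "((\<lambda>s. Im (H (Complex s t))) has_real_derivative Im D) (at s)"
    and "((\<lambda>t. Re (H (Complex s t))) has_real_derivative - Im D) (at t)"
    and "((\<lambda>t. Im (H (Complex s t))) has_real_derivative Re D) (at t)"
proof -
  have c1: "((\<lambda>s. Complex s t) has_vector_derivative 1) (at s)"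
    unfolding Complex_eq by (auto intro!: derivative_eq_intros)
  \<comment> \<open>The vertical direction multiplies the derivative by i, which is the
    Cauchy-Riemann rule behind the last two claims.\<close>
  have c2: "((\<lambda>t. Complex s t) has_vector_derivative \<i>) (at t)"
    unfolding Complex_eq by (auto intro!: derivative_eq_intros)
  have 1: "((\<lambda>s. H (Complex s t)) has_vector_derivative D) (at s)"
    using field_vector_diff_chain_at[OF c1 assms] by (simp add: o_def)
  have 2: "((\<lambda>t. H (Complex s t)) has_vector_derivative \<i> * D) (at t)"
    using field_vector_diff_chain_at[OF c2 assms] by (simp add: o_def)
  show "((\<lambda>s. Re (H (Complex s t))) has_real_derivative Re D) (at s)"
    using bounded_linear.has_vector_derivative[OF bounded_linear_Re 1]
    by (simp add: has_real_derivative_iff_has_vector_derivative)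
  show "((\<lambda>s. Im (H (Complex s t))) has_real_derivative Im D) (at s)"
    using bounded_linear.has_vector_derivative[OF bounded_linear_Im 1]
    by (simp add: has_real_derivative_iff_has_vector_derivative)
  show "((\<lambda>t. Re (H (Complex s t))) has_real_derivative - Im D) (at t)"
    using bounded_linear.has_vector_derivative[OF bounded_linear_Re 2]
    by (simp add: has_real_derivative_iff_has_vector_derivative)
  show "((\<lambda>t. Im (H (Complex s t))) has_real_derivative Re D) (at t)"
    using bounded_linear.has_vector_derivative[OF bounded_linear_Im 2]
    by (simp add: has_real_derivative_iff_has_vector_derivative)
qed

text \<open>Read \<open>h\<close>, \<open>D\<close>, \<open>E\<close> as a holomorphic function and
  its first two derivatives, and \<open>y\<close> as (Re h)^2 + \<kappa> (Im h)^2 + \<epsilon>. The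
  two summands on the left are then the second s- and t-derivatives of y^a. The terms with
  \<open>E\<close> cancel because Re h and Im h are harmonic. The equation for \<kappa> says that it
  is 0 or 1, so that the real part and the modulus are treated in one computation.\<close>

lemma powr_laplacian_identity:
  fixes y a \<kappa> :: real and h D E :: complex
  assumes "y > 0" "\<kappa> * \<kappa> = \<kappa>"
  shows "(a * (a - 1) * y powr (a - 2) * (2 * (Re h * Re D + \<kappa> * (Im h * Im D)))\<^sup>2 +
      a * y powr (a - 1) * (2 * ((Re D)\<^sup>2 + Re h * Re E + \<kappa> * ((Im D)\<^sup>2 + Im h * Im E)))) +
      (a * (a - 1) * y powr (a - 2) * (2 * (- Re h * Im D + \<kappa> * (Im h * Re D)))\<^sup>2 +
      a * y powr (a - 1) * (2 * ((Im D)\<^sup>2 - Re h * Re E + \<kappa> * ((Re D)\<^sup>2 - Im h * Im E))))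
    = (cmod D)\<^sup>2 * (a * y powr (a - 2) * (2 * (1 + \<kappa>) * y + 4 * (a - 1) * ((Re h)\<^sup>2 + \<kappa> * (Im h)\<^sup>2)))"
proof -
  have y: "y powr (a - 1) = y powr (a - 2) * y"
    using powr_add[of y "a - 2" 1] assms by simp
  define P u v d1 d2 e1 e2 where "P = y powr (a - 2)" and "u = Re h" and "v = Im h"
    and "d1 = Re D" and "d2 = Im D" and "e1 = Re E" and "e2 = Im E"
  note defs = this
  have "\<kappa> = 0 \<or> \<kappa> = 1" using assms(2) by (metis mult_cancel_left1)
  then show ?thesis
    unfolding y cmod_power2 defs[symmetric]
    by (elim disjE) (simp_all add: algebra_simps power2_eq_square)
qed

text \<open>Up to the factor |H'|^2, the expression in \<open>lap\<close> is the Laplacian of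
  \<open>\<Psi>\<close> composed with F, with x and y in place of (Re F)^2 and (Im F)^2. The shift
  \<epsilon> keeps both bases positive, so the powers stay smooth where F or Re F vanishes. The
  coefficients may have either sign, as a comparison of two such functions requires.\<close>

lemma circle_mean_subharmonic_mono:
  fixes F :: "complex \<Rightarrow> complex" and a c d \<epsilon> :: real
  defines "\<Psi> \<equiv> \<lambda>z. c * ((Re z)\<^sup>2 + \<epsilon>) powr a + d * ((cmod z)\<^sup>2 + \<epsilon>) powr a"
  assumes F: "F holomorphic_on ball 0 R" and \<epsilon>: "0 < \<epsilon>"
    and lap: "\<And>x y. 0 \<le> x \<Longrightarrow> 0 \<le> y \<Longrightarrow>
       0 \<le> c * (a * (x + \<epsilon>) powr (a - 2) * (2 * (x + \<epsilon>) + 4 * (a - 1) * x))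
         + d * (a * (x + y + \<epsilon>) powr (a - 2) * (4 * (x + y + \<epsilon>) + 4 * (a - 1) * (x + y)))"
    and r: "0 \<le> r1" "r1 \<le> r2" "r2 < R"
  shows "circle_mean (\<lambda>z. \<Psi> (F z)) r1 \<le> circle_mean (\<lambda>z. \<Psi> (F z)) r2"
proof -
  have R: "R > 0" using r by simp
  \<comment> \<open>The exponential maps the half-plane Re z < ln R onto the punctured disc and
    vertical lines onto circles.\<close>
  define H D E where "H = (\<lambda>z. F (exp z))" and "D = (\<lambda>z. deriv F (exp z) * exp z)"
    and "E = (\<lambda>z. (deriv (deriv F) (exp z) * exp z + deriv F (exp z)) * exp z)"
  define V where "V = {z. Re z < ln R}"
  have expV: "exp z \<in> ball 0 R" if "z \<in> V" for z
  proof -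
    have "exp (Re z) < exp (ln R)" using that by (simp add: V_def)
    then show ?thesis using R by simp
  qed
  have F1: "deriv F holomorphic_on ball 0 R" and F2: "deriv (deriv F) holomorphic_on ball 0 R"
    by (simp_all add: F holomorphic_deriv)
  have dH: "(H has_field_derivative D z) (at z)" if "z \<in> V" for z
    unfolding H_def D_def
    by (rule DERIV_chain2) (use holomorphic_derivI[OF F _ expV[OF that]] in \<open>auto intro!: derivative_eq_intros\<close>)
  have dD: "(D has_field_derivative E z) (at z)" if "z \<in> V" for z
  proof -
    have *: "((\<lambda>z. deriv F (exp z)) has_field_derivative deriv (deriv F) (exp z) * exp z) (at z)"
      by (rule DERIV_chain2) (use holomorphic_derivI[OF F1 _ expV[OF that]] in \<open>auto intro!: derivative_eq_intros\<close>)
    show ?thesis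
      unfolding D_def E_def by (rule derivative_eq_intros * refl)+ (simp add: algebra_simps)
  qed
  have contE: "continuous_on V E"
    unfolding E_def
    by (intro continuous_intros continuous_on_compose2[OF holomorphic_on_imp_continuous_on[OF F1]]
        continuous_on_compose2[OF holomorphic_on_imp_continuous_on[OF F2]]) (use expV in auto)
  have contH: "continuous_on V H" and contD: "continuous_on V D"
    using dH dD by (meson DERIV_isCont continuous_at_imp_continuous_on)+
  have cC: "continuous_on X (\<lambda>(s, t). Complex s t)" for X
    unfolding Complex_eq case_prod_unfold by (intro continuous_intros)
  have slice: "continuous_on ({..<ln R} \<times> UNIV) (\<lambda>(s, t). f (Complex s t))" if "continuous_on V f"
    for f :: "complex \<Rightarrow> complex"
  proof -
    have "continuous_on ({..<ln R} \<times> UNIV) (\<lambda>x. f ((\<lambda>(s, t). Complex s t) x))"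
      by (rule continuous_on_compose2[OF that cC]) (auto simp: V_def)
    then show ?thesis by (simp add: case_prod_unfold)
  qed
  \<comment> \<open>\<kappa> = 0 gives (Re h)^2 + \<epsilon> and \<kappa> = 1 gives |h|^2 +
    \<epsilon>. Below, \<open>q1\<close> and \<open>q2\<close> are the s-derivatives of the a-th
    power, \<open>p1\<close> and \<open>p2\<close> its t-derivatives.\<close>
  define Y where "Y \<kappa> h = (Re h)\<^sup>2 + \<kappa> * (Im h)\<^sup>2 + \<epsilon>" for \<kappa> :: real and h :: complex
  have Ypos: "Y \<kappa> h > 0" if "\<kappa> \<ge> 0" for \<kappa> h
    unfolding Y_def using \<epsilon> that by (simp add: add_nonneg_pos)
  define Ys Yss Yt Ytt where
    "Ys \<kappa> z = 2 * (Re (H z) * Re (D z) + \<kappa> * (Im (H z) * Im (D z)))" and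
    "Yss \<kappa> z = 2 * ((Re (D z))\<^sup>2 + Re (H z) * Re (E z) + \<kappa> * ((Im (D z))\<^sup>2 + Im (H z) * Im (E z)))" and
    "Yt \<kappa> z = 2 * (- Re (H z) * Im (D z) + \<kappa> * (Im (H z) * Re (D z)))" and
    "Ytt \<kappa> z = 2 * ((Im (D z))\<^sup>2 - Re (H z) * Re (E z) + \<kappa> * ((Re (D z))\<^sup>2 - Im (H z) * Im (E z)))"
    for \<kappa> :: real and z :: complex
  define q1 q2 p1 p2 where
    "q1 \<kappa> z = a * Y \<kappa> (H z) powr (a - 1) * Ys \<kappa> z" and
    "q2 \<kappa> z = a * (a - 1) * Y \<kappa> (H z) powr (a - 2) * (Ys \<kappa> z)\<^sup>2 + a * Y \<kappa> (H z) powr (a - 1) * Yss \<kappa> z" and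
    "p1 \<kappa> z = a * Y \<kappa> (H z) powr (a - 1) * Yt \<kappa> z" and
    "p2 \<kappa> z = a * (a - 1) * Y \<kappa> (H z) powr (a - 2) * (Yt \<kappa> z)\<^sup>2 + a * Y \<kappa> (H z) powr (a - 1) * Ytt \<kappa> z"
    for \<kappa> :: real and z :: complex
  have V: "Complex s t \<in> V" if "s < ln R" for s t using that by (simp add: V_def)
  note dsl = has_real_derivative_slices[OF dH] has_real_derivative_slices[OF dD]
  have dY: "((\<lambda>s. Y \<kappa> (H (Complex s t))) has_real_derivative Ys \<kappa> (Complex s t)) (at s)"
    "((\<lambda>t. Y \<kappa> (H (Complex s t))) has_real_derivative Yt \<kappa> (Complex s t)) (at t)"
    "((\<lambda>s. Ys \<kappa> (Complex s t)) has_real_derivative Yss \<kappa> (Complex s t)) (at s)"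
    "((\<lambda>t. Yt \<kappa> (Complex s t)) has_real_derivative Ytt \<kappa> (Complex s t)) (at t)"
    if "s < ln R" for s t \<kappa>
    unfolding Y_def Ys_def Yt_def Yss_def Ytt_def
    by (rule derivative_eq_intros dsl V that refl | simp add: algebra_simps power2_eq_square)+
  have dq: "((\<lambda>s. Y \<kappa> (H (Complex s t)) powr a) has_real_derivative q1 \<kappa> (Complex s t)) (at s)"
    "((\<lambda>s. q1 \<kappa> (Complex s t)) has_real_derivative q2 \<kappa> (Complex s t)) (at s)"
    "((\<lambda>t. p1 \<kappa> (Complex s t)) has_real_derivative p2 \<kappa> (Complex s t)) (at t)"
    if "s < ln R" "\<kappa> \<ge> 0" for s t \<kappa>
  proof -
    note pos = Ypos[OF that(2), of "H (Complex s t)"]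
    have ps: "((\<lambda>s. Y \<kappa> (H (Complex s t)) powr b) has_real_derivative
        b * Y \<kappa> (H (Complex s t)) powr (b - 1) * Ys \<kappa> (Complex s t)) (at s)"
      and pt: "((\<lambda>t. Y \<kappa> (H (Complex s t)) powr b) has_real_derivative
        b * Y \<kappa> (H (Complex s t)) powr (b - 1) * Yt \<kappa> (Complex s t)) (at t)" for b
      by (rule DERIV_chain2[where f = "\<lambda>y. y powr b"], rule has_real_derivative_powr[OF pos], rule dY that, rule that)+
    have 2: "a - 1 - 1 = a - 2" by simp
    show "((\<lambda>s. Y \<kappa> (H (Complex s t)) powr a) has_real_derivative q1 \<kappa> (Complex s t)) (at s)"
      unfolding q1_def by (rule ps)
    show "((\<lambda>s. q1 \<kappa> (Complex s t)) has_real_derivative q2 \<kappa> (Complex s t)) (at s)"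
      unfolding q1_def q2_def
      by (rule derivative_eq_intros ps[of "a - 1", unfolded 2] dY that refl)+ (simp add: algebra_simps power2_eq_square)
    show "((\<lambda>t. p1 \<kappa> (Complex s t)) has_real_derivative p2 \<kappa> (Complex s t)) (at t)"
      unfolding p1_def p2_def
      by (rule derivative_eq_intros pt[of "a - 1", unfolded 2] dY that refl)+ (simp add: algebra_simps power2_eq_square)
  qed
  note cs = slice[OF contH, unfolded case_prod_unfold] slice[OF contD, unfolded case_prod_unfold]
     slice[OF contE, unfolded case_prod_unfold]
  have cq: "continuous_on ({..<ln R} \<times> UNIV) (\<lambda>x. Y \<kappa> (H (Complex (fst x) (snd x))) powr a)"
    "continuous_on ({..<ln R} \<times> UNIV) (\<lambda>x. q1 \<kappa> (Complex (fst x) (snd x)))"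
    "continuous_on ({..<ln R} \<times> UNIV) (\<lambda>x. q2 \<kappa> (Complex (fst x) (snd x)))"
    if "\<kappa> \<ge> 0" for \<kappa>
  proof -
    have 1: "continuous_on ({..<ln R} \<times> UNIV) (\<lambda>x. Y \<kappa> (H (Complex (fst x) (snd x))))"
      unfolding Y_def by (intro continuous_intros cs)
    have 2: "continuous_on ({..<ln R} \<times> UNIV) (\<lambda>x. Y \<kappa> (H (Complex (fst x) (snd x))) powr b)" for b
      by (intro continuous_on_powr 1 continuous_intros) (use Ypos[OF that] in \<open>auto simp: less_imp_neq[symmetric]\<close>)
    have 3: "continuous_on ({..<ln R} \<times> UNIV) (\<lambda>x. Ys \<kappa> (Complex (fst x) (snd x)))"
      "continuous_on ({..<ln R} \<times> UNIV) (\<lambda>x. Yss \<kappa> (Complex (fst x) (snd x)))"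
      unfolding Ys_def Yss_def by (intro continuous_intros cs)+
    show "continuous_on ({..<ln R} \<times> UNIV) (\<lambda>x. Y \<kappa> (H (Complex (fst x) (snd x))) powr a)"
      "continuous_on ({..<ln R} \<times> UNIV) (\<lambda>x. q1 \<kappa> (Complex (fst x) (snd x)))"
      "continuous_on ({..<ln R} \<times> UNIV) (\<lambda>x. q2 \<kappa> (Complex (fst x) (snd x)))"
      unfolding q1_def q2_def by (intro continuous_intros 2 3)+
  qed
  have \<Psi>: "\<Psi> (H z) = c * Y 0 (H z) powr a + d * Y 1 (H z) powr a" for z
    by (simp add: \<Psi>_def Y_def cmod_power2 add.assoc)
  define m where "m = circle_mean (\<lambda>z. \<Psi> (F z))"
  have ex: "exp (Complex s t) = of_real (exp s) * cis t" for s t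
    by (simp add: exp_eq_polar)
  have m: "integral {0..2*pi} (\<lambda>t. \<Psi> (H (Complex s t))) = 2 * pi * m (exp s)" for s
    unfolding m_def circle_mean_def H_def by (simp add: ex)
  have cont\<Psi>: "continuous_on (ball 0 R) (\<lambda>z. \<Psi> (F z))"
    unfolding \<Psi>_def
    by (intro continuous_intros continuous_on_powr holomorphic_on_imp_continuous_on[OF F])
       (use \<epsilon> in \<open>auto simp: add_nonneg_eq_0_iff\<close>)
  have contm: "continuous_on {0..<R} m"
    unfolding m_def by (rule continuous_on_circle_mean[OF cont\<Psi>])
  \<comment> \<open>Continuity up to the centre bounds the means for radii at most R/2. This is the
    upper bound needed as s tends to minus infinity.\<close>
  have "compact (m ` {0..R/2})"
    by (intro compact_continuous_image continuous_on_subset[OF contm]) (use R in auto)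
  then obtain B where B: "\<And>r. r \<in> {0..R/2} \<Longrightarrow> m r \<le> B"
    using compact_imp_bounded bounded_imp_bdd_above by (metis bdd_above.unfold image_eqI)
  have mono: "m r1 \<le> m r2" if "0 < r1" "r1 \<le> r2" "r2 < R" for r1 r2
  proof -
    have "integral {0..2*pi} (\<lambda>t. \<Psi> (H (Complex (ln r1) t))) \<le> integral {0..2*pi} (\<lambda>t. \<Psi> (H (Complex (ln r2) t)))"
    proof (rule log_mean_mono[where S = "ln R" and S0 = "ln (R/2)" and B = "2 * pi * B"
          and ?w1.0 = "\<lambda>s t. c * q1 0 (Complex s t) + d * q1 1 (Complex s t)"
          and ?w2.0 = "\<lambda>s t. c * q2 0 (Complex s t) + d * q2 1 (Complex s t)"
          and ?v1.0 = "\<lambda>s t. c * p1 0 (Complex s t) + d * p1 1 (Complex s t)"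
          and ?v2.0 = "\<lambda>s t. c * p2 0 (Complex s t) + d * p2 1 (Complex s t)"])
      fix s t assume s: "s < ln R"
      show "((\<lambda>s. \<Psi> (H (Complex s t))) has_real_derivative c * q1 0 (Complex s t) + d * q1 1 (Complex s t)) (at s)"
        unfolding \<Psi> by (intro DERIV_add DERIV_cmult dq s) auto
      show "((\<lambda>s. c * q1 0 (Complex s t) + d * q1 1 (Complex s t)) has_real_derivative
          c * q2 0 (Complex s t) + d * q2 1 (Complex s t)) (at s)"
        by (intro DERIV_add DERIV_cmult dq s) auto
      show "((\<lambda>t. c * p1 0 (Complex s t) + d * p1 1 (Complex s t)) has_real_derivative
          c * p2 0 (Complex s t) + d * p2 1 (Complex s t)) (at t)"
        by (intro DERIV_add DERIV_cmult dq s) auto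
      define z where "z = Complex s t"
      have L: "q2 \<kappa> z + p2 \<kappa> z = (cmod (D z))\<^sup>2 * (a * Y \<kappa> (H z) powr (a - 2) *
          (2 * (1 + \<kappa>) * Y \<kappa> (H z) + 4 * (a - 1) * ((Re (H z))\<^sup>2 + \<kappa> * (Im (H z))\<^sup>2)))"
        if "\<kappa> \<ge> 0" "\<kappa> * \<kappa> = \<kappa>" for \<kappa>
        unfolding q2_def p2_def Ys_def Yss_def Yt_def Ytt_def
        by (rule powr_laplacian_identity) (use Ypos that in auto)
      have "c * q2 0 z + d * q2 1 z + (c * p2 0 z + d * p2 1 z)
          = c * (q2 0 z + p2 0 z) + d * (q2 1 z + p2 1 z)" by (simp add: algebra_simps)
      also have "\<dots> = (cmod (D z))\<^sup>2 *
         (c * (a * ((Re (H z))\<^sup>2 + \<epsilon>) powr (a - 2) * (2 * ((Re (H z))\<^sup>2 + \<epsilon>) + 4 * (a - 1) * (Re (H z))\<^sup>2))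
         + d * (a * ((Re (H z))\<^sup>2 + (Im (H z))\<^sup>2 + \<epsilon>) powr (a - 2) * (4 * ((Re (H z))\<^sup>2 + (Im (H z))\<^sup>2 + \<epsilon>)
            + 4 * (a - 1) * ((Re (H z))\<^sup>2 + (Im (H z))\<^sup>2))))"
        by (subst (1 2) L) (simp_all add: Y_def algebra_simps)
      also have "\<dots> \<ge> 0"
        by (intro mult_nonneg_nonneg lap) auto
      finally show "0 \<le> c * q2 0 (Complex s t) + d * q2 1 (Complex s t) + (c * p2 0 (Complex s t) + d * p2 1 (Complex s t))"
        by (simp add: z_def)
    next
      fix s assume "s < ln R"
      have "exp (Complex s (2 * pi)) = exp (Complex s 0)" by (simp add: ex)
      then show "c * p1 0 (Complex s (2*pi)) + d * p1 1 (Complex s (2*pi)) = c * p1 0 (Complex s 0) + d * p1 1 (Complex s 0)"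
        by (simp add: p1_def Yt_def H_def D_def)
    next
      fix s assume "s \<le> ln (R/2)"
      then have "exp s \<le> R/2" using R by (metis exp_le_cancel_iff exp_ln half_gt_zero)
      then show "integral {0..2*pi} (\<lambda>t. \<Psi> (H (Complex s t))) \<le> 2 * pi * B"
        unfolding m by (intro mult_left_mono B) auto
    qed (use that in \<open>auto simp: case_prod_unfold \<Psi> intro!: continuous_intros cq\<close>)
    then show ?thesis using that unfolding m by simp
  qed
  \<comment> \<open>Radius 0 lies outside the logarithmic chart and is reached as a limit of
    positive radii.\<close>
  show ?thesis
  proof (cases "r1 = 0")
    case False
    then show ?thesis using mono r by (simp add: m_def)
  next
    case True
    show ?thesis
    proof (cases "r2 = 0")
      case r2: False
      have "(m \<longlongrightarrow> m 0) (at 0 within {0..<R})"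
        using contm R by (simp add: continuous_on_def)
      then have "(m \<longlongrightarrow> m 0) (at 0 within {0<..<R})"
        by (rule tendsto_within_subset) auto
      moreover have "eventually (\<lambda>r. m r \<le> m r2) (at 0 within {0<..<R})"
        unfolding eventually_at using r r2 True mono
        by (intro exI[of _ r2]) (auto simp: dist_real_def)
      moreover have "at (0::real) within {0<..<R} \<noteq> bot"
        using R by (simp add: at_within_eq_bot_iff)
      ultimately have "m 0 \<le> m r2" by (metis tendsto_upperbound)
      then show ?thesis using True by (simp add: m_def)
    qed (use True in simp)
  qed
qed

section \<open>The conjugate function theorem\<close>

lemma circle_mean_linear:
  assumes "continuous_on (sphere 0 r) \<phi>" "continuous_on (sphere 0 r) \<psi>" "0 \<le> r"
  shows "circle_mean (\<lambda>z. a * \<phi> z + b * \<psi> z) r = a * circle_mean \<phi> r + b * circle_mean \<psi> r"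
  by (subst circle_mean_add) (simp_all only: circle_mean_cmult continuous_on_mult_left assms)

lemma powr_half_square: "(x\<^sup>2) powr (q / 2) = \<bar>x\<bar> powr q" for x q :: real
proof -
  have "(\<bar>x\<bar> powr 2) powr (q / 2) = \<bar>x\<bar> powr q" by (simp only: powr_powr) simp
  then show ?thesis by simp
qed

lemma continuous_on_norm_powr:
  fixes f :: "complex \<Rightarrow> 'a::real_normed_vector"
  assumes "continuous_on S f" "0 < q"
  shows "continuous_on S (\<lambda>z. norm (f z) powr q)"
  by (rule continuous_on_powr') (use assms in \<open>auto intro!: continuous_intros\<close>)

lemma holomorphic_on_sphere_continuous:
  assumes "F holomorphic_on ball 0 R" "r < R"
  shows "continuous_on (sphere 0 r) F"
  by (rule holomorphic_on_imp_continuous_on, rule holomorphic_on_subset[OF assms(1)]) (use assms in auto)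

lemma powr_add_le:
  fixes x y q :: real
  assumes "0 \<le> x" "0 \<le> y" "0 < q"
  shows "(x + y) powr q \<le> 2 powr q * (x powr q + y powr q)"
proof -
  have "(x + y) powr q \<le> (2 * max x y) powr q" by (rule powr_mono2) (use assms in auto)
  also have "\<dots> = 2 powr q * (max x y powr q)" using assms by (simp add: powr_mult)
  also have "\<dots> \<le> 2 powr q * (x powr q + y powr q)"
    by (rule mult_left_mono) (auto simp: max_def)
  finally show ?thesis .
qed

lemma circle_mean_regularize:
  assumes u: "continuous_on (sphere 0 r) u" "\<And>z. 0 \<le> u z" and r: "0 \<le> r" and a: "0 < a"
  shows "(\<lambda>n. circle_mean (\<lambda>z. (u z + 1 / real (Suc n)) powr a) r) \<longlonglongrightarrow> circle_mean (\<lambda>z. u z powr a) r"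
proof -
  have "compact (u ` sphere 0 r)"
    by (intro compact_continuous_image u) auto
  then have "bdd_above (u ` sphere 0 r)"
    by (intro bounded_imp_bdd_above compact_imp_bounded)
  then obtain B where "\<forall>x\<in>u ` sphere 0 r. x \<le> B"
    unfolding bdd_above_def by blast
  then have B: "u z \<le> B" if "norm z = r" for z
    using that by simp
  show ?thesis
  proof (rule circle_mean_dominated[where B = "(B + 1) powr a"])
    fix n show "continuous_on (sphere 0 r) (\<lambda>z. (u z + 1 / real (Suc n)) powr a)"
      by (rule continuous_on_powr') (use assms in \<open>auto intro!: continuous_intros\<close>)
    fix z :: complex assume "norm z = r"
    then have "(u z + 1 / real (Suc n)) powr a \<le> (B + 1) powr a"
      using B[of z] u(2)[of z] a by (intro powr_mono2 add_mono) auto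
    then show "\<bar>(u z + 1 / real (Suc n)) powr a\<bar> \<le> (B + 1) powr a" by simp
  next
    fix z :: complex
    have "(\<lambda>n. u z + 1 / real (Suc n)) \<longlonglongrightarrow> u z + 0"
      by (intro tendsto_intros LIMSEQ_Suc[OF lim_1_over_n])
    then show "(\<lambda>n. (u z + 1 / real (Suc n)) powr a) \<longlonglongrightarrow> u z powr a"
      by (intro tendsto_powr') (use u(2) a in auto)
  qed (use r in auto)
qed

text \<open>The smoothed inequality for a = q/2 passes to the limit along \<epsilon> = 1/(n+1). The
  smoothing is there because for q < 2 the function |Re F|^q is in general not twice differentiable
  at zeros of Re F.\<close>

lemma circle_mean_subharmonic_powr_mono:
  fixes F :: "complex \<Rightarrow> complex" and q c d :: real
  assumes F: "F holomorphic_on ball 0 R" and q: "0 < q"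
    and lap: "\<And>x y \<epsilon>. 0 \<le> x \<Longrightarrow> 0 \<le> y \<Longrightarrow> 0 < \<epsilon> \<Longrightarrow>
       0 \<le> c * (q/2 * (x + \<epsilon>) powr (q/2 - 2) * (2 * (x + \<epsilon>) + 4 * (q/2 - 1) * x))
         + d * (q/2 * (x + y + \<epsilon>) powr (q/2 - 2) * (4 * (x + y + \<epsilon>) + 4 * (q/2 - 1) * (x + y)))"
    and r: "0 \<le> r1" "r1 \<le> r2" "r2 < R"
  shows "c * circle_mean (\<lambda>z. \<bar>Re (F z)\<bar> powr q) r1 + d * circle_mean (\<lambda>z. norm (F z) powr q) r1
       \<le> c * circle_mean (\<lambda>z. \<bar>Re (F z)\<bar> powr q) r2 + d * circle_mean (\<lambda>z. norm (F z) powr q) r2"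
proof -
  let ?m = "\<lambda>n r. c * circle_mean (\<lambda>z. ((Re (F z))\<^sup>2 + 1 / real (Suc n)) powr (q/2)) r
       + d * circle_mean (\<lambda>z. ((norm (F z))\<^sup>2 + 1 / real (Suc n)) powr (q/2)) r"
  have lim: "(\<lambda>n. ?m n r) \<longlonglongrightarrow>
     c * circle_mean (\<lambda>z. \<bar>Re (F z)\<bar> powr q) r + d * circle_mean (\<lambda>z. norm (F z) powr q) r"
    if "0 \<le> r" "r < R" for r
  proof -
    note cF = holomorphic_on_sphere_continuous[OF F that(2)]
    have "(\<lambda>n. ?m n r) \<longlonglongrightarrow> c * circle_mean (\<lambda>z. ((Re (F z))\<^sup>2) powr (q/2)) r
         + d * circle_mean (\<lambda>z. ((norm (F z))\<^sup>2) powr (q/2)) r"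
      by (intro tendsto_intros circle_mean_regularize continuous_intros cF) (use that q in auto)
    then show ?thesis by (simp add: powr_half_square)
  qed
  have "?m n r1 \<le> ?m n r2" for n
  proof -
    have eq: "?m n r = circle_mean (\<lambda>z. c * ((Re (F z))\<^sup>2 + 1 / real (Suc n)) powr (q/2)
        + d * ((norm (F z))\<^sup>2 + 1 / real (Suc n)) powr (q/2)) r" if "0 \<le> r" "r < R" for r
    proof -
      note cF = holomorphic_on_sphere_continuous[OF F that(2)]
      show ?thesis
        using that q by (subst circle_mean_add)
          (auto simp: circle_mean_cmult intro!: continuous_intros cF continuous_on_powr')
    qed
    show ?thesis
      unfolding eq[OF r(1) order.strict_trans1[OF r(2,3)]] eq[OF order.trans[OF r(1,2)] r(3)]
      by (rule circle_mean_subharmonic_mono[OF F _ lap r]) auto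
  qed
  then show ?thesis
    by (intro LIMSEQ_le[OF lim lim]) (use r in auto)
qed

text \<open>The case c = 0, d = 1: the bracket equals 4 \<epsilon> + 2 q (x + y), which is positive
  for every q > 0. This is what lets one circle control all smaller ones, including the
  centre.\<close>

lemma circle_mean_norm_powr_mono:
  assumes "F holomorphic_on ball 0 R" "0 < q" "0 \<le> r1" "r1 \<le> r2" "r2 < R"
  shows "circle_mean (\<lambda>z. norm (F z) powr q) r1 \<le> circle_mean (\<lambda>z. norm (F z) powr q) r2"
proof -
  have "0 * circle_mean (\<lambda>z. \<bar>Re (F z)\<bar> powr q) r1 + 1 * circle_mean (\<lambda>z. norm (F z) powr q) r1
       \<le> 0 * circle_mean (\<lambda>z. \<bar>Re (F z)\<bar> powr q) r2 + 1 * circle_mean (\<lambda>z. norm (F z) powr q) r2"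
  proof (rule circle_mean_subharmonic_powr_mono[OF assms(1,2) _ assms(3-5)])
    fix x y \<epsilon> :: real assume *: "0 \<le> x" "0 \<le> y" "0 < \<epsilon>"
    have "4 * (x + y + \<epsilon>) + 4 * (q/2 - 1) * (x + y) = 4 * \<epsilon> + 2 * q * (x + y)"
      by (simp add: algebra_simps)
    also have "\<dots> \<ge> 0" using * assms by simp
    finally have "0 \<le> q/2 * (x + y + \<epsilon>) powr (q/2 - 2) * (4 * (x + y + \<epsilon>) + 4 * (q/2 - 1) * (x + y))"
      using assms by (intro mult_nonneg_nonneg) auto
    then show "0 \<le> 0 * (q/2 * (x + \<epsilon>) powr (q/2 - 2) * (2 * (x + \<epsilon>) + 4 * (q/2 - 1) * x))
         + 1 * (q/2 * (x + y + \<epsilon>) powr (q/2 - 2) * (4 * (x + y + \<epsilon>) + 4 * (q/2 - 1) * (x + y)))"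
      by simp
  qed
  then show ?thesis by simp
qed

text \<open>The case c = 1, d = 0, compared with the centre; the bracket 2 \<epsilon> + 2 (q - 1) x
  is where q >= 1 enters.\<close>

lemma abs_Re_powr_le_circle_mean:
  assumes "F holomorphic_on ball 0 R" "1 \<le> q" "0 \<le> r" "r < R"
  shows "\<bar>Re (F 0)\<bar> powr q \<le> circle_mean (\<lambda>z. \<bar>Re (F z)\<bar> powr q) r"
proof -
  have "1 * circle_mean (\<lambda>z. \<bar>Re (F z)\<bar> powr q) 0 + 0 * circle_mean (\<lambda>z. norm (F z) powr q) 0
       \<le> 1 * circle_mean (\<lambda>z. \<bar>Re (F z)\<bar> powr q) r + 0 * circle_mean (\<lambda>z. norm (F z) powr q) r"
  proof (rule circle_mean_subharmonic_powr_mono[OF assms(1) _ _ _ assms(3,4)])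
    fix x y \<epsilon> :: real assume *: "0 \<le> x" "0 \<le> y" "0 < \<epsilon>"
    have "2 * (x + \<epsilon>) + 4 * (q/2 - 1) * x = 2 * \<epsilon> + 2 * ((q - 1) * x)"
      by (simp add: algebra_simps)
    also have "\<dots> \<ge> 0" using * assms by (intro add_nonneg_nonneg mult_nonneg_nonneg) auto
    finally have "0 \<le> q/2 * (x + \<epsilon>) powr (q/2 - 2) * (2 * (x + \<epsilon>) + 4 * (q/2 - 1) * x)"
      using assms by (intro mult_nonneg_nonneg) auto
    then show "0 \<le> 1 * (q/2 * (x + \<epsilon>) powr (q/2 - 2) * (2 * (x + \<epsilon>) + 4 * (q/2 - 1) * x))
         + 0 * (q/2 * (x + y + \<epsilon>) powr (q/2 - 2) * (4 * (x + y + \<epsilon>) + 4 * (q/2 - 1) * (x + y)))"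
      by simp
  qed (use assms in auto)
  then show ?thesis by simp
qed

text \<open>For this c the function c |Re F|^q - |F|^q is subharmonic. Per unit of |F'|^2, the
  Laplacian of the smoothed modulus term is at most 2 q (x + y + \<epsilon>)^(q/2 - 1), that of the
  real part at least q (q - 1) (x + \<epsilon>)^(q/2 - 1), and 2 / (q - 1) is the ratio of the two
  factors. At the centre F is real, so c >= 1 makes the value nonnegative.\<close>

lemma riesz_conjugate_le2:
  assumes F: "F holomorphic_on ball 0 R" "Im (F 0) = 0" and q: "1 < q" "q \<le> 2" and r: "0 \<le> r" "r < R"
  shows "circle_mean (\<lambda>z. norm (F z) powr q) r \<le> 2 / (q - 1) * circle_mean (\<lambda>z. \<bar>Re (F z)\<bar> powr q) r"
proof -
  define c where "c = 2 / (q - 1)"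
  have c: "c \<ge> 1" "c * (q - 1) = 2" using q by (auto simp: c_def field_simps)
  have "c * circle_mean (\<lambda>z. \<bar>Re (F z)\<bar> powr q) 0 + (-1) * circle_mean (\<lambda>z. norm (F z) powr q) 0
       \<le> c * circle_mean (\<lambda>z. \<bar>Re (F z)\<bar> powr q) r + (-1) * circle_mean (\<lambda>z. norm (F z) powr q) r"
  proof (rule circle_mean_subharmonic_powr_mono[OF F(1) _ _ _ r])
    fix x y \<epsilon> :: real assume *: "0 \<le> x" "0 \<le> y" "0 < \<epsilon>"
    have p: "t powr (q/2 - 1) = t powr (q/2 - 2) * t" if "t > 0" for t :: real
      using powr_add[of t "q/2 - 2" 1] that by simp
    have "q/2 * (x + y + \<epsilon>) powr (q/2 - 2) * (4 * (x + y + \<epsilon>) + 4 * (q/2 - 1) * (x + y))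
       \<le> q/2 * (x + y + \<epsilon>) powr (q/2 - 2) * (4 * (x + y + \<epsilon>))"
      using * q by (intro mult_left_mono) (auto simp: mult_nonpos_nonneg)
    also have "\<dots> = 2 * q * (x + y + \<epsilon>) powr (q/2 - 1)"
      using * by (simp add: p)
    \<comment> \<open>The exponent q/2 - 1 is not positive, so dropping y does not decrease the
      power.\<close>
    also have "\<dots> \<le> 2 * q * (x + \<epsilon>) powr (q/2 - 1)"
      using * q by (intro mult_left_mono powr_mono2') auto
    also have "\<dots> = (c * (q - 1)) * (q/2 * (x + \<epsilon>) powr (q/2 - 2) * (2 * (x + \<epsilon>)))"
      unfolding c using * by (simp add: p)
    also have "\<dots> = c * (q/2 * (x + \<epsilon>) powr (q/2 - 2) * (2 * (q - 1) * (x + \<epsilon>)))"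
      by (simp only: ac_simps)
    also have "\<dots> \<le> c * (q/2 * (x + \<epsilon>) powr (q/2 - 2) * (2 * (x + \<epsilon>) + 4 * (q/2 - 1) * x))"
    proof (intro mult_left_mono)
      have "(2 * (x + \<epsilon>) + 4 * (q/2 - 1) * x) - 2 * (q - 1) * (x + \<epsilon>) = 2 * (2 - q) * \<epsilon>"
        by (simp add: algebra_simps)
      moreover have "\<dots> \<ge> 0" using q * by simp
      ultimately show "2 * (q - 1) * (x + \<epsilon>) \<le> 2 * (x + \<epsilon>) + 4 * (q/2 - 1) * x" by linarith
    qed (use c q in auto)
    finally show "0 \<le> c * (q/2 * (x + \<epsilon>) powr (q/2 - 2) * (2 * (x + \<epsilon>) + 4 * (q/2 - 1) * x))
         + (-1) * (q/2 * (x + y + \<epsilon>) powr (q/2 - 2) * (4 * (x + y + \<epsilon>) + 4 * (q/2 - 1) * (x + y)))"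
      by simp
  qed (use q in auto)
  moreover have "norm (F 0) = \<bar>Re (F 0)\<bar>" using F(2) by (simp add: cmod_def)
  moreover have "1 * \<bar>Re (F 0)\<bar> powr q \<le> c * \<bar>Re (F 0)\<bar> powr q"
    by (rule mult_right_mono) (use c in auto)
  ultimately show ?thesis by (simp add: c_def)
qed

text \<open>Apply the bound for q to H = -i (F^2 - a^2), which vanishes at 0 and has real part 2 Re
  F Im F. The product of |Re F|^q and |F|^q is split by the inequality between geometric and
  arithmetic means, and half of the mean of |F|^(2q), a finite number, is absorbed on the
  left.\<close>

lemma riesz_conjugate_double:
  assumes C: "0 \<le> C" "\<And>F R r. F holomorphic_on ball 0 R \<Longrightarrow> Im (F 0) = 0 \<Longrightarrow> 0 \<le> r \<Longrightarrow> r < R \<Longrightarrow>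
      circle_mean (\<lambda>z. norm (F z) powr q) r \<le> C * circle_mean (\<lambda>z. \<bar>Re (F z)\<bar> powr q) r"
    and F: "F holomorphic_on ball 0 R" "Im (F 0) = 0" and q: "1 < q" and r: "0 \<le> r" "r < R"
  shows "circle_mean (\<lambda>z. norm (F z) powr (2 * q)) r
      \<le> ((2 powr q * C * 2 powr q)\<^sup>2 + 2 * 2 powr q) * circle_mean (\<lambda>z. \<bar>Re (F z)\<bar> powr (2 * q)) r"
proof -
  define a where "a = Re (F 0)"
  define H where "H z = - \<i> * ((F z)\<^sup>2 - of_real (a\<^sup>2))" for z
  \<comment> \<open>One factor 2^q comes from splitting F^2 = i H + a^2, the other from the 2 in Re
    H = 2 Re F Im F.\<close>
  define K where "K = 2 powr q * C * 2 powr q"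
  have F0: "F 0 = of_real a" using F(2) by (simp add: a_def complex_eq_iff)
  have H: "H holomorphic_on ball 0 R" unfolding H_def by (intro holomorphic_intros F)
  have H0: "H 0 = 0" by (simp add: H_def F0)
  have ReH: "Re (H z) = 2 * Re (F z) * Im (F z)" for z
    by (simp add: H_def power2_eq_square)
  note cF = holomorphic_on_sphere_continuous[OF F(1) r(2)] and cH = holomorphic_on_sphere_continuous[OF H r(2)]
  have cRe: "continuous_on (sphere 0 r) (\<lambda>z. \<bar>Re (F z)\<bar> powr s)" if "s > 0" for s
    using continuous_on_norm_powr[OF continuous_on_Re[OF cF] that] by simp
  have cReH: "continuous_on (sphere 0 r) (\<lambda>z. \<bar>Re (H z)\<bar> powr q)"
    using continuous_on_norm_powr[OF continuous_on_Re[OF cH], of q] q by simp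
  have sq: "x powr (2 * q) = (x powr q)\<^sup>2" if "x \<ge> 0" for x :: real
    using that by (simp add: power2_eq_square flip: powr_add)
  let ?A = "circle_mean (\<lambda>z. norm (F z) powr (2 * q)) r" and ?U = "circle_mean (\<lambda>z. \<bar>Re (F z)\<bar> powr (2 * q)) r"
  have "?A \<le> circle_mean (\<lambda>z. 2 powr q * (norm (H z) powr q + \<bar>a\<bar> powr (2 * q))) r"
  proof (rule circle_mean_mono)
    fix z
    have "(F z)\<^sup>2 = \<i> * H z + of_real (a\<^sup>2)" by (simp add: H_def flip: mult.assoc)
    then have "(norm (F z))\<^sup>2 \<le> norm (H z) + a\<^sup>2"
      using norm_triangle_ineq[of "\<i> * H z" "of_real (a\<^sup>2)"] norm_power[of "F z" 2]
      by (simp add: norm_mult norm_power)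
    then have "((norm (F z))\<^sup>2) powr q \<le> (norm (H z) + a\<^sup>2) powr q"
      using q by (intro powr_mono2) auto
    also have "\<dots> \<le> 2 powr q * (norm (H z) powr q + (a\<^sup>2) powr q)"
      by (rule powr_add_le) (use q in auto)
    finally show "norm (F z) powr (2 * q) \<le> 2 powr q * (norm (H z) powr q + \<bar>a\<bar> powr (2 * q))"
      using powr_half_square[of "norm (F z)" "2 * q"] powr_half_square[of a "2 * q"] by simp
  qed (use q r in \<open>auto intro!: continuous_intros continuous_on_norm_powr cF cH\<close>)
  also have "\<dots> = 2 powr q * (circle_mean (\<lambda>z. norm (H z) powr q) r + \<bar>a\<bar> powr (2 * q))"
    unfolding circle_mean_cmult using q r
    by (subst circle_mean_add) (auto intro!: continuous_intros continuous_on_norm_powr cF cH)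
  also have "\<dots> \<le> 2 powr q * (C * circle_mean (\<lambda>z. \<bar>Re (H z)\<bar> powr q) r + ?U)"
    using C(2)[OF H _ r] H0 abs_Re_powr_le_circle_mean[OF F(1) _ r, of "2 * q"] q
    by (intro mult_left_mono add_mono) (auto simp: a_def)
  also have "\<dots> = circle_mean (\<lambda>z. 2 powr q * C * \<bar>Re (H z)\<bar> powr q) r + 2 powr q * ?U"
    by (simp add: circle_mean_cmult algebra_simps)
  also have "circle_mean (\<lambda>z. 2 powr q * C * \<bar>Re (H z)\<bar> powr q) r
      \<le> circle_mean (\<lambda>z. (K\<^sup>2 / 2) * \<bar>Re (F z)\<bar> powr (2 * q) + (1/2) * norm (F z) powr (2 * q)) r"
  proof (rule circle_mean_mono)
    fix z
    let ?x = "\<bar>Re (F z)\<bar> powr q" and ?y = "norm (F z) powr q"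
    have "\<bar>Re (H z)\<bar> powr q = 2 powr q * (?x * \<bar>Im (F z)\<bar> powr q)"
      by (simp add: ReH abs_mult powr_mult mult.assoc)
    also have "\<dots> \<le> 2 powr q * (?x * ?y)"
      using q abs_Im_le_cmod by (intro mult_left_mono powr_mono2) auto
    finally have "2 powr q * C * \<bar>Re (H z)\<bar> powr q \<le> 2 powr q * C * (2 powr q * (?x * ?y))"
      using C by (intro mult_left_mono) auto
    also have "\<dots> = (K * ?x) * ?y" by (simp add: K_def)
    also have "\<dots> \<le> (K\<^sup>2 / 2) * ?x\<^sup>2 + (1/2) * ?y\<^sup>2"
      using sum_squares_bound[of "K * ?x" ?y] by (simp add: power_mult_distrib)
    finally show "2 powr q * C * \<bar>Re (H z)\<bar> powr q
       \<le> (K\<^sup>2 / 2) * \<bar>Re (F z)\<bar> powr (2 * q) + (1/2) * norm (F z) powr (2 * q)"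
      by (simp add: sq)
  qed (use q r in \<open>auto intro!: continuous_intros continuous_on_norm_powr cF cRe cReH\<close>)
  also have "\<dots> = (K\<^sup>2 / 2) * ?U + (1/2) * ?A"
    using q r by (intro circle_mean_linear continuous_on_norm_powr cF cRe) auto
  finally show ?thesis by (simp add: K_def algebra_simps)
qed

text \<open>\<open>C\<close> is chosen before F, R and r: suprema over radii need this uniformity.
  Halving an exponent above 2 keeps it above 1, so finitely many doublings lead from the range
  between 1 and 2 to every q.\<close>

theorem riesz_conjugate:
  assumes "1 < q"
  obtains C where "0 \<le> C" "\<And>F R r. F holomorphic_on ball 0 R \<Longrightarrow> Im (F 0) = 0 \<Longrightarrow> 0 \<le> r \<Longrightarrow> r < R \<Longrightarrow>
      circle_mean (\<lambda>z. norm (F z) powr q) r \<le> C * circle_mean (\<lambda>z. \<bar>Re (F z)\<bar> powr q) r"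
proof -
  define good where "good q C \<longleftrightarrow> 0 \<le> C \<and> (\<forall>F R r. F holomorphic_on ball 0 R \<longrightarrow> Im (F 0) = 0 \<longrightarrow> 0 \<le> r \<longrightarrow> r < R \<longrightarrow>
      circle_mean (\<lambda>z. norm (F z) powr q) r \<le> C * circle_mean (\<lambda>z. \<bar>Re (F z)\<bar> powr q) r)" for q C
  have le2: "good q (2 / (q - 1))" if "1 < q" "q \<le> 2" for q
    unfolding good_def using riesz_conjugate_le2 that by simp
  have ex: "\<exists>C. good q C" if "q \<le> 2 ^ Suc n" "1 < q" for n
    using that
  proof (induction n arbitrary: q)
    case 0
    then show ?case using le2[of q] by (intro exI[of _ "2 / (q - 1)"]) simp
  next
    case (Suc n)
    show ?case
    proof (cases "q \<le> 2")
      case True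
      then show ?thesis using le2[of q] Suc.prems by blast
    next
      case False
      then have q: "1 < q/2" "q/2 \<le> 2 ^ Suc n" using Suc.prems by auto
      obtain C where "good (q/2) C" using Suc.IH[OF q(2,1)] by blast
      then have C: "0 \<le> C" "\<And>F R r. F holomorphic_on ball 0 R \<Longrightarrow> Im (F 0) = 0 \<Longrightarrow> 0 \<le> r \<Longrightarrow> r < R \<Longrightarrow>
          circle_mean (\<lambda>z. norm (F z) powr (q/2)) r \<le> C * circle_mean (\<lambda>z. \<bar>Re (F z)\<bar> powr (q/2)) r"
        unfolding good_def by blast+
      have q2: "2 * (q / 2) = q" by simp
      have "good q ((2 powr (q/2) * C * 2 powr (q/2))\<^sup>2 + 2 * 2 powr (q/2))"
        unfolding good_def
        by (intro conjI allI impI riesz_conjugate_double[OF C _ _ q(1), unfolded q2]) auto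
      then show ?thesis by blast
    qed
  qed
  obtain n where "q < 2 ^ n" using real_arch_pow[of 2 q] by auto
  moreover have "(0::real) \<le> 2 ^ n" by simp
  ultimately have "q \<le> 2 ^ Suc n" by (simp only: power_Suc)
  then obtain C where "good q C" using ex assms by blast
  then show thesis using that unfolding good_def by blast
qed

section \<open>Taylor tails and multipliers of bounded variation\<close>

lemma suminf_dominated:
  fixes a :: "nat \<Rightarrow> nat \<Rightarrow> complex"
  assumes "\<And>k. (\<lambda>n. a k n) \<longlonglongrightarrow> b k" "\<And>k n. norm (a k n) \<le> M k" "summable M"
  shows "(\<lambda>n. \<Sum>k. a k n) \<longlonglongrightarrow> (\<Sum>k. b k)"
proof -
  have "eventually (\<lambda>(k, n). norm (a k n) \<le> M k) (at_top \<times>\<^sub>F sequentially)"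
    using assms(2) by (intro always_eventually) auto
  from tannerys_theorem[OF assms(1) this assms(3)] show ?thesis by simp
qed

lemma analytic_series_abs:
  assumes "analytic_series c" "norm z < 1"
  shows "summable (\<lambda>n. norm (c n * z ^ n))"
proof (rule powser_insidea)
  show "summable (\<lambda>n. c n * of_real ((1 + norm z) / 2) ^ n)"
    using assms unfolding analytic_series_def by (auto simp: norm_divide simp flip: of_real_add)
  show "norm z < norm (complex_of_real ((1 + norm z) / 2))"
    using assms(2) by (simp only: norm_of_real) simp
qed

lemma analytic_series_sums:
  assumes "analytic_series c" "norm z < 1"
  shows "(\<lambda>n. c n * z ^ n) sums series_fun c z"
  unfolding series_fun_def using summable_norm_cancel[OF analytic_series_abs[OF assms]] by (rule summable_sums)

lemma analytic_seriesI_le: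
  assumes "analytic_series c" "\<And>n. norm (d n) \<le> B * norm (c n)"
  shows "analytic_series d"
  unfolding analytic_series_def
proof
  fix z :: complex assume "z \<in> ball 0 1"
  then have "summable (\<lambda>n. B * norm (c n * z ^ n))"
    using analytic_series_abs[OF assms(1), of z] by (intro summable_mult) auto
  then show "summable (\<lambda>n. d n * z ^ n)"
  proof (rule summable_comparison_test'[where N = 0])
    fix n show "norm (d n * z ^ n) \<le> B * norm (c n * z ^ n)"
      using assms(2)[of n] by (simp add: norm_mult flip: mult.assoc) (intro mult_right_mono, auto)
  qed
qed

lemma series_fun_holomorphic:
  assumes "analytic_series c"
  shows "series_fun c holomorphic_on ball 0 1"
  by (rule power_series_holomorphic[where a = c]) (use analytic_series_sums[OF assms] in auto)

lemma analytic_series_diffs: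
  assumes "analytic_series c"
  shows "analytic_series (diffs c)"
  unfolding analytic_series_def
  using termdiff_converges[where c = c and K = 1] assms by (auto simp: analytic_series_def)

lemma deriv_series_fun:
  assumes "analytic_series c" "norm z < 1"
  shows "deriv (series_fun c) z = series_fun (diffs c) z"
proof -
  have "(series_fun c has_field_derivative series_fun (diffs c) z) (at z)"
    unfolding series_fun_def
    by (rule termdiffs_strong'[where K = 1]) (use assms in \<open>auto simp: analytic_series_def\<close>)
  then show ?thesis by (rule DERIV_imp_deriv)
qed

lemma holomorphic_series:
  assumes "f holomorphic_on ball 0 1"
  defines "a \<equiv> \<lambda>n. fps_nth (fps_expansion f 0) n"
  shows "analytic_series a" "\<And>z. norm z < 1 \<Longrightarrow> f z = series_fun a z"
proof -
  have "(\<lambda>n. a n * z ^ n) sums f z" if "norm z < 1" for z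
    using holomorphic_power_series[OF assms(1), of z] that by (simp add: a_def fps_expansion_def)
  then show "analytic_series a" "\<And>z. norm z < 1 \<Longrightarrow> f z = series_fun a z"
    by (auto simp: analytic_series_def series_fun_def sums_iff)
qed

lemma analytic_series_shift:
  assumes "analytic_series c"
  shows "analytic_series (\<lambda>n. c (n + k))"
  unfolding analytic_series_def
proof
  fix z :: complex assume z: "z \<in> ball 0 1"
  show "summable (\<lambda>n. c (n + k) * z ^ n)"
  proof (cases "z = 0")
    case False
    have "summable (\<lambda>n. c n * z ^ n)" using assms z by (simp add: analytic_series_def)
    then have "summable (\<lambda>n. z ^ k * (c (n + k) * z ^ n))"
      by (drule_tac k = k in summable_ignore_initial_segment) (simp add: power_add algebra_simps)
    then show ?thesis using False by (simp add: summable_cmult_iff)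
  qed (simp add: summable_0_powser)
qed

lemma series_fun_split:
  assumes "analytic_series c" "norm z < 1"
  shows "series_fun c z = (\<Sum>n<k. c n * z ^ n) + z ^ k * series_fun (\<lambda>n. c (n + k)) z"
proof -
  have s: "summable (\<lambda>n. c n * z ^ n)"
    using analytic_series_sums[OF assms] by (rule sums_summable)
  have "series_fun c z = (\<Sum>n. c (n + k) * z ^ (n + k)) + (\<Sum>n<k. c n * z ^ n)"
    unfolding series_fun_def by (rule suminf_split_initial_segment[OF s])
  also have "(\<Sum>n. c (n + k) * z ^ (n + k)) = z ^ k * series_fun (\<lambda>n. c (n + k)) z"
  proof -
    have "z ^ k * series_fun (\<lambda>n. c (n + k)) z = (\<Sum>n. z ^ k * (c (n + k) * z ^ n))"
      unfolding series_fun_def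
      using sums_summable[OF analytic_series_sums[OF analytic_series_shift[OF assms(1)] assms(2)]]
      by (rule suminf_mult[symmetric])
    then show ?thesis by (simp add: power_add algebra_simps)
  qed
  finally show ?thesis by simp
qed

text \<open>Padding with zeros instead of shifting keeps each z^n with its own coefficient, so that
  a combination of tails is a multiplier applied to \<open>c\<close>.\<close>

definition tail_coeff :: "nat \<Rightarrow> (nat \<Rightarrow> complex) \<Rightarrow> nat \<Rightarrow> complex" where
  "tail_coeff k c n = (if n < k then 0 else c n)"

lemma analytic_series_tail:
  assumes "analytic_series c"
  shows "analytic_series (tail_coeff k c)"
  by (rule analytic_seriesI_le[OF assms, of _ 1]) (simp add: tail_coeff_def)

lemma series_fun_tail:
  assumes "analytic_series c" "norm z < 1"
  shows "series_fun (tail_coeff k c) z = z ^ k * series_fun (\<lambda>n. c (n + k)) z"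
  using series_fun_split[OF analytic_series_tail[OF assms(1)] assms(2), of k k]
  by (simp add: tail_coeff_def)

text \<open>On the circle of radius $r$, write $w = z/r$. Up to the unimodular factor $w^{-k}$ the
  series is $A + \overline{N}$, with $A$ analytic of the same modulus as the tail and $N$ a
  polynomial vanishing at the origin, so the conjugate function theorem applies to $A + N$ and to
  $-iA + iN$, whose real parts are the real and imaginary parts of $A + \overline{N}$.\<close>

theorem riesz_tail:
  assumes q: "1 < q"
  obtains C where "0 \<le> C" "\<And>c k r. analytic_series c \<Longrightarrow> 0 < r \<Longrightarrow> r < 1 \<Longrightarrow>
      circle_mean (\<lambda>z. norm (series_fun (tail_coeff k c) z) powr q) r
      \<le> C * circle_mean (\<lambda>z. norm (series_fun c z) powr q) r"
proof -
  obtain C where C: "0 \<le> C" "\<And>F R r. F holomorphic_on ball 0 R \<Longrightarrow> Im (F 0) = 0 \<Longrightarrow> 0 \<le> r \<Longrightarrow> r < R \<Longrightarrow>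
      circle_mean (\<lambda>z. norm (F z) powr q) r \<le> C * circle_mean (\<lambda>z. \<bar>Re (F z)\<bar> powr q) r"
    using riesz_conjugate[OF q] by blast
  show thesis
  proof
    show "0 \<le> 4 powr q * 4 * C" using C by simp
    fix c :: "nat \<Rightarrow> complex" and k :: nat and r :: real
    assume c: "analytic_series c" and r: "0 < r" "r < 1"
    define A where "A z = of_real (r ^ k) * series_fun (\<lambda>n. c (n + k)) z" for z
    \<comment> \<open>On the circle \<open>cnj z\<close> equals r^2 / z, and the weight r^(2n-k)
      makes the conjugate of the n-th monomial equal to r^k z^(-k) times c_n z^n.\<close>
    define N where "N z = (\<Sum>n<k. cnj (c n) * of_real (r ^ n * r ^ n / r ^ k) * z ^ (k - n))" for z
    define h where "h = series_fun c"
    \<comment> \<open>The added constants are imaginary: they make the value at 0 real and leave the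
      real part unchanged.\<close>
    define F1 where "F1 z = A z + N z - \<i> * of_real (Im (A 0))" for z
    define F2 where "F2 z = - \<i> * A z + \<i> * N z + \<i> * of_real (Re (A 0))" for z
    have A: "A holomorphic_on ball 0 1"
      unfolding A_def by (intro holomorphic_intros series_fun_holomorphic analytic_series_shift c)
    have N: "N holomorphic_on ball 0 1" unfolding N_def by (intro holomorphic_intros)
    have F: "F1 holomorphic_on ball 0 1" "F2 holomorphic_on ball 0 1"
      unfolding F1_def F2_def by (intro holomorphic_intros A N)+
    have h: "h holomorphic_on ball 0 1" unfolding h_def by (rule series_fun_holomorphic[OF c])
    have N0: "N 0 = 0" by (auto simp: N_def intro!: sum.neutral)
    have F0: "Im (F1 0) = 0" "Im (F2 0) = 0" by (simp_all add: F1_def F2_def N0)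
    note cont = holomorphic_on_sphere_continuous[OF A r(2)] holomorphic_on_sphere_continuous[OF h r(2)]
      holomorphic_on_sphere_continuous[OF F(1) r(2)] holomorphic_on_sphere_continuous[OF F(2) r(2)]
    have tailA: "norm (series_fun (tail_coeff k c) z) = norm (A z)" if "norm z = r" for z
      using that r by (simp add: series_fun_tail c A_def norm_mult norm_power)
    have AN: "A z + cnj (N z) = of_real (r ^ k) * inverse z ^ k * h z" if z: "norm z = r" for z
    proof -
      have z0: "z \<noteq> 0" using z r by auto
      have zz: "z * cnj z = of_real (r * r)" using z by (simp add: complex_norm_square[symmetric] power2_eq_square)
      have monom: "cnj (cnj (c n) * of_real (r ^ n * r ^ n / r ^ k) * z ^ (k - n)) =
          of_real (r ^ k) * inverse z ^ k * (c n * z ^ n)" if "n < k" for n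
      proof -
        have "of_real (r ^ n * r ^ n) * cnj z ^ (k - n) * z ^ k = z ^ n * cnj z ^ n * cnj z ^ (k - n) * z ^ k"
          using zz by (metis of_real_mult of_real_power power_mult_distrib)
        also have "\<dots> = z ^ n * (cnj z ^ k * z ^ k)"
          using that by (simp add: power_add[symmetric] mult.assoc)
        also have "cnj z ^ k * z ^ k = of_real (r ^ k) * of_real (r ^ k)"
          using zz by (metis mult.commute of_real_mult of_real_power power_mult_distrib)
        finally have "of_real (r ^ n * r ^ n) * cnj z ^ (k - n) * z ^ k = z ^ n * (of_real (r ^ k) * of_real (r ^ k))" .
        then show ?thesis using z0 r by (simp add: field_simps)
      qed
      have "cnj (N z) = of_real (r ^ k) * inverse z ^ k * (\<Sum>n<k. c n * z ^ n)"
        unfolding N_def cnj_sum sum_distrib_left by (rule sum.cong) (use monom in auto)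
      moreover have "A z = of_real (r ^ k) * inverse z ^ k * (z ^ k * series_fun (\<lambda>n. c (n + k)) z)"
        using z0 by (simp add: A_def power_inverse)
      ultimately show ?thesis
        unfolding h_def using series_fun_split[OF c, of z k] z r by (simp add: algebra_simps)
    qed
    have Re_le: "\<bar>Re (F1 z)\<bar> \<le> norm (h z)" "\<bar>Re (F2 z)\<bar> \<le> norm (h z)" if z: "norm z = r" for z
    proof -
      have "norm (A z + cnj (N z)) = norm (h z)"
        unfolding AN[OF z] using z r by (simp add: norm_mult norm_power norm_inverse power_inverse)
      moreover have "Re (F1 z) = Re (A z + cnj (N z))" "Re (F2 z) = Im (A z + cnj (N z))"
        by (simp_all add: F1_def F2_def)
      ultimately show "\<bar>Re (F1 z)\<bar> \<le> norm (h z)" "\<bar>Re (F2 z)\<bar> \<le> norm (h z)"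
        by (metis abs_Re_le_cmod, metis abs_Im_le_cmod)
    qed
    let ?h = "circle_mean (\<lambda>z. norm (h z) powr q) r"
    have bound: "circle_mean (\<lambda>z. norm (F z) powr q) r \<le> C * ?h" "norm (F 0) powr q \<le> C * ?h"
      if "F holomorphic_on ball 0 1" "Im (F 0) = 0" "\<And>z. norm z = r \<Longrightarrow> \<bar>Re (F z)\<bar> \<le> norm (h z)" for F
    proof -
      note cF = holomorphic_on_sphere_continuous[OF that(1) r(2)]
      have "circle_mean (\<lambda>z. \<bar>Re (F z)\<bar> powr q) r \<le> ?h"
        using q r that(3) continuous_on_norm_powr[OF continuous_on_Re[OF cF], of q]
        by (intro circle_mean_mono powr_mono2 continuous_on_norm_powr cont) auto
      then have "C * circle_mean (\<lambda>z. \<bar>Re (F z)\<bar> powr q) r \<le> C * ?h" by (rule mult_left_mono) (rule C)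
      with C(2)[OF that(1,2), of r] r show 1: "circle_mean (\<lambda>z. norm (F z) powr q) r \<le> C * ?h" by linarith
      \<comment> \<open>The value at the centre is a circle mean of radius 0, so monotonicity bounds
        it too.\<close>
      have "circle_mean (\<lambda>z. norm (F z) powr q) 0 \<le> circle_mean (\<lambda>z. norm (F z) powr q) r"
        by (rule circle_mean_norm_powr_mono[OF that(1)]) (use q r in auto)
      with 1 show "norm (F 0) powr q \<le> C * ?h" by simp
    qed
    note b1 = bound[OF F(1) F0(1) Re_le(1)] and b2 = bound[OF F(2) F0(2) Re_le(2)]
    have "circle_mean (\<lambda>z. norm (series_fun (tail_coeff k c) z) powr q) r = circle_mean (\<lambda>z. norm (A z) powr q) r"
      by (rule circle_mean_cong) (use tailA r in auto)
    also have "\<dots> \<le> circle_mean (\<lambda>z. 4 powr q * ((norm (F1 z) powr q + norm (F2 z) powr q) +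
         (norm (F1 0) powr q + norm (F2 0) powr q))) r"
    proof (rule circle_mean_mono)
      fix z
      \<comment> \<open>N cancels in F1 + i F2, which leaves 2 A - A(0), and A(0) is F1(0) + i
        F2(0). The four resulting terms give the factor 4 in the constant, and two splittings of a
        q-th power give 4^q.\<close>
      have "2 * A z = (F1 z + \<i> * F2 z) + (F1 0 + \<i> * F2 0)"
        by (simp add: F1_def F2_def N0 complex_eq_iff)
      then have "norm (2 * A z) \<le> (norm (F1 z) + norm (F2 z)) + (norm (F1 0) + norm (F2 0))"
        by (metis (no_types, opaque_lifting) add_mono norm_ii norm_mult norm_triangle_mono mult_1 norm_triangle_ineq)
      then have "norm (A z) \<le> (norm (F1 z) + norm (F2 z)) + (norm (F1 0) + norm (F2 0))"
        using norm_ge_zero[of "A z"] unfolding norm_mult norm_numeral by linarith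
      then have "norm (A z) powr q \<le> ((norm (F1 z) + norm (F2 z)) + (norm (F1 0) + norm (F2 0))) powr q"
        using q by (intro powr_mono2) auto
      also have "\<dots> \<le> 2 powr q * ((norm (F1 z) + norm (F2 z)) powr q + (norm (F1 0) + norm (F2 0)) powr q)"
        by (rule powr_add_le) (use q in auto)
      also have "\<dots> \<le> 2 powr q * (2 powr q * (norm (F1 z) powr q + norm (F2 z) powr q) +
           2 powr q * (norm (F1 0) powr q + norm (F2 0) powr q))"
        by (intro mult_left_mono add_mono powr_add_le) (use q in auto)
      also have "\<dots> = (2 * 2) powr q * ((norm (F1 z) powr q + norm (F2 z) powr q) +
           (norm (F1 0) powr q + norm (F2 0) powr q))"
        unfolding powr_mult by (simp add: algebra_simps)
      finally show "norm (A z) powr q \<le> 4 powr q * ((norm (F1 z) powr q + norm (F2 z) powr q) +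
           (norm (F1 0) powr q + norm (F2 0) powr q))" by simp
    qed (use q r in \<open>auto intro!: continuous_intros continuous_on_norm_powr cont\<close>)
    also have "\<dots> = 4 powr q * ((circle_mean (\<lambda>z. norm (F1 z) powr q) r + circle_mean (\<lambda>z. norm (F2 z) powr q) r) +
         (norm (F1 0) powr q + norm (F2 0) powr q))"
      using q r unfolding circle_mean_cmult
      by (subst circle_mean_add circle_mean_const; auto intro!: continuous_intros continuous_on_norm_powr cont)+
    also have "\<dots> \<le> 4 powr q * ((C * ?h + C * ?h) + (C * ?h + C * ?h))"
      by (intro mult_left_mono add_mono b1 b2) auto
    finally show "circle_mean (\<lambda>z. norm (series_fun (tail_coeff k c) z) powr q) r
      \<le> 4 powr q * 4 * C * circle_mean (\<lambda>z. norm (series_fun c z) powr q) r"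
      by (simp add: h_def algebra_simps)
  qed
qed

section \<open>Multipliers of bounded variation\<close>

lemma weighted_powr_le:
  fixes \<alpha> x :: "nat \<Rightarrow> complex"
  assumes "finite I" "(\<Sum>k\<in>I. norm (\<alpha> k)) \<le> A" "1 \<le> q"
  shows "norm (\<Sum>k\<in>I. \<alpha> k * x k) powr q \<le> A powr (q - 1) * (\<Sum>k\<in>I. norm (\<alpha> k) * norm (x k) powr q)"
proof -
  define S T where "S = (\<Sum>k\<in>I. norm (\<alpha> k))" and "T = (\<Sum>k\<in>I. norm (\<alpha> k) * norm (x k))"
  have S: "0 \<le> S" "S \<le> A" using assms by (auto simp: S_def intro!: sum_nonneg)
  have T: "0 \<le> T" by (auto simp: T_def intro!: sum_nonneg)
  have le: "norm (\<Sum>k\<in>I. \<alpha> k * x k) \<le> T"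
    unfolding T_def norm_mult[symmetric] by (rule norm_sum)
  have rhs: "0 \<le> (\<Sum>k\<in>I. norm (\<alpha> k) * norm (x k) powr q)" by (auto intro!: sum_nonneg)
  show ?thesis
  proof (cases "T = 0")
    case True
    then show ?thesis using le rhs by (auto intro!: mult_nonneg_nonneg)
  next
    case False
    have "S \<noteq> 0"
    proof
      assume "S = 0"
      then have "\<forall>k\<in>I. norm (\<alpha> k) = 0" using assms(1) by (simp add: S_def sum_nonneg_eq_0_iff)
      then show False using False by (simp add: T_def)
    qed
    with S T False have pos: "S > 0" "T > 0" by auto
    \<comment> \<open>\<open>m\<close> is the mean of the norms for the weights
      \<open>norm (\<alpha> k)\<close>; summing the tangent inequality at \<open>m\<close> cancels
      its linear part. The weights have mass S <= A instead of 1, which costs the factor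
      A^(q-1).\<close>
    define m where "m = T / S"
    have m: "m > 0" "T = S * m" using pos by (auto simp: m_def)
    have "S * m powr q = (\<Sum>k\<in>I. norm (\<alpha> k) * (m powr q + q * m powr (q - 1) * (norm (x k) - m)))"
    proof -
      have "(\<Sum>k\<in>I. norm (\<alpha> k) * (m powr q + q * m powr (q - 1) * (norm (x k) - m)))
          = (\<Sum>k\<in>I. norm (\<alpha> k) * m powr q + (q * m powr (q - 1)) * (norm (\<alpha> k) * norm (x k)) - (q * m powr (q - 1) * m) * norm (\<alpha> k))"
        by (rule sum.cong) (auto simp: algebra_simps)
      also have "\<dots> = S * m powr q + (q * m powr (q - 1)) * T - (q * m powr (q - 1) * m) * S"
        by (simp add: sum.distrib sum_subtractf sum_distrib_left sum_distrib_right S_def T_def)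
      also have "\<dots> = S * m powr q" unfolding m(2) by (simp add: algebra_simps)
      finally show ?thesis by simp
    qed
    also have "\<dots> \<le> (\<Sum>k\<in>I. norm (\<alpha> k) * norm (x k) powr q)"
      by (intro sum_mono mult_left_mono powr_ge_tangent) (use assms m in auto)
    finally have *: "S * m powr q \<le> (\<Sum>k\<in>I. norm (\<alpha> k) * norm (x k) powr q)" .
    have "norm (\<Sum>k\<in>I. \<alpha> k * x k) powr q \<le> T powr q"
      using le assms by (intro powr_mono2) auto
    also have "\<dots> = S powr (q - 1) * (S * m powr q)"
      unfolding m(2) using pos m by (simp add: powr_mult powr_diff)
    also have "\<dots> \<le> A powr (q - 1) * (S * m powr q)"
      using S assms by (intro mult_right_mono powr_mono2) auto
    also have "\<dots> \<le> A powr (q - 1) * (\<Sum>k\<in>I. norm (\<alpha> k) * norm (x k) powr q)"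
      by (intro mult_left_mono *) auto
    finally show ?thesis .
  qed
qed

text \<open>Abel summation: multiplying the coefficients of c by the partial sums of \<alpha>
  amounts to summing \<alpha>_k times the k-th tail of c. Jensen's inequality for the weights
  |\<alpha>_k| then bounds the mean. The bounds \<open>m k\<close> are left free, so that both
  uniform boundedness and decay of the tails can be fed in.\<close>

theorem multiplier_mean_le:
  assumes c: "analytic_series c" and q: "1 \<le> q" and r: "0 < r" "r < 1"
    and \<alpha>: "summable (\<lambda>k. norm (\<alpha> k))" "(\<Sum>k. norm (\<alpha> k)) \<le> A"
    and m: "\<And>k. circle_mean (\<lambda>z. norm (series_fun (tail_coeff k c) z) powr q) r \<le> m k" "\<And>k. 0 \<le> m k"
      "summable (\<lambda>k. norm (\<alpha> k) * m k)"
  shows "circle_mean (\<lambda>z. norm (series_fun (\<lambda>n. c n * (\<Sum>k\<le>n. \<alpha> k)) z) powr q) r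
      \<le> A powr (q - 1) * (\<Sum>k. norm (\<alpha> k) * m k)"
proof -
  define G where "G N z = (\<Sum>k<N. \<alpha> k * series_fun (tail_coeff k c) z)" for N z
  \<comment> \<open>The N-th partial sum of the combination of tails multiplies c_n by
    \<open>\<tau> N n\<close>, which has its final value as soon as N > n.\<close>
  define \<tau> where "\<tau> N n = (\<Sum>k<N. if k \<le> n then \<alpha> k else 0)" for N n
  have A: "sum (\<lambda>k. norm (\<alpha> k)) I \<le> A" if "finite I" for I
    using sum_le_suminf[OF \<alpha>(1) that] \<alpha>(2) by force
  have \<tau>_bound: "norm (\<tau> N n) \<le> A" for N n
  proof -
    have "norm (\<tau> N n) \<le> (\<Sum>k<N. norm (\<alpha> k))"
      unfolding \<tau>_def by (intro order.trans[OF norm_sum] sum_mono) auto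
    with A[of "{..<N}"] show ?thesis by simp
  qed
  have \<tau>_lim: "(\<lambda>N. \<tau> N n) \<longlonglongrightarrow> (\<Sum>k\<le>n. \<alpha> k)" for n
  proof (rule tendsto_eventually)
    have "\<tau> N n = (\<Sum>k\<le>n. \<alpha> k)" if "N > n" for N
    proof -
      have "{..<N} \<inter> {k. k \<le> n} = {..n}" using that by auto
      then show ?thesis unfolding \<tau>_def by (simp flip: sum.inter_restrict add: sum.If_cases)
    qed
    then show "eventually (\<lambda>N. \<tau> N n = (\<Sum>k\<le>n. \<alpha> k)) sequentially"
      unfolding eventually_sequentially by (meson Suc_le_eq)
  qed
  have G_eq: "G N z = (\<Sum>n. c n * z ^ n * \<tau> N n)" if "norm z < 1" for N z
  proof -
    have s: "(\<lambda>n. \<alpha> k * (tail_coeff k c n * z ^ n)) sums (\<alpha> k * series_fun (tail_coeff k c) z)" for k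
      by (intro sums_mult analytic_series_sums analytic_series_tail c that)
    have "(\<lambda>n. \<Sum>k<N. \<alpha> k * (tail_coeff k c n * z ^ n)) sums G N z"
      unfolding G_def by (rule sums_sum) (rule s)
    moreover have "(\<Sum>k<N. \<alpha> k * (tail_coeff k c n * z ^ n)) = c n * z ^ n * \<tau> N n" for n
      unfolding \<tau>_def sum_distrib_left by (rule sum.cong) (auto simp: tail_coeff_def)
    ultimately show ?thesis by (simp add: sums_iff)
  qed
  \<comment> \<open>A majorant on the circle common to all N, for the dominated convergence of the
    partial sums.\<close>
  define B where "B = (\<Sum>n. norm (c n * of_real r ^ n) * A)"
  have sB: "summable (\<lambda>n. norm (c n * of_real r ^ n) * A)"
    using analytic_series_abs[OF c, of "of_real r"] r by (intro summable_mult2) auto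
  have A0: "0 \<le> A" using A[of "{}"] by simp
  have G_bound: "norm (G N z) \<le> B" if "norm z = r" for N z
  proof -
    have le: "norm (c n * z ^ n * \<tau> N n) \<le> norm (c n * of_real r ^ n) * A" for n
      using that r \<tau>_bound[of N n] by (simp add: norm_mult norm_power) (intro mult_left_mono, auto)
    have "norm (\<Sum>n. c n * z ^ n * \<tau> N n) \<le> B"
      unfolding B_def by (rule norm_suminf_le[OF le sB])
    then show ?thesis using that r by (simp add: G_eq)
  qed
  have G_lim: "(\<lambda>N. G N z) \<longlonglongrightarrow> series_fun (\<lambda>n. c n * (\<Sum>k\<le>n. \<alpha> k)) z" if "norm z = r" for z
  proof -
    have "(\<lambda>N. \<Sum>n. c n * z ^ n * \<tau> N n) \<longlonglongrightarrow> (\<Sum>n. c n * z ^ n * (\<Sum>k\<le>n. \<alpha> k))"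
    proof (rule suminf_dominated[OF _ _ sB])
      show "(\<lambda>N. c n * z ^ n * \<tau> N n) \<longlonglongrightarrow> c n * z ^ n * (\<Sum>k\<le>n. \<alpha> k)" for n
        by (intro tendsto_intros \<tau>_lim)
      show "norm (c n * z ^ n * \<tau> N n) \<le> norm (c n * of_real r ^ n) * A" for n N
        using that r \<tau>_bound[of N n] by (simp add: norm_mult norm_power) (intro mult_left_mono, auto)
    qed
    then show ?thesis using that r by (simp add: G_eq series_fun_def mult_ac)
  qed
  have hol: "series_fun (tail_coeff k c) holomorphic_on ball 0 1" for k
    by (intro series_fun_holomorphic analytic_series_tail c)
  note cT = holomorphic_on_sphere_continuous[OF hol r(2)]
  have cG: "continuous_on (sphere 0 r) (G N)" for N
    unfolding G_def by (intro continuous_intros cT)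
  have "(\<lambda>N. circle_mean (\<lambda>z. norm (G N z) powr q) r) \<longlonglongrightarrow>
      circle_mean (\<lambda>z. norm (series_fun (\<lambda>n. c n * (\<Sum>k\<le>n. \<alpha> k)) z) powr q) r"
  proof (rule circle_mean_dominated[where B = "B powr q"])
    fix N show "continuous_on (sphere 0 r) (\<lambda>z. norm (G N z) powr q)"
      by (rule continuous_on_norm_powr[OF cG]) (use q in auto)
    fix z :: complex assume "norm z = r"
    then show "\<bar>norm (G N z) powr q\<bar> \<le> B powr q"
      using G_bound[of z N] q by (simp add: powr_mono2)
  next
    fix z :: complex assume "norm z = r"
    then show "(\<lambda>N. norm (G N z) powr q) \<longlonglongrightarrow> norm (series_fun (\<lambda>n. c n * (\<Sum>k\<le>n. \<alpha> k)) z) powr q"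
      using q by (intro tendsto_powr' tendsto_norm G_lim tendsto_const) auto
  qed (use r in auto)
  then show ?thesis
  proof (rule LIMSEQ_le_const2, intro exI allI impI)
    fix N
    have "circle_mean (\<lambda>z. norm (G N z) powr q) r \<le> circle_mean (\<lambda>z. A powr (q - 1) *
        (\<Sum>k<N. norm (\<alpha> k) * norm (series_fun (tail_coeff k c) z) powr q)) r"
      unfolding G_def
      by (intro circle_mean_mono weighted_powr_le A continuous_intros continuous_on_norm_powr cT)
         (use q r in auto)
    also have "\<dots> = A powr (q - 1) * (\<Sum>k<N. norm (\<alpha> k) * circle_mean (\<lambda>z. norm (series_fun (tail_coeff k c) z) powr q) r)"
      unfolding circle_mean_cmult
      by (subst circle_mean_sum)
         (use q r in \<open>auto intro!: continuous_intros continuous_on_norm_powr cT simp: circle_mean_cmult\<close>)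
    also have "\<dots> \<le> A powr (q - 1) * (\<Sum>k<N. norm (\<alpha> k) * m k)"
      by (intro mult_left_mono sum_mono m) auto
    also have "\<dots> \<le> A powr (q - 1) * (\<Sum>k. norm (\<alpha> k) * m k)"
      by (intro mult_left_mono sum_le_suminf m) (auto intro!: mult_nonneg_nonneg m)
    finally show "circle_mean (\<lambda>z. norm (G N z) powr q) r \<le> A powr (q - 1) * (\<Sum>k. norm (\<alpha> k) * m k)" .
  qed
qed

section \<open>Convergence of Taylor tails\<close>

lemma powr_gt_tangent:
  fixes x m q :: real
  assumes "1 < q" "0 \<le> x" "0 < m" "x \<noteq> m"
  shows "m powr q + q * m powr (q - 1) * (x - m) < x powr q"
proof -
  \<comment> \<open>Strictness comes from the mean value theorem, since the derivative of the q-th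
    power is strictly increasing.\<close>
  have mean_value: "\<exists>\<xi>. a < \<xi> \<and> \<xi> < b \<and> b powr q - a powr q = (b - a) * (q * \<xi> powr (q - 1))"
    if "0 < a" "a < b" for a b
    by (rule MVT2) (use that in \<open>auto intro!: has_real_derivative_powr\<close>)
  consider "x = 0" | "0 < x" "x < m" | "m < x" using assms by linarith
  then show ?thesis
  proof cases
    case 1
    have "m powr (q - 1) * m = m powr q" using assms powr_add[of m "q - 1" 1] by simp
    then have "m powr q + q * m powr (q - 1) * (x - m) = (1 - q) * m powr q"
      using 1 by (simp add: algebra_simps)
    also have "\<dots> < 0" using assms by (simp add: mult_neg_pos)
    finally show ?thesis using 1 by simp
  next
    case 2
    then obtain \<xi> where \<xi>: "x < \<xi>" "\<xi> < m" "m powr q - x powr q = (m - x) * (q * \<xi> powr (q - 1))"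
      using mean_value by blast
    have "(m - x) * (q * \<xi> powr (q - 1)) < (m - x) * (q * m powr (q - 1))"
      using 2 \<xi> assms by (intro mult_strict_left_mono powr_less_mono2) auto
    then show ?thesis using \<xi>(3) by (simp add: algebra_simps)
  next
    case 3
    then obtain \<xi> where \<xi>: "m < \<xi>" "\<xi> < x" "x powr q - m powr q = (x - m) * (q * \<xi> powr (q - 1))"
      using mean_value[of m x] assms by blast
    have "(x - m) * (q * m powr (q - 1)) < (x - m) * (q * \<xi> powr (q - 1))"
      using 3 \<xi> assms by (intro mult_strict_left_mono powr_less_mono2) auto
    then show ?thesis using \<xi>(3) by (simp add: algebra_simps)
  qed
qed

text \<open>Strictness has two sources. If the moduli differ, the q-th power is strictly convex
  around their mean. If they agree, the parallelogram law makes the modulus of the midpoint strictly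
  smaller.\<close>

lemma norm_powr_midpoint_less:
  fixes x y :: complex
  assumes q: "1 < q" and "x \<noteq> y"
  shows "norm ((x + y) / 2) powr q < (norm x powr q + norm y powr q) / 2"
proof -
  define m where "m = (norm x + norm y) / 2"
  have m: "m > 0" using assms(2) unfolding m_def
    by (metis add_nonneg_eq_0_iff add_nonneg_nonneg half_gt_zero_iff norm_eq_zero norm_ge_zero order_le_less)
  have le: "norm ((x + y) / 2) \<le> m"
    unfolding m_def by (simp add: norm_divide norm_triangle_ineq)
  show ?thesis
  proof (cases "norm x = norm y")
    case False
    have "norm x \<noteq> m" "norm y \<noteq> m" using False by (auto simp: m_def)
    then have "m powr q + q * m powr (q - 1) * (norm x - m) < norm x powr q"
      "m powr q + q * m powr (q - 1) * (norm y - m) < norm y powr q"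
      using powr_gt_tangent[OF q _ m] by simp_all
    moreover have "q * m powr (q - 1) * (norm x - m) + q * m powr (q - 1) * (norm y - m) = 0"
      by (simp add: m_def field_simps)
    ultimately have "m powr q < (norm x powr q + norm y powr q) / 2" by simp
    moreover have "norm ((x + y) / 2) powr q \<le> m powr q"
      using le q by (intro powr_mono2) auto
    ultimately show ?thesis by simp
  next
    case True
    have "(norm (x + y))\<^sup>2 + (norm (x - y))\<^sup>2 = 2 * (norm x)\<^sup>2 + 2 * (norm y)\<^sup>2"
      unfolding cmod_power2 by (simp add: power2_eq_square algebra_simps)
    moreover have "(norm (x - y))\<^sup>2 > 0" using assms(2) by simp
    moreover have "(2 * norm x)\<^sup>2 = 2 * (norm x)\<^sup>2 + 2 * (norm y)\<^sup>2"
      using True by (simp add: power_mult_distrib)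
    ultimately have "(norm (x + y))\<^sup>2 < (2 * norm x)\<^sup>2"
      by linarith
    then have "norm (x + y) < 2 * norm x" by (rule power_less_imp_less_base) auto
    then have "norm ((x + y) / 2) < norm x" by (simp add: norm_divide)
    then have "norm ((x + y) / 2) powr q < norm x powr q"
      using q by (intro powr_less_mono2) auto
    then show ?thesis using True by simp
  qed
qed

text \<open>A pointwise form of the uniform convexity of $L^q$: by homogeneity only the pairs with
  $|x|^q + |y|^q = 1$ matter, and these form a compact set.\<close>

lemma uniform_convexity_powr:
  assumes q: "1 < q" and \<epsilon>: "0 < \<epsilon>"
  obtains C where "0 \<le> C" "\<And>x y :: complex. norm (x - y) powr q \<le> \<epsilon> * (norm x powr q + norm y powr q)
      + C * ((norm x powr q + norm y powr q) / 2 - norm ((x + y) / 2) powr q)"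
proof -
  define S where "S p = norm (fst p) powr q + norm (snd p) powr q" for p :: "complex \<times> complex"
  define D where "D p = S p / 2 - norm ((fst p + snd p) / 2) powr q" for p :: "complex \<times> complex"
  define E where "E p = norm (fst p - snd p) powr q" for p :: "complex \<times> complex"
  \<comment> \<open>Normalized pairs whose difference is not already covered by the \<epsilon>-term.
    They lie off the diagonal, so the convexity deficit \<open>D\<close> has a positive minimum d on
    this compact set, and the constant 2^q / d pays for the largest possible
    \<open>E\<close>.\<close>
  define K where "K = {p. S p = 1 \<and> \<epsilon> \<le> E p}"
  have cont: "continuous_on UNIV S" "continuous_on UNIV D" "continuous_on UNIV E"
    unfolding D_def S_def E_def
    by (intro continuous_intros continuous_on_powr'; use q in auto)+
  have "bounded K"
  proof (rule boundedI[where B = 2])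
    fix p assume "p \<in> K"
    then have "S p = 1" by (simp add: K_def)
    then have "norm (fst p) powr q \<le> 1" "norm (snd p) powr q \<le> 1"
      using powr_ge_zero[of "norm (fst p)" q] powr_ge_zero[of "norm (snd p)" q] unfolding S_def by linarith+
    moreover have "a \<le> 1" if "a powr q \<le> 1" for a :: real
    proof (rule ccontr)
      assume "\<not> a \<le> 1"
      then have "1 powr q < a powr q" using q by (intro powr_less_mono2) auto
      then show False using that by simp
    qed
    ultimately have "norm (fst p) \<le> 1" "norm (snd p) \<le> 1"
      by blast+
    then show "norm p \<le> 2" using norm_Pair_le[of "fst p" "snd p"] by simp
  qed
  moreover have "closed K"
    unfolding K_def Collect_conj_eq
    by (intro closed_Int closed_Collect_eq closed_Collect_le cont continuous_intros)
  ultimately have K: "compact K" by (simp add: compact_eq_bounded_closed)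
  have Dpos: "D p > 0" if "fst p \<noteq> snd p" for p
    using norm_powr_midpoint_less[OF q that] by (simp add: D_def S_def)
  have D0: "D p \<ge> 0" for p
  proof (cases "fst p = snd p")
    case True
    then have "(fst p + snd p) / 2 = snd p" by simp
    then show ?thesis using True by (simp add: D_def S_def)
  qed (use Dpos in force)
  have ES: "E p \<le> 2 powr q * S p" for p
  proof -
    have "E p \<le> (norm (fst p) + norm (snd p)) powr q"
      unfolding E_def using q by (intro powr_mono2 norm_triangle_ineq4) auto
    also have "\<dots> \<le> 2 powr q * S p" unfolding S_def by (rule powr_add_le) (use q in auto)
    finally show ?thesis .
  qed
  obtain d where d: "d > 0" "\<And>p. p \<in> K \<Longrightarrow> d \<le> D p"
  proof (cases "K = {}")
    case False
    obtain p where p: "p \<in> K" "\<And>y. y \<in> K \<Longrightarrow> D p \<le> D y"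
      using continuous_attains_inf[OF K False continuous_on_subset[OF cont(2)]] by auto
    then have "fst p \<noteq> snd p" using \<epsilon> by (auto simp: K_def E_def)
    then show thesis using that[of "D p"] p Dpos by auto
  qed (use that[of 1] in auto)
  have unit: "E p \<le> \<epsilon> * S p + 2 powr q / d * D p" if "S p = 1" for p
  proof (cases "p \<in> K")
    case True
    have "E p \<le> 2 powr q" using ES[of p] that by simp
    also have "\<dots> \<le> 2 powr q / d * D p" using d(1) d(2)[OF True] by (simp add: field_simps)
    also have "\<dots> \<le> \<epsilon> * S p + 2 powr q / d * D p" using that \<epsilon> by simp
    finally show ?thesis .
  next
    case False
    then have "E p \<le> \<epsilon>" using that by (simp add: K_def)
    moreover have "0 \<le> 2 powr q / d * D p" using d(1) D0[of p] by simp
    ultimately show ?thesis using that by simp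
  qed
  have all: "E p \<le> \<epsilon> * S p + 2 powr q / d * D p" for p
  proof (cases "S p = 0")
    case True
    moreover have "0 \<le> 2 powr q / d * D p" using D0[of p] d(1) by simp
    ultimately show ?thesis using ES[of p] by simp
  next
    case False
    moreover have "S p \<ge> 0" by (simp add: S_def)
    ultimately have S: "S p > 0" by simp
    define s where "s = S p powr (1 / q)"
    have s: "s > 0" "s powr q = S p" using S q by (auto simp: s_def powr_powr)
    define p' where "p' = (fst p / of_real s, snd p / of_real s)"
    have mid: "(fst p' + snd p') / 2 = ((fst p + snd p) / 2) / of_real s"
      and diff: "fst p' - snd p' = (fst p - snd p) / of_real s"
      by (simp_all add: p'_def add_divide_distrib diff_divide_distrib mult.commute)
    have norm_s: "norm (w / of_real s) powr q = norm w powr q / s powr q" for w :: complex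
      using s(1) by (simp add: norm_divide powr_divide)
    have "S p' = S p / s powr q" "E p' = E p / s powr q"
      "norm ((fst p' + snd p') / 2) powr q = norm ((fst p + snd p) / 2) powr q / s powr q"
      unfolding S_def E_def mid diff by (simp_all only: p'_def fst_conv snd_conv norm_s) (simp only: add_divide_distrib)
    then have *: "S p' = 1" "E p' = E p / S p" "D p' = D p / S p"
      using S s(2) by (simp_all add: D_def diff_divide_distrib)
    have "E p / S p \<le> (\<epsilon> * S p + 2 powr q / d * D p) / S p"
      using unit[OF *(1)] S unfolding * by (simp add: add_divide_distrib)
    then show ?thesis using S by (simp add: divide_le_cancel)
  qed
  show thesis
    by (rule that[of "2 powr q / d"]) (use d(1) all[of "(_, _)"] in \<open>auto simp: E_def S_def D_def\<close>)
qed

text \<open>Let L be the supremum of the means of |h|^q and take a circle on which the mean exceeds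
  L - \<delta>. For a dilation close to the identity the midpoint of h and its dilation also exceeds
  L - \<delta> in mean, first on that circle and by monotonicity on every larger one. Both functions
  have means at most L, so the averaged convexity deficit is at most \<delta>, and uniform convexity
  bounds the difference. On smaller circles the means of the difference are no larger.\<close>

theorem dilation_mean_approx:
  assumes q: "1 < q" and h: "h holomorphic_on ball 0 1" and \<epsilon>: "0 < \<epsilon>"
    and M: "\<And>r. 0 < r \<Longrightarrow> r < 1 \<Longrightarrow> circle_mean (\<lambda>z. norm (h z) powr q) r \<le> M"
  obtains \<rho> where "0 < \<rho>" "\<rho> < 1"
    "\<And>r. 0 < r \<Longrightarrow> r < 1 \<Longrightarrow> circle_mean (\<lambda>z. norm (h z - h (of_real \<rho> * z)) powr q) r \<le> \<epsilon>"
proof -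
  define A where "A r = circle_mean (\<lambda>z. norm (h z) powr q) r" for r
  have cont: "continuous_on (sphere 0 r) f" if "f holomorphic_on ball 0 1" "r < 1"
    for f :: "complex \<Rightarrow> complex" and r
    using holomorphic_on_sphere_continuous[OF that] .
  have q0: "0 < q" using q by simp
  define L where "L = (SUP r\<in>{0<..<1}. A r)"
  have bdd: "bdd_above (A ` {0<..<1})" using M by (auto simp: bdd_above_def A_def intro!: exI[of _ M])
  have AL: "A r \<le> L" if "0 < r" "r < 1" for r
    unfolding L_def by (rule cSUP_upper) (use bdd that in auto)
  have "0 \<le> A (1/2)" unfolding A_def
    by (rule circle_mean_nonneg) (auto intro!: continuous_on_norm_powr cont h q0)
  then have L0: "L \<ge> 0" using AL[of "1/2"] by simp
  \<comment> \<open>The total mass is at most 2 L, so the first term contributes at most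
    \<epsilon>/2. The added 4, like the added 2 in \<open>\<delta>\<close>, keeps the denominator
    positive.\<close>
  obtain C where C: "0 \<le> C" "\<And>x y :: complex. norm (x - y) powr q \<le> (\<epsilon> / (4 * L + 4)) * (norm x powr q + norm y powr q)
      + C * ((norm x powr q + norm y powr q) / 2 - norm ((x + y) / 2) powr q)"
    using uniform_convexity_powr[OF q, of "\<epsilon> / (4 * L + 4)"] \<epsilon> L0 by auto
  define \<delta> where "\<delta> = \<epsilon> / (2 * C + 2)"
  have \<delta>: "\<delta> > 0" "C * \<delta> \<le> \<epsilon> / 2" using \<epsilon> C by (auto simp: \<delta>_def field_simps)
  have "\<exists>r\<in>{0<..<1}. L - \<delta> < A r"
    using \<delta>(1) bdd unfolding L_def by (subst less_cSUP_iff[symmetric]) auto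
  then obtain r0 where r0: "0 < r0" "r0 < 1" "L - \<delta> < A r0" by auto
  define \<rho> where "\<rho> n = 1 - 1 / real (n + 2)" for n
  have \<rho>: "0 < \<rho> n" "\<rho> n < 1" for n by (auto simp: \<rho>_def field_simps)
  have \<rho>_lim: "\<rho> \<longlonglongrightarrow> 1"
  proof -
    have "(\<lambda>n. 1 - 1 / real (n + 2)) \<longlonglongrightarrow> 1 - 0"
      by (intro tendsto_diff tendsto_const LIMSEQ_ignore_initial_segment[OF lim_1_over_n])
    then show ?thesis by (simp add: \<rho>_def[abs_def])
  qed
  have contract: "s * x < 1" if "0 < s" "s < 1" "0 \<le> x" "x < 1" for s x :: real
    using mult_right_mono[of s 1 x] that by simp
  have hol: "(\<lambda>z. h (of_real s * z)) holomorphic_on ball 0 1" if "0 < s" "s < 1" for s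
  proof -
    have "(h \<circ> (\<lambda>z. of_real s * z)) holomorphic_on ball 0 1"
      by (rule holomorphic_on_compose_gen[OF _ h])
         (use that in \<open>auto intro!: holomorphic_intros contract simp: norm_mult\<close>)
    then show ?thesis by (simp add: o_def)
  qed
  have mid: "(\<lambda>z. (h z + h (of_real s * z)) / 2) holomorphic_on ball 0 1" if "0 < s" "s < 1" for s
    using hol[OF that] h by (intro holomorphic_intros) auto
  obtain B where B: "\<And>z. norm z \<le> r0 \<Longrightarrow> norm (h z) \<le> B"
  proof -
    have "compact (h ` cball 0 r0)"
      by (intro compact_continuous_image holomorphic_on_imp_continuous_on holomorphic_on_subset[OF h])
         (use r0 in auto)
    then have "bounded (h ` cball 0 r0)" by (rule compact_imp_bounded)
    then obtain B where "\<forall>x\<in>h ` cball 0 r0. norm x \<le> B" unfolding bounded_iff by blast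
    then show thesis by (intro that[of B]) auto
  qed
  have "(\<lambda>n. circle_mean (\<lambda>z. norm ((h z + h (of_real (\<rho> n) * z)) / 2) powr q) r0) \<longlonglongrightarrow> A r0"
    unfolding A_def
  proof (rule circle_mean_dominated[where B = "B powr q"])
    fix n show "continuous_on (sphere 0 r0) (\<lambda>z. norm ((h z + h (of_real (\<rho> n) * z)) / 2) powr q)"
      by (intro continuous_on_norm_powr cont mid \<rho> r0 q0)
    fix z :: complex assume z: "norm z = r0"
    have "norm (of_real (\<rho> n) * z) \<le> r0"
      using z \<rho>[of n] r0 mult_right_mono[of "\<rho> n" 1 r0] by (simp add: norm_mult)
    then have "norm (h z + h (of_real (\<rho> n) * z)) \<le> B + B"
      using z by (intro order.trans[OF norm_triangle_ineq] add_mono B) auto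
    then have "norm ((h z + h (of_real (\<rho> n) * z)) / 2) \<le> B" by (simp add: norm_divide)
    then show "\<bar>norm ((h z + h (of_real (\<rho> n) * z)) / 2) powr q\<bar> \<le> B powr q"
      using q by (simp add: powr_mono2)
  next
    fix z :: complex assume z: "norm z = r0"
    have "isCont h z"
      using holomorphic_on_imp_continuous_on[OF h] z r0 by (simp add: continuous_on_eq_continuous_at)
    moreover have "(\<lambda>n. of_real (\<rho> n) * z) \<longlonglongrightarrow> of_real 1 * z"
      by (intro tendsto_mult tendsto_of_real \<rho>_lim tendsto_const)
    ultimately have "(\<lambda>n. h (of_real (\<rho> n) * z)) \<longlonglongrightarrow> h z"
      by (intro isCont_tendsto_compose[of z h]) auto
    then have "(\<lambda>n. (h z + h (of_real (\<rho> n) * z)) / 2) \<longlonglongrightarrow> (h z + h z) / 2"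
      by (intro tendsto_intros) auto
    then have "(\<lambda>n. (h z + h (of_real (\<rho> n) * z)) / 2) \<longlonglongrightarrow> h z" by simp
    then show "(\<lambda>n. norm ((h z + h (of_real (\<rho> n) * z)) / 2) powr q) \<longlonglongrightarrow> norm (h z) powr q"
      using q by (intro tendsto_powr' tendsto_norm tendsto_const) auto
  qed (use r0 in auto)
  then have "eventually (\<lambda>n. L - \<delta> < circle_mean (\<lambda>z. norm ((h z + h (of_real (\<rho> n) * z)) / 2) powr q) r0) sequentially"
    using r0(3) by (rule order_tendstoD)
  then obtain n where n: "L - \<delta> < circle_mean (\<lambda>z. norm ((h z + h (of_real (\<rho> n) * z)) / 2) powr q) r0"
    unfolding eventually_sequentially by blast
  define s where "s = \<rho> n"
  have s: "0 < s" "s < 1" using \<rho> by (auto simp: s_def)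
  have diff: "(\<lambda>z. h z - h (of_real s * z)) holomorphic_on ball 0 1"
    using hol[OF s] h by (intro holomorphic_intros) auto
  have large: "circle_mean (\<lambda>z. norm (h z - h (of_real s * z)) powr q) r \<le> \<epsilon>" if r: "r0 \<le> r" "r < 1" for r
  proof -
    have rpos: "0 < r" using r r0 by simp
    note cs = cont[OF h r(2)] cont[OF hol[OF s] r(2)] cont[OF mid[OF s] r(2)] cont[OF diff r(2)]
    note cp = cs[THEN continuous_on_norm_powr, OF q0]
    \<comment> \<open>The dilation on radius r is h on radius s r, so its means are at most L as
      well.\<close>
    have As: "A (s * r) = circle_mean (\<lambda>z. norm (h (of_real s * z)) powr q) r"
      unfolding A_def by (rule circle_mean_scale)
    let ?a = "\<lambda>z. norm (h z) powr q" and ?b = "\<lambda>z. norm (h (of_real s * z)) powr q"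
      and ?m = "\<lambda>z. norm ((h z + h (of_real s * z)) / 2) powr q" and ?e = "\<epsilon> / (4 * L + 4)"
    have sr: "0 < s * r" "s * r < 1" using s rpos r contract[of s r] by auto
    have "circle_mean (\<lambda>z. norm (h z - h (of_real s * z)) powr q) r
      \<le> circle_mean (\<lambda>z. (?e + C / 2) * (1 * ?a z + 1 * ?b z) + (- C) * ?m z) r"
    proof (rule circle_mean_mono)
      fix z
      show "norm (h z - h (of_real s * z)) powr q \<le> (?e + C / 2) * (1 * ?a z + 1 * ?b z) + (- C) * ?m z"
        using C(2)[of "h z" "h (of_real s * z)"] by (simp add: algebra_simps add_divide_distrib)
    qed ((intro continuous_on_add continuous_on_mult_left cp)+, use rpos in simp)
    also have "\<dots> = (?e + C / 2) * circle_mean (\<lambda>z. 1 * ?a z + 1 * ?b z) r + (- C) * circle_mean ?m r"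
      by (rule circle_mean_linear) ((intro continuous_on_add continuous_on_mult_left cp)+, use rpos in simp)
    also have "circle_mean (\<lambda>z. 1 * ?a z + 1 * ?b z) r = 1 * circle_mean ?a r + 1 * circle_mean ?b r"
      by (rule circle_mean_linear) (use rpos in \<open>auto intro!: continuous_intros continuous_on_norm_powr cs q0\<close>)
    also have "(?e + C / 2) * (1 * circle_mean ?a r + 1 * circle_mean ?b r) + (- C) * circle_mean ?m r
       \<le> (?e + C / 2) * (1 * L + 1 * L) + (- C) * (L - \<delta>)"
    proof (rule add_mono)
      show "(?e + C / 2) * (1 * circle_mean ?a r + 1 * circle_mean ?b r) \<le> (?e + C / 2) * (1 * L + 1 * L)"
        using AL[of r] AL[of "s * r"] As sr rpos r(2) C(1) \<epsilon> L0
        by (intro mult_left_mono add_mono) (auto simp: A_def)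
      have "circle_mean ?m r0 \<le> circle_mean ?m r"
        by (rule circle_mean_norm_powr_mono[OF mid[OF s]]) (use q r r0 in auto)
      then have "L - \<delta> \<le> circle_mean ?m r" using n by (simp add: s_def)
      then show "(- C) * circle_mean ?m r \<le> (- C) * (L - \<delta>)"
        using C(1) by (intro mult_left_mono_neg) auto
    qed
    also have "\<dots> = ?e * (2 * L) + C * \<delta>" by (simp add: algebra_simps)
    also have "\<dots> \<le> \<epsilon> / 2 + \<epsilon> / 2"
      using \<epsilon> L0 \<delta>(2) by (intro add_mono) (auto simp: field_simps)
    finally show ?thesis by simp
  qed
  show thesis
  proof (rule that[OF s])
    fix r :: real assume r: "0 < r" "r < 1"
    show "circle_mean (\<lambda>z. norm (h z - h (of_real s * z)) powr q) r \<le> \<epsilon>"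
    proof (cases "r0 \<le> r")
      case False
      then have "circle_mean (\<lambda>z. norm (h z - h (of_real s * z)) powr q) r \<le>
          circle_mean (\<lambda>z. norm (h z - h (of_real s * z)) powr q) r0"
        by (intro circle_mean_norm_powr_mono[OF diff]) (use q r r0 in auto)
      then show ?thesis using large[of r0] r0 by simp
    qed (use large r in auto)
  qed
qed

text \<open>Split c into the coefficients \<open>e\<close> of a dilation and the rest
  \<open>d\<close>. The series of \<open>d\<close> has small means, which the Riesz bound passes on
  to all its tails at once. The coefficients \<open>e\<close> are absolutely summable, so their
  tails are uniformly small on the disc for large k.\<close>

theorem tail_means_tendsto_0:
  assumes q: "1 < q" and c: "analytic_series c"
    and M: "\<And>r. 0 < r \<Longrightarrow> r < 1 \<Longrightarrow> circle_mean (\<lambda>z. norm (series_fun c z) powr q) r \<le> M"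
  obtains m :: "nat \<Rightarrow> real" where "m \<longlonglongrightarrow> 0" "\<And>k. 0 \<le> m k"
    "\<And>k r. 0 < r \<Longrightarrow> r < 1 \<Longrightarrow> circle_mean (\<lambda>z. norm (series_fun (tail_coeff k c) z) powr q) r \<le> m k"
proof -
  have q0: "0 < q" using q by simp
  obtain C where C: "0 \<le> C" "\<And>c k r. analytic_series c \<Longrightarrow> 0 < r \<Longrightarrow> r < 1 \<Longrightarrow>
      circle_mean (\<lambda>z. norm (series_fun (tail_coeff k c) z) powr q) r
      \<le> C * circle_mean (\<lambda>z. norm (series_fun c z) powr q) r"
    using riesz_tail[OF q] by blast
  have cT: "continuous_on (sphere 0 r) (series_fun (tail_coeff k d))"
    if "r < 1" "analytic_series d" for r k d
    by (rule holomorphic_on_sphere_continuous[OF series_fun_holomorphic[OF analytic_series_tail] that(1)]) (rule that)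
  define T where "T k r = circle_mean (\<lambda>z. norm (series_fun (tail_coeff k c) z) powr q) r" for k r
  define m where "m k = (SUP r\<in>{0<..<1}. T k r)" for k
  have bdd: "bdd_above (T k ` {0<..<1})" for k
    unfolding bdd_above_def
  proof (intro exI[of _ "C * M"] ballI, elim imageE)
    fix x r assume "x = T k r" "r \<in> {0<..<1::real}"
    then show "x \<le> C * M"
      using C(2)[OF c, of r k] mult_left_mono[OF M[of r] C(1)] by (simp add: T_def)
  qed
  have Tm: "T k r \<le> m k" if "0 < r" "r < 1" for k r
    unfolding m_def by (rule cSUP_upper) (use bdd that in auto)
  have T0: "0 \<le> T k r" if "0 < r" "r < 1" for k r
    unfolding T_def by (rule circle_mean_nonneg) (use that in \<open>auto intro!: continuous_on_norm_powr cT q0 c\<close>)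
  have m0: "0 \<le> m k" for k using Tm[of "1/2" k] T0[of "1/2" k] by simp
  have small: "\<exists>K. \<forall>k\<ge>K. m k \<le> \<epsilon>" if \<epsilon>: "\<epsilon> > 0" for \<epsilon>
  proof -
    \<comment> \<open>\<open>\<epsilon>1\<close> and \<open>\<eta>\<close> are chosen so that, after
      the factor 2^q from splitting a q-th power, the parts d and e contribute at most \<epsilon>/2
      each.\<close>
    define \<epsilon>1 where "\<epsilon>1 = \<epsilon> / (2 * 2 powr q * (C + 1))"
    have \<epsilon>1: "\<epsilon>1 > 0" "2 powr q * (C * \<epsilon>1) \<le> \<epsilon> / 2"
    proof -
      show "\<epsilon>1 > 0" using \<epsilon> C(1) by (simp add: \<epsilon>1_def)
      have "2 powr q * (C * \<epsilon>1) = C / (C + 1) * (\<epsilon> / 2)" by (simp add: \<epsilon>1_def)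
      also have "\<dots> \<le> 1 * (\<epsilon> / 2)" using \<epsilon> C(1) by (intro mult_right_mono) auto
      finally show "2 powr q * (C * \<epsilon>1) \<le> \<epsilon> / 2" by simp
    qed
    define \<eta> where "\<eta> = (\<epsilon> / (2 * 2 powr q)) powr (1 / q)"
    have \<eta>: "\<eta> > 0" "2 powr q * \<eta> powr q = \<epsilon> / 2"
      using \<epsilon> q by (auto simp: \<eta>_def powr_powr)
    obtain \<rho> where \<rho>: "0 < \<rho>" "\<rho> < 1"
      "\<And>r. 0 < r \<Longrightarrow> r < 1 \<Longrightarrow>
        circle_mean (\<lambda>z. norm (series_fun c z - series_fun c (of_real \<rho> * z)) powr q) r \<le> \<epsilon>1"
      using dilation_mean_approx[OF q series_fun_holomorphic[OF c] \<epsilon>1(1) M] by blast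
    define d e where "d n = c n * (1 - of_real \<rho> ^ n)" and "e n = c n * of_real \<rho> ^ n" for n
    have e_le: "norm (e n) \<le> 1 * norm (c n)" for n
      using \<rho> by (simp add: e_def norm_mult norm_power mult_left_le power_le_one)
    have "norm (1 - complex_of_real \<rho> ^ n) \<le> 2" for n
    proof -
      have "norm (1 - complex_of_real \<rho> ^ n) \<le> norm (1::complex) + norm (complex_of_real \<rho> ^ n)"
        by (rule norm_triangle_ineq4)
      moreover have "\<rho> ^ n \<le> 1" using \<rho> by (intro power_le_one) auto
      ultimately show ?thesis using \<rho> by (simp add: norm_power)
    qed
    then have d_le: "norm (d n) \<le> 2 * norm (c n)" for n
      unfolding d_def norm_mult by (subst mult.commute) (intro mult_right_mono, auto)
    have d: "analytic_series d" and e: "analytic_series e"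
      using d_le e_le analytic_seriesI_le[OF c] by blast+
    have series_e: "series_fun e z = series_fun c (of_real \<rho> * z)" for z
      by (simp add: series_fun_def e_def power_mult_distrib mult.assoc)
    have split: "series_fun d z + series_fun e z = series_fun c z" if "norm z < 1" for z
      using sums_add[OF analytic_series_sums[OF d that] analytic_series_sums[OF e that]]
        analytic_series_sums[OF c that] by (simp add: d_def e_def algebra_simps sums_unique2)
    have split_tail: "series_fun (tail_coeff k c) z = series_fun (tail_coeff k d) z + series_fun (tail_coeff k e) z"
      if "norm z < 1" for k z
    proof -
      have "tail_coeff k d n * z ^ n + tail_coeff k e n * z ^ n = tail_coeff k c n * z ^ n" for n
        by (simp add: tail_coeff_def d_def e_def algebra_simps)
      then show ?thesis
        using sums_add[OF analytic_series_sums[OF analytic_series_tail[OF d] that, of k]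
            analytic_series_sums[OF analytic_series_tail[OF e] that, of k]]
          analytic_series_sums[OF analytic_series_tail[OF c] that, of k] by (simp add: sums_unique2)
    qed
    have sum_e: "summable (\<lambda>n. norm (e n))"
      using analytic_series_abs[OF c, of "of_real \<rho>"] \<rho> by (simp add: e_def)
    obtain K where K: "\<And>k. k \<ge> K \<Longrightarrow> (\<Sum>n. norm (e (n + k))) \<le> \<eta>"
    proof -
      obtain K where "\<forall>k\<ge>K. norm (\<Sum>n. norm (e (n + k))) < \<eta>"
        using suminf_exist_split[OF \<eta>(1) sum_e] by blast
      then have "(\<Sum>n. norm (e (n + k))) \<le> \<eta>" if "k \<ge> K" for k
        using that abs_le_D1[of "\<Sum>n. norm (e (n + k))" \<eta>] by (simp add: less_imp_le)
      then show thesis by (rule that)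
    qed
    have "m k \<le> \<epsilon>" if k: "k \<ge> K" for k
      unfolding m_def
    proof (rule cSUP_least)
      fix r :: real assume "r \<in> {0<..<1}"
      then have r: "0 < r" "r < 1" by auto
      have "T k r \<le> circle_mean (\<lambda>z. 2 powr q * norm (series_fun (tail_coeff k d) z) powr q + 2 powr q * \<eta> powr q) r"
        unfolding T_def
      proof (rule circle_mean_mono)
        fix z :: complex assume z: "norm z = r"
        then have z1: "norm z < 1" using r by simp
        have "norm (series_fun (tail_coeff k e) z) \<le> \<eta>"
        proof -
          have "norm (series_fun (tail_coeff k e) z) = norm z ^ k * norm (series_fun (\<lambda>n. e (n + k)) z)"
            by (simp add: series_fun_tail[OF e z1] norm_mult norm_power)
          also have "\<dots> \<le> 1 * norm (series_fun (\<lambda>n. e (n + k)) z)"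
            using z1 by (intro mult_right_mono power_le_one) auto
          also have "norm (series_fun (\<lambda>n. e (n + k)) z) \<le> (\<Sum>n. norm (e (n + k)))"
            unfolding series_fun_def
          proof (rule norm_suminf_le)
            show "summable (\<lambda>n. norm (e (n + k)))" by (rule summable_ignore_initial_segment[OF sum_e])
            show "norm (e (n + k) * z ^ n) \<le> norm (e (n + k))" for n
              using z1 by (simp add: norm_mult norm_power mult_left_le power_le_one)
          qed
          finally show ?thesis using K[OF k] by simp
        qed
        then have "norm (series_fun (tail_coeff k c) z) \<le> norm (series_fun (tail_coeff k d) z) + \<eta>"
          unfolding split_tail[OF z1] by (intro order.trans[OF norm_triangle_ineq]) auto
        then have "norm (series_fun (tail_coeff k c) z) powr q \<le> (norm (series_fun (tail_coeff k d) z) + \<eta>) powr q"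
          using q by (intro powr_mono2) auto
        also have "\<dots> \<le> 2 powr q * (norm (series_fun (tail_coeff k d) z) powr q + \<eta> powr q)"
          using \<eta> q by (intro powr_add_le) auto
        finally show "norm (series_fun (tail_coeff k c) z) powr q
            \<le> 2 powr q * norm (series_fun (tail_coeff k d) z) powr q + 2 powr q * \<eta> powr q"
          by (simp add: algebra_simps)
      qed (use r in \<open>auto intro!: continuous_intros continuous_on_norm_powr cT c d q0\<close>)
      also have "\<dots> = 2 powr q * circle_mean (\<lambda>z. norm (series_fun (tail_coeff k d) z) powr q) r + 2 powr q * \<eta> powr q"
        using circle_mean_linear[of r "\<lambda>z. norm (series_fun (tail_coeff k d) z) powr q" "\<lambda>_. 1" "2 powr q" "2 powr q * \<eta> powr q"]
          continuous_on_norm_powr[OF cT[OF r(2) d] q0] r by simp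
      also have "\<dots> \<le> 2 powr q * (C * circle_mean (\<lambda>z. norm (series_fun d z) powr q) r) + 2 powr q * \<eta> powr q"
        by (intro add_right_mono mult_left_mono C d r) auto
      also have "circle_mean (\<lambda>z. norm (series_fun d z) powr q) r =
          circle_mean (\<lambda>z. norm (series_fun c z - series_fun c (of_real \<rho> * z)) powr q) r"
      proof (rule circle_mean_cong)
        fix z :: complex assume "norm z = r"
        then show "norm (series_fun d z) powr q = norm (series_fun c z - series_fun c (of_real \<rho> * z)) powr q"
          using r by (simp add: split[symmetric] series_e[symmetric])
      qed (use r in auto)
      also have "2 powr q * (C * \<dots>) + 2 powr q * \<eta> powr q \<le> 2 powr q * (C * \<epsilon>1) + 2 powr q * \<eta> powr q"
        by (intro add_right_mono mult_left_mono \<rho>(3) r C) auto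
      also have "\<dots> \<le> \<epsilon>" using \<epsilon>1(2) \<eta>(2) by simp
      finally show "T k r \<le> \<epsilon>" .
    qed auto
    then show ?thesis by blast
  qed
  have "m \<longlonglongrightarrow> 0"
  proof (rule LIMSEQ_I)
    fix \<epsilon> :: real assume "\<epsilon> > 0"
    then obtain K where "\<forall>k\<ge>K. m k \<le> \<epsilon> / 2" using small[of "\<epsilon> / 2"] by auto
    then show "\<exists>no. \<forall>n\<ge>no. norm (m n - 0) < \<epsilon>"
      using m0 \<open>\<epsilon> > 0\<close> by (intro exI[of _ K]) (auto intro: order.strict_trans1[of _ "\<epsilon> / 2"])
  qed
  then show thesis by (rule that[OF _ m0]) (use Tm in \<open>auto simp: T_def\<close>)
qed

section \<open>Hardy's inequality\<close>

lemma integral_Re_cis: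
  fixes w :: complex and k :: int
  shows "integral {0..2*pi} (\<lambda>t. Re (w * cis (of_int k * t))) = (if k = 0 then 2 * pi * Re w else 0)"
proof (cases "k = 0")
  case False
  define F where "F t = Re (w * cis (of_int k * t) / (\<i> * of_int k))" for t :: real
  have "((\<lambda>t. Re (w * cis (of_int k * t))) has_integral (F (2*pi) - F 0)) {0..2*pi}"
  proof (rule fundamental_theorem_of_calculus)
    fix t :: real
    have "((\<lambda>t. w * cis (of_int k * t) / (\<i> * of_int k)) has_vector_derivative w * cis (of_int k * t)) (at t)"
    proof -
      have "((\<lambda>z. w * exp (\<i> * of_int k * z) / (\<i> * of_int k)) has_field_derivative w * exp (\<i> * of_int k * of_real t)) (at (of_real t))"
        using False by (auto intro!: derivative_eq_intros)
      then have "((\<lambda>t. w * exp (\<i> * of_int k * of_real t) / (\<i> * of_int k)) has_vector_derivative w * exp (\<i> * of_int k * of_real t)) (at t)"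
        by (rule has_vector_derivative_real_field)
      then show ?thesis by (simp add: cis_conv_exp mult.assoc)
    qed
    from bounded_linear.has_vector_derivative[OF bounded_linear_Re this]
    show "(F has_vector_derivative Re (w * cis (of_int k * t))) (at t within {0..2*pi})"
      unfolding F_def by (rule has_vector_derivative_at_within)
  qed simp
  moreover have "cis (of_int k * (2 * pi)) = 1"
    using cis_multiple_2pi[of "of_int k"] by (simp add: mult_ac)
  ultimately have "((\<lambda>t. Re (w * cis (of_int k * t))) has_integral 0) {0..2*pi}"
    by (simp add: F_def)
  then show ?thesis using False by (simp add: integral_unique)
qed simp

text \<open>Parseval's identity by orthogonality. The square is written as the real part of a double
  sum because \<open>circle_mean\<close> takes real integrands.\<close>

lemma circle_mean_polynomial_square:
  assumes "0 \<le> r"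
  shows "circle_mean (\<lambda>z. (norm (\<Sum>n<N. c n * z ^ n))\<^sup>2) r = (\<Sum>n<N. (norm (c n))\<^sup>2 * r ^ (2 * n))"
proof -
  have term_mean: "circle_mean (\<lambda>z. Re ((c n * z ^ n) * cnj (c m * z ^ m))) r
      = (if n = m then (norm (c n))\<^sup>2 * r ^ (2 * n) else 0)" for n m
  proof -
    have "Re ((c n * (of_real r * cis t) ^ n) * cnj (c m * (of_real r * cis t) ^ m))
        = Re ((of_real (r ^ (n + m)) * (c n * cnj (c m))) * cis (of_int (int n - int m) * t))" for t
    proof -
      have "cis t ^ n * cnj (cis t) ^ m = cis (of_int (int n - int m) * t)"
        unfolding cis_cnj Complex.DeMoivre cis_mult by (simp add: left_diff_distrib)
      then have "(c n * (of_real r * cis t) ^ n) * cnj (c m * (of_real r * cis t) ^ m)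
          = (of_real (r ^ (n + m)) * (c n * cnj (c m))) * cis (of_int (int n - int m) * t)"
        by (simp only: complex_cnj_mult complex_cnj_power complex_cnj_complex_of_real power_mult_distrib
            power_add of_real_mult of_real_power flip: \<open>cis t ^ n * cnj (cis t) ^ m = _\<close>) (simp only: mult_ac)
      then show ?thesis by (rule arg_cong)
    qed
    then have "circle_mean (\<lambda>z. Re ((c n * z ^ n) * cnj (c m * z ^ m))) r =
       (1 / (2 * pi)) * (if int n - int m = 0 then 2 * pi * Re (of_real (r ^ (n + m)) * (c n * cnj (c m))) else 0)"
      unfolding circle_mean_def by (simp only: integral_Re_cis)
    also have "\<dots> = (if n = m then (norm (c n))\<^sup>2 * r ^ (2 * n) else 0)"
    proof (cases "n = m")
      case True
      have "c n * cnj (c n) = of_real ((norm (c n))\<^sup>2)" by (simp only: complex_norm_square)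
      then have "Re (of_real (r ^ (n + m)) * (c n * cnj (c m))) = r ^ (2 * n) * (norm (c n))\<^sup>2"
        unfolding True by (simp only: of_real_mult[symmetric] Re_complex_of_real mult_2)
      then show ?thesis using True by simp
    qed simp
    finally show ?thesis .
  qed
  have sq: "(norm w)\<^sup>2 = Re (w * cnj w)" for w :: complex
    by (simp only: complex_norm_square[symmetric] of_real_power[symmetric] Re_complex_of_real)
  have "circle_mean (\<lambda>z. (norm (\<Sum>n<N. c n * z ^ n))\<^sup>2) r =
      circle_mean (\<lambda>z. \<Sum>n<N. \<Sum>m<N. Re ((c n * z ^ n) * cnj (c m * z ^ m))) r"
    by (rule arg_cong[where f = "\<lambda>f. circle_mean f r"], rule ext)
       (simp only: sq cnj_sum sum_product Re_sum)
  also have "\<dots> = (\<Sum>n<N. \<Sum>m<N. circle_mean (\<lambda>z. Re ((c n * z ^ n) * cnj (c m * z ^ m))) r)"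
    using assms by (subst circle_mean_sum, auto intro!: continuous_intros)
      (subst circle_mean_sum, auto intro!: continuous_intros)
  also have "\<dots> = (\<Sum>n<N. \<Sum>m<N. if n = m then (norm (c n))\<^sup>2 * r ^ (2 * n) else 0)"
    by (simp only: term_mean)
  also have "\<dots> = (\<Sum>n<N. (norm (c n))\<^sup>2 * r ^ (2 * n))" by simp
  finally show ?thesis .
qed

lemma bessel_circle_mean:
  assumes c: "analytic_series c" and r: "0 \<le> r" "r < 1"
  shows "(\<Sum>n<N. (norm (c n))\<^sup>2 * r ^ (2 * n)) \<le> circle_mean (\<lambda>z. (norm (series_fun c z))\<^sup>2) r"
proof (rule LIMSEQ_le_const)
  define B where "B = (\<Sum>n. norm (c n * of_real r ^ n))"
  have s: "summable (\<lambda>n. norm (c n * of_real r ^ n))"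
    using analytic_series_abs[OF c, of "of_real r"] r by simp
  show "(\<lambda>M. circle_mean (\<lambda>z. (norm (\<Sum>n<M. c n * z ^ n))\<^sup>2) r) \<longlonglongrightarrow> circle_mean (\<lambda>z. (norm (series_fun c z))\<^sup>2) r"
  proof (rule circle_mean_dominated[where B = "B\<^sup>2"])
    fix M show "continuous_on (sphere 0 r) (\<lambda>z. (norm (\<Sum>n<M. c n * z ^ n))\<^sup>2)"
      by (intro continuous_intros)
    fix z :: complex assume z: "norm z = r"
    have "norm (\<Sum>n<M. c n * z ^ n) \<le> (\<Sum>n<M. norm (c n * of_real r ^ n))"
      using z r by (intro order.trans[OF norm_sum]) (auto simp: norm_mult norm_power)
    also have "\<dots> \<le> B" unfolding B_def by (rule sum_le_suminf[OF s]) auto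
    finally show "\<bar>(norm (\<Sum>n<M. c n * z ^ n))\<^sup>2\<bar> \<le> B\<^sup>2" by (simp add: power_mono)
  next
    fix z :: complex assume z: "norm z = r"
    have "(\<lambda>M. \<Sum>n<M. c n * z ^ n) \<longlonglongrightarrow> series_fun c z"
      using analytic_series_sums[OF c, of z] z r by (simp add: sums_def)
    then show "(\<lambda>M. (norm (\<Sum>n<M. c n * z ^ n))\<^sup>2) \<longlonglongrightarrow> (norm (series_fun c z))\<^sup>2"
      by (intro tendsto_intros)
  qed (use r in auto)
  show "\<exists>K. \<forall>M\<ge>K. (\<Sum>n<N. (norm (c n))\<^sup>2 * r ^ (2 * n)) \<le> circle_mean (\<lambda>z. (norm (\<Sum>n<M. c n * z ^ n))\<^sup>2) r"
    unfolding circle_mean_polynomial_square[OF r(1)]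
    by (intro exI[of _ N] allI impI sum_mono2) (use r in auto)
qed

text \<open>The difference of the series has zero means, and Bessel's inequality at radius 1/2 then
  makes each of its coefficients zero.\<close>

lemma series_fun_unique:
  assumes "analytic_series c" "analytic_series d" "\<And>z. norm z < 1 \<Longrightarrow> series_fun c z = series_fun d z"
  shows "c = d"
proof
  fix n
  define e where "e n = c n - d n" for n
  have e_sums: "(\<lambda>n. e n * z ^ n) sums 0" if "norm z < 1" for z
    using sums_diff[OF analytic_series_sums[OF assms(1) that] analytic_series_sums[OF assms(2) that]] assms(3)[OF that]
    by (simp add: e_def algebra_simps)
  have e: "analytic_series e" using e_sums by (auto simp: analytic_series_def sums_iff)
  have "(\<Sum>m<Suc n. (norm (e m))\<^sup>2 * (1/2) ^ (2 * m)) \<le> circle_mean (\<lambda>z. (norm (series_fun e z))\<^sup>2) (1/2)"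
    by (rule bessel_circle_mean[OF e]) auto
  also have "\<dots> = circle_mean (\<lambda>z. 0) (1/2)"
    using e_sums by (intro circle_mean_cong) (auto simp: series_fun_def sums_iff)
  finally have "(\<Sum>m<Suc n. (norm (e m))\<^sup>2 * (1/2) ^ (2 * m)) \<le> 0" by simp
  moreover have "(norm (e n))\<^sup>2 * (1/2) ^ (2 * n) \<le> (\<Sum>m<Suc n. (norm (e m))\<^sup>2 * (1/2) ^ (2 * m))"
    by (rule member_le_sum) auto
  ultimately have "(norm (e n))\<^sup>2 * (1/2) ^ (2 * n) \<le> 0" by simp
  moreover have "(1/2 :: real) ^ (2 * n) > 0" by simp
  ultimately have "(norm (e n))\<^sup>2 \<le> 0" by (metis mult_le_0_iff not_le)
  then show "c n = d n" by (simp add: e_def)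
qed

section \<open>Schur's test for the Hilbert matrix\<close>

lemma hilbert_weight_sum:
  "(\<Sum>j<N. sqrt (real (i + 1) / real (j + 1)) / real (i + j + 1)) \<le> 4"
proof -
  define s where "s = sqrt (real (i + 1))"
  have s: "s > 0" "s * s = real (i + 1)" by (auto simp: s_def)
  \<comment> \<open>A telescoping bound, from y^2 - x^2 = 1 and y + x <= 2 y for neighbouring square
    roots.\<close>
  have step: "1 / sqrt (real (n + 1)) \<le> 2 * (sqrt (real (n + 1)) - sqrt (real n))" for n
  proof -
    define x y where "x = sqrt (real n)" and "y = sqrt (real (n + 1))"
    have *: "x \<ge> 0" "y > 0" "x \<le> y" "y * y - x * x = 1" by (auto simp: x_def y_def)
    have "(y - x) * (y + x) = 1" using * by (simp add: algebra_simps)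
    moreover have "(y - x) * (y + x) \<le> (y - x) * (2 * y)" using * by (intro mult_left_mono) auto
    ultimately have "1 \<le> (y - x) * (2 * y)" by linarith
    also have "\<dots> = (2 * (y - x)) * y" by simp
    finally have "1 \<le> (2 * (y - x)) * y" .
    then show ?thesis using * unfolding x_def[symmetric] y_def[symmetric] by (simp add: divide_le_eq)
  qed
  define S where "S N = (\<Sum>j<N. 1 / (sqrt (real (j + 1)) * real (i + j + 1)))" for N
  \<comment> \<open>Up to j = i the factor i + j + 1 is replaced by i + 1, afterwards by j + 1. Each
    range contributes at most 2 / s. Both bounds equal 2 / s at N = i + 1, where the induction
    passes from one to the other.\<close>
  have S_le: "(N \<le> i + 1 \<longrightarrow> S N \<le> 2 * sqrt (real N) / (s * s)) \<and> (i + 1 \<le> N \<longrightarrow> S N \<le> 4 / s - 2 / sqrt (real N))" for N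
  proof (induction N)
    case 0
    show ?case using s by (simp add: S_def)
  next
    case (Suc n)
    have SS: "S (Suc n) = S n + 1 / (sqrt (real (n + 1)) * real (i + n + 1))" by (simp add: S_def)
    have sm: "S (Suc n) \<le> 2 * sqrt (real (Suc n)) / (s * s)" if "Suc n \<le> i + 1"
    proof -
      have "1 / (sqrt (real (n + 1)) * real (i + n + 1)) \<le> (1 / sqrt (real (n + 1))) * (1 / (s * s))"
      proof -
        have "1 / real (i + n + 1) \<le> 1 / (s * s)" unfolding s(2) by (intro divide_left_mono) auto
        then have "(1 / sqrt (real (n + 1))) * (1 / real (i + n + 1)) \<le> (1 / sqrt (real (n + 1))) * (1 / (s * s))"
          by (rule mult_left_mono) simp
        then show ?thesis by simp
      qed
      also have "\<dots> \<le> (2 * (sqrt (real (n + 1)) - sqrt (real n))) * (1 / (s * s))"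
        using s by (intro mult_right_mono step) auto
      finally have "1 / (sqrt (real (n + 1)) * real (i + n + 1)) \<le> 2 * sqrt (real (n + 1)) / (s * s) - 2 * sqrt (real n) / (s * s)"
        by (simp add: field_simps diff_divide_distrib)
      moreover have "S n \<le> 2 * sqrt (real n) / (s * s)" using Suc that by simp
      ultimately show ?thesis using SS by simp
    qed
    have lg: "S (Suc n) \<le> 4 / s - 2 / sqrt (real (Suc n))" if "i + 1 \<le> Suc n"
    proof (cases "Suc n = i + 1")
      case True
      have "2 * sqrt (real (Suc n)) / (s * s) = 4 / s - 2 / sqrt (real (Suc n))"
        using s unfolding True s_def[symmetric] by (simp add: field_simps)
      then show ?thesis using sm True by simp
    next
      case False
      then have n: "i + 1 \<le> n" using that by simp
      define x y where "x = sqrt (real n)" and "y = sqrt (real (n + 1))"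
      have *: "x > 0" "y > 0" "x \<le> y" "y * y = real (n + 1)" using n by (auto simp: x_def y_def)
      have "1 / (y * real (i + n + 1)) \<le> 1 / (y * (y * y))"
        unfolding *(4) using * by (intro divide_left_mono mult_left_mono) auto
      also have "\<dots> \<le> (1 / y) * (1 / (x * y))"
      proof -
        have "1 / (y * y) \<le> 1 / (x * y)" using * by (intro divide_left_mono mult_right_mono) auto
        then have "(1 / y) * (1 / (y * y)) \<le> (1 / y) * (1 / (x * y))"
          by (rule mult_left_mono) (use * in simp)
        then show ?thesis by simp
      qed
      also have "\<dots> \<le> (2 * (y - x)) * (1 / (x * y))"
        using * step[of n] unfolding x_def[symmetric] y_def[symmetric] by (intro mult_right_mono) auto
      also have "\<dots> = 2 / x - 2 / y" using * by (simp add: field_simps)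
      finally have "1 / (y * real (i + n + 1)) \<le> 2 / x - 2 / y" .
      moreover have "S n \<le> 4 / s - 2 / x" using Suc n by (simp add: x_def)
      ultimately show ?thesis using SS by (simp add: y_def add.commute)
    qed
    show ?case using sm lg by blast
  qed
  have "S N \<le> 4 / s"
  proof (cases "N \<le> i + 1")
    case True
    then have "S N \<le> 2 * sqrt (real N) / (s * s)" using S_le by blast
    also have "\<dots> \<le> 2 * s / (s * s)"
      using True s by (intro divide_right_mono mult_left_mono) (auto simp: s_def)
    also have "\<dots> \<le> 4 / s" using s by (simp add: field_simps)
    finally show ?thesis .
  next
    case False
    then have "S N \<le> 4 / s - 2 / sqrt (real N)" using S_le[of N] by simp
    moreover have "0 \<le> 2 / sqrt (real N)" by simp
    ultimately show ?thesis by linarith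
  qed
  then have "s * S N \<le> 4" using s by (simp add: field_simps)
  moreover have "s * S N = (\<Sum>j<N. sqrt (real (i + 1) / real (j + 1)) / real (i + j + 1))"
    unfolding S_def s_def sum_distrib_left by (simp add: real_sqrt_divide)
  ultimately show ?thesis by simp
qed

text \<open>Schur's test for the Hilbert matrix, with weights $\sqrt{(i+1)/(j+1)}$.\<close>

lemma hilbert_inequality:
  fixes x y :: "nat \<Rightarrow> real"
  shows "(\<Sum>i<N. \<Sum>j<N. x i * y j / real (i + j + 1)) \<le> 2 * (\<Sum>i<N. (x i)\<^sup>2) + 2 * (\<Sum>j<N. (y j)\<^sup>2)"
proof -
  define w where "w i j = sqrt (real (i + 1) / real (j + 1)) / real (i + j + 1)" for i j
  have "x i * y j / real (i + j + 1) \<le> (x i)\<^sup>2 / 2 * w i j + (y j)\<^sup>2 / 2 * w j i" for i j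
  proof -
    \<comment> \<open>A fourth root, so that writing the product as (x u) (y / u) leaves the weight
      u^2 on one square and its inverse on the other. The constants 2 in the claim are half of the
      row sum bound 4.\<close>
    define u where "u = sqrt (sqrt (real (i + 1) / real (j + 1)))"
    have u: "u > 0" "u\<^sup>2 = sqrt (real (i + 1) / real (j + 1))" by (auto simp: u_def)
    have "sqrt (real (j + 1) / real (i + 1)) = 1 / u\<^sup>2"
      unfolding u(2) by (simp add: real_sqrt_divide)
    then have w: "w i j = u\<^sup>2 / real (i + j + 1)" "w j i = (1 / u\<^sup>2) / real (i + j + 1)"
      by (simp_all add: w_def u(2) add.commute)
    have "2 * (x i * u) * (y j / u) \<le> (x i * u)\<^sup>2 + (y j / u)\<^sup>2" by (rule sum_squares_bound)
    then have "x i * y j \<le> (x i)\<^sup>2 / 2 * u\<^sup>2 + (y j)\<^sup>2 / 2 * (1 / u\<^sup>2)"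
      using u(1) by (simp add: power_mult_distrib power_divide)
    then have "x i * y j / real (i + j + 1) \<le> ((x i)\<^sup>2 / 2 * u\<^sup>2 + (y j)\<^sup>2 / 2 * (1 / u\<^sup>2)) / real (i + j + 1)"
      by (rule divide_right_mono) auto
    then show ?thesis unfolding w by (simp only: add_divide_distrib times_divide_eq_right)
  qed
  then have "(\<Sum>i<N. \<Sum>j<N. x i * y j / real (i + j + 1)) \<le> (\<Sum>i<N. \<Sum>j<N. (x i)\<^sup>2 / 2 * w i j + (y j)\<^sup>2 / 2 * w j i)"
    by (intro sum_mono)
  also have "\<dots> = (\<Sum>i<N. (x i)\<^sup>2 / 2 * (\<Sum>j<N. w i j)) + (\<Sum>j<N. (y j)\<^sup>2 / 2 * (\<Sum>i<N. w j i))"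
    unfolding sum.distrib sum_distrib_left by (intro arg_cong2[where f = "(+)"] refl sum.swap)
  also have "\<dots> \<le> (\<Sum>i<N. (x i)\<^sup>2 / 2 * 4) + (\<Sum>j<N. (y j)\<^sup>2 / 2 * 4)"
    unfolding w_def by (intro add_mono sum_mono mult_left_mono hilbert_weight_sum) auto
  finally show ?thesis by (simp add: sum_distrib_left mult.commute)
qed

text \<open>The zeros in the open disc are divided out by Blaschke factors.\<close>

lemma blaschke_division:
  assumes "f holomorphic_on ball 0 R" "1 < R" "finite {z \<in> ball 0 1. f z = 0}"
  shows "\<exists>k. k holomorphic_on ball 0 R \<and> (\<forall>z\<in>ball 0 1. k z \<noteq> 0 \<and> norm (f z) \<le> norm (k z)) \<and>
      (\<forall>z. norm z = 1 \<longrightarrow> norm (k z) = norm (f z))"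
  using assms(1,3)
\<comment> \<open>The count is of distinct zeros: one step removes a zero with its whole
  multiplicity.\<close>
proof (induction "card {z \<in> ball 0 1. f z = 0}" arbitrary: f rule: less_induct)
  case less
  define Z where "Z = {z \<in> ball 0 1. f z = 0}"
  show ?case
  proof (cases "Z = {}")
    case True
    then show ?thesis using less.prems(1) by (intro exI[of _ f]) (auto simp: Z_def)
  next
    case False
    then obtain \<xi> where \<xi>: "norm \<xi> < 1" "f \<xi> = 0" by (auto simp: Z_def)
    have \<xi>R: "\<xi> \<in> ball 0 R" using \<xi>(1) assms(2) by simp
    have nonconst: "\<not> f constant_on ball 0 R"
    proof
      assume "f constant_on ball 0 R"
      then obtain y where y: "\<And>z. z \<in> ball 0 R \<Longrightarrow> f z = y" unfolding constant_on_def by blast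
      then have "y = 0" using \<xi>(2) \<xi>R by blast
      then have "f z = 0" if "z \<in> ball 0 1" for z
        using that y[of z] assms(2) by simp
      then have "{z \<in> ball 0 1. f z = 0} = ball 0 1" by auto
      then show False using less.prems(2) uncountable_ball[of 1 "0::complex"] by (simp add: countable_finite)
    qed
    obtain g s n where g: "0 < n" "0 < s" "ball \<xi> s \<subseteq> ball 0 R" "g holomorphic_on ball \<xi> s"
        "\<And>w. w \<in> ball \<xi> s \<Longrightarrow> f w = (w - \<xi>) ^ n * g w" "\<And>w. w \<in> ball \<xi> s \<Longrightarrow> g w \<noteq> 0"
      by (rule holomorphic_factor_zero_nonconstant[OF less.prems(1) open_ball connected_ball \<xi>R \<xi>(2) nonconst]) blast
    \<comment> \<open>The quotient with its removable singularity filled in by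
      \<open>g\<close>.\<close>
    define G where "G w = (if w = \<xi> then g \<xi> else f w / (w - \<xi>) ^ n)" for w
    have Gg: "G w = g w" if "w \<in> ball \<xi> s" for w using g(5)[OF that] by (auto simp: G_def)
    have "G holomorphic_on ball \<xi> s"
      using g(4) by (rule holomorphic_transform) (simp only: Gg)
    moreover have "G holomorphic_on (ball 0 R - {\<xi>})"
    proof -
      have "(\<lambda>w. f w / (w - \<xi>) ^ n) holomorphic_on (ball 0 R - {\<xi>})"
        by (intro holomorphic_intros holomorphic_on_subset[OF less.prems(1)]) auto
      then show ?thesis by (rule holomorphic_transform) (auto simp: G_def)
    qed
    ultimately have "G holomorphic_on (ball \<xi> s \<union> (ball 0 R - {\<xi>}))"
      by (intro holomorphic_on_Un open_ball open_delete)
    moreover have "ball \<xi> s \<union> (ball 0 R - {\<xi>}) = ball 0 R" using g(2,3) by auto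
    ultimately have G: "G holomorphic_on ball 0 R" by simp
    have fG: "f w = (w - \<xi>) ^ n * G w" for w
      using g(1) \<xi>(2) by (auto simp: G_def)
    have G\<xi>: "G \<xi> \<noteq> 0" using g(6)[of \<xi>] g(2) by (simp add: G_def)
    \<comment> \<open>Exchanging (w - \<xi>)^n for \<open>(1 - cnj \<xi> * w) ^ n\<close> is
      division by a power of a Blaschke factor, done without creating a pole, so the result is
      holomorphic on the same larger disc.\<close>
    define f2 where "f2 w = (1 - cnj \<xi> * w) ^ n * G w" for w
    have f2: "f2 holomorphic_on ball 0 R" unfolding f2_def by (intro holomorphic_intros G)
    have nz: "1 - cnj \<xi> * w \<noteq> 0" if "norm w < 1" for w
    proof
      assume "1 - cnj \<xi> * w = 0"
      then have "norm (cnj \<xi> * w) = 1" by simp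
      moreover have "norm \<xi> * norm w \<le> norm \<xi> * 1" using that by (intro mult_left_mono) auto
      ultimately show False using \<xi>(1) by (simp add: norm_mult)
    qed
    have Z2: "{z \<in> ball 0 1. f2 z = 0} \<subseteq> Z - {\<xi>}"
      using nz G\<xi> by (auto simp: f2_def Z_def fG)
    have finZ: "finite Z" using less.prems(2) by (simp add: Z_def)
    have "card {z \<in> ball 0 1. f2 z = 0} < card Z"
      using Z2 finZ \<xi> by (intro psubset_card_mono) (auto simp: Z_def)
    from less.hyps[OF this[unfolded Z_def] f2 finite_subset[OF Z2]] finZ
    obtain k where k: "k holomorphic_on ball 0 R"
        "\<And>z. z \<in> ball 0 1 \<Longrightarrow> k z \<noteq> 0 \<and> norm (f2 z) \<le> norm (k z)"
        "\<And>z. norm z = 1 \<Longrightarrow> norm (k z) = norm (f2 z)" by auto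
    \<comment> \<open>The subtracted product is nonnegative in the closed disc and vanishes on the
      unit circle; this gives both comparisons of moduli below.\<close>
    have id: "(norm (w - \<xi>))\<^sup>2 = (norm (1 - cnj \<xi> * w))\<^sup>2 - (1 - (norm w)\<^sup>2) * (1 - (norm \<xi>)\<^sup>2)" for w
      unfolding cmod_power2 by (simp add: power2_eq_square algebra_simps)
    have le: "norm (w - \<xi>) \<le> norm (1 - cnj \<xi> * w)" if "norm w \<le> 1" for w
    proof (rule power2_le_imp_le)
      have "0 \<le> (1 - (norm w)\<^sup>2) * (1 - (norm \<xi>)\<^sup>2)"
        using that \<xi>(1) by (intro mult_nonneg_nonneg) (auto simp: power_le_one)
      then show "(norm (w - \<xi>))\<^sup>2 \<le> (norm (1 - cnj \<xi> * w))\<^sup>2" using id[of w] by linarith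
    qed simp
    have eq: "norm (w - \<xi>) = norm (1 - cnj \<xi> * w)" if "norm w = 1" for w
      using id[of w] that by (auto intro: power2_eq_imp_eq)
    have f_le: "norm (f z) \<le> norm (f2 z)" if "norm z \<le> 1" for z
      unfolding fG f2_def norm_mult norm_power by (intro mult_right_mono power_mono le that) auto
    have f_eq: "norm (f z) = norm (f2 z)" if "norm z = 1" for z
      unfolding fG f2_def norm_mult norm_power eq[OF that] by simp
    have "norm (f z) \<le> norm (k z)" if "z \<in> ball 0 1" for z
      using k(2)[OF that] f_le[of z] that by simp
    then show ?thesis using k f_eq by (intro exI[of _ k]) auto
  qed
qed

text \<open>A function in $H^1$ is a product $st$ of two functions in $H^2$, where $s^2$ is the
  zero-free part left after dividing out the zeros; Hilbert's inequality bounds the product.\<close>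

lemma hardy_inequality_partial:
  assumes b: "analytic_series b" and r: "0 < r" "r < 1" and \<rho>: "0 \<le> \<rho>" "\<rho> < 1"
  shows "(\<Sum>n<N. norm (b n) * (r * \<rho>) ^ n / real (n + 1)) \<le> 4 * circle_mean (\<lambda>z. norm (series_fun b z)) r"
proof -
  \<comment> \<open>Rescaling makes F holomorphic across the unit circle, so a nonconstant F has
    only finitely many zeros in the closed disc.\<close>
  define F where "F z = series_fun b (of_real r * z)" for z
  define R where "R = 1 / r"
  have R: "1 < R" using r by (simp add: R_def)
  have hol: "F holomorphic_on ball 0 R"
  proof -
    have "(series_fun b \<circ> (\<lambda>z. of_real r * z)) holomorphic_on ball 0 R"
      by (rule holomorphic_on_compose_gen[OF _ series_fun_holomorphic[OF b]])
         (use r in \<open>auto intro!: holomorphic_intros simp: norm_mult R_def field_simps\<close>)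
    then show ?thesis by (simp add: o_def F_def[abs_def])
  qed
  have F_series: "F z = series_fun (\<lambda>n. b n * of_real r ^ n) z" for z
    by (simp add: F_def series_fun_def power_mult_distrib mult.assoc)
  have br: "analytic_series (\<lambda>n. b n * of_real r ^ n)"
    by (rule analytic_seriesI_le[OF b, of _ 1])
       (use r in \<open>auto simp: norm_mult norm_power mult_left_le power_le_one\<close>)
  have mean: "circle_mean (\<lambda>z. norm (series_fun b z)) r = circle_mean (\<lambda>z. norm (F z)) 1"
    unfolding F_def by (rule circle_mean_scale1)
  have cF: "continuous_on (sphere 0 1) F" by (rule holomorphic_on_sphere_continuous[OF hol R])
  show ?thesis
  proof (cases "\<forall>z\<in>ball 0 1. F z = 0")
    case True
    have "(\<lambda>n. b n * of_real r ^ n) = (\<lambda>_. 0)"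
      by (rule series_fun_unique[OF br]) (use True F_series in \<open>auto simp: analytic_series_def series_fun_def\<close>)
    then have "b n = 0" for n using r by (metis mult_eq_0_iff of_real_eq_0_iff order_less_irrefl power_not_zero)
    moreover have "0 \<le> circle_mean (\<lambda>z. norm (F z)) 1"
      by (rule circle_mean_nonneg) (auto intro!: continuous_intros cF)
    ultimately show ?thesis unfolding mean by simp
  next
    case False
    have "finite {z \<in> ball 0 1. F z = 0}"
    proof (cases "F constant_on ball 0 R")
      case True
      then obtain y where y: "\<And>z. z \<in> ball 0 R \<Longrightarrow> F z = y" unfolding constant_on_def by blast
      then have "y \<noteq> 0" using False R by force
      then have "F z \<noteq> 0" if "z \<in> ball 0 1" for z using y[of z] that R by simp
      then have "{z \<in> ball 0 1. F z = 0} = {}" by blast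
      then show ?thesis by (simp only: finite.emptyI)
    next
      case False
      have "finite {z \<in> cball 0 1. F z = 0}"
        by (rule holomorphic_compact_finite_zeros[OF hol _ _ _ _ False]) (use R in auto)
      then show ?thesis by (rule finite_subset[rotated]) auto
    qed
    from blaschke_division[OF hol R this] obtain k where k: "k holomorphic_on ball 0 R"
        "\<And>z. z \<in> ball 0 1 \<Longrightarrow> k z \<noteq> 0" "\<And>z. z \<in> ball 0 1 \<Longrightarrow> norm (F z) \<le> norm (k z)"
        "\<And>z. norm z = 1 \<Longrightarrow> norm (k z) = norm (F z)" by blast
    have k1: "k holomorphic_on ball 0 1" using k(1) by (rule holomorphic_on_subset) (use R in auto)
    \<comment> \<open>The square root is available on the open disc, where k has no zeros. Hence the
      coefficients of s and t are estimated on a second radius \<rho> < 1.\<close>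
    obtain s where s: "s holomorphic_on ball 0 1" "\<And>z. z \<in> ball 0 1 \<Longrightarrow> k z = (s z)\<^sup>2"
      using contractible_imp_holomorphic_sqrt[OF k1 convex_imp_contractible[OF convex_ball] k(2)] by blast
    have s0: "s z \<noteq> 0" if "z \<in> ball 0 1" for z using s(2)[OF that] k(2)[OF that] by auto
    \<comment> \<open>Since |F| <= |k| = |s|^2 in the disc, |t|^2 = |F|^2 / |k| is at most |k|, so s
      and t obey the same bound.\<close>
    define t where "t z = F z / s z" for z
    have F1: "F holomorphic_on ball 0 1" using hol by (rule holomorphic_on_subset) (use R in auto)
    have t: "t holomorphic_on ball 0 1" unfolding t_def by (intro holomorphic_intros F1 s s0)
    have s_sq: "(norm (s z))\<^sup>2 = norm (k z)" if "norm z < 1" for z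
      using s(2)[of z] that by (simp add: norm_power)
    have t_sq: "(norm (t z))\<^sup>2 \<le> norm (k z)" if "norm z < 1" for z
    proof -
      have "(norm (t z))\<^sup>2 = (norm (F z))\<^sup>2 / norm (k z)"
        using s_sq[OF that] by (simp add: t_def norm_divide power_divide)
      also have "\<dots> \<le> (norm (k z))\<^sup>2 / norm (k z)"
        using k(3)[of z] that by (intro divide_right_mono power_mono) auto
      also have "\<dots> = norm (k z)" using k(2)[of z] that by (simp add: power2_eq_square)
      finally show ?thesis .
    qed
    obtain \<sigma> \<tau> where \<sigma>: "analytic_series \<sigma>" "\<And>z. norm z < 1 \<Longrightarrow> s z = series_fun \<sigma> z"
      and \<tau>: "analytic_series \<tau>" "\<And>z. norm z < 1 \<Longrightarrow> t z = series_fun \<tau> z"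
      using holomorphic_series[OF s(1)] holomorphic_series[OF t] by blast
    let ?m = "circle_mean (\<lambda>z. norm (F z)) 1"
    have k_mean: "circle_mean (\<lambda>z. norm (k z)) \<rho> \<le> ?m"
    proof -
      have "circle_mean (\<lambda>z. norm (k z) powr 1) \<rho> \<le> circle_mean (\<lambda>z. norm (k z) powr 1) 1"
        by (rule circle_mean_norm_powr_mono[OF k(1)]) (use \<rho> R in auto)
      moreover have "circle_mean (\<lambda>z. norm (k z)) 1 = ?m"
        by (rule circle_mean_cong) (use k(4) in auto)
      ultimately show ?thesis by simp
    qed
    have ck: "continuous_on (sphere 0 \<rho>) (\<lambda>z. norm (k z))"
      by (intro continuous_on_norm holomorphic_on_sphere_continuous[OF k1 \<rho>(2)])
    \<comment> \<open>Bessel's inequality on radius \<rho>; monotonicity then carries the mean of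
      |k| out to the unit circle, where |k| = |F|.\<close>
    have coeff_bound: "(\<Sum>n<N. (norm (c n) * \<rho> ^ n)\<^sup>2) \<le> ?m"
      if "analytic_series c" "\<And>z. norm z < 1 \<Longrightarrow> (norm (series_fun c z))\<^sup>2 \<le> norm (k z)" for c
    proof -
      have "(\<Sum>n<N. (norm (c n) * \<rho> ^ n)\<^sup>2) = (\<Sum>n<N. (norm (c n))\<^sup>2 * \<rho> ^ (2 * n))"
        by (simp add: power_mult_distrib power_mult[symmetric] mult.commute)
      also have "\<dots> \<le> circle_mean (\<lambda>z. (norm (series_fun c z))\<^sup>2) \<rho>"
        by (rule bessel_circle_mean[OF that(1) \<rho>])
      also have "\<dots> \<le> circle_mean (\<lambda>z. norm (k z)) \<rho>"
        using that(2) \<rho> holomorphic_on_sphere_continuous[OF series_fun_holomorphic[OF that(1)] \<rho>(2)]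
        by (intro circle_mean_mono ck) (auto intro!: continuous_intros)
      finally show ?thesis using k_mean by simp
    qed
    define x y where "x n = norm (\<sigma> n) * \<rho> ^ n" and "y n = norm (\<tau> n) * \<rho> ^ n" for n
    have xy: "0 \<le> x n" "0 \<le> y n" for n using \<rho> by (auto simp: x_def y_def)
    define p where "p n = (\<Sum>i\<le>n. \<sigma> i * \<tau> (n - i))" for n
    have p_sums: "(\<lambda>n. p n * z ^ n) sums F z" if z: "norm z < 1" for z
    proof -
      have "(\<lambda>n. \<Sum>i\<le>n. (\<sigma> i * z ^ i) * (\<tau> (n - i) * z ^ (n - i))) sums
          ((\<Sum>n. \<sigma> n * z ^ n) * (\<Sum>n. \<tau> n * z ^ n))"
        by (rule Cauchy_product_sums[OF analytic_series_abs[OF \<sigma>(1) z] analytic_series_abs[OF \<tau>(1) z]])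
      moreover have "(\<Sum>i\<le>n. (\<sigma> i * z ^ i) * (\<tau> (n - i) * z ^ (n - i))) = p n * z ^ n" for n
      proof -
        have m: "(\<sigma> i * z ^ i) * (\<tau> (n - i) * z ^ (n - i)) = \<sigma> i * \<tau> (n - i) * z ^ n" if "i \<le> n" for i
          using that by (metis (no_types, opaque_lifting) le_add_diff_inverse mult.assoc mult.left_commute power_add)
        show ?thesis unfolding p_def sum_distrib_right by (rule sum.cong[OF refl], rule m) simp
      qed
      moreover have "(\<Sum>n. \<sigma> n * z ^ n) * (\<Sum>n. \<tau> n * z ^ n) = F z"
      proof -
        have "s z * t z = F z" using s0[of z] z by (simp add: t_def)
        then show ?thesis unfolding \<sigma>(2)[OF z] \<tau>(2)[OF z] series_fun_def .
      qed
      ultimately show ?thesis by simp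
    qed
    have p: "(\<lambda>n. b n * of_real r ^ n) = p"
    proof (rule series_fun_unique[OF br])
      show "analytic_series p" using p_sums by (auto simp: analytic_series_def sums_iff)
      show "series_fun (\<lambda>n. b n * of_real r ^ n) z = series_fun p z" if "norm z < 1" for z
        using p_sums[OF that] F_series by (simp add: series_fun_def sums_iff)
    qed
    have pn: "norm (b n) * (r * \<rho>) ^ n \<le> (\<Sum>i\<le>n. x i * y (n - i))" for n
    proof -
      have "norm (b n) * (r * \<rho>) ^ n = norm (p n) * \<rho> ^ n"
        using fun_cong[OF p, of n] r by (simp add: norm_mult norm_power power_mult_distrib flip: fun_cong[OF p])
      also have "\<dots> \<le> (\<Sum>i\<le>n. norm (\<sigma> i * \<tau> (n - i))) * \<rho> ^ n"
        unfolding p_def by (intro mult_right_mono norm_sum) (use \<rho> in auto)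
      also have "\<dots> = (\<Sum>i\<le>n. x i * y (n - i))"
        unfolding sum_distrib_right x_def y_def norm_mult
        by (rule sum.cong) (auto simp: mult_ac simp flip: power_add)
      finally show ?thesis .
    qed
    have "(\<Sum>n<N. norm (b n) * (r * \<rho>) ^ n / real (n + 1)) \<le> (\<Sum>n<N. (\<Sum>i\<le>n. x i * y (n - i)) / real (n + 1))"
      by (intro sum_mono divide_right_mono pn) auto
    also have "\<dots> = (\<Sum>n<N. \<Sum>i\<le>n. x i * y (n - i) / real (i + (n - i) + 1))"
      by (simp add: sum_divide_distrib)
    also have "\<dots> = (\<Sum>(i, j)\<in>{(i, j). i + j < N}. x i * y j / real (i + j + 1))"
      by (rule sum.triangle_reindex[symmetric])
    \<comment> \<open>The Cauchy product runs over the triangle i + j < N; its terms are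
      nonnegative, so it may be enlarged to the square.\<close>
    also have "\<dots> \<le> (\<Sum>(i, j)\<in>{..<N} \<times> {..<N}. x i * y j / real (i + j + 1))"
      by (rule sum_mono2) (use xy in auto)
    also have "\<dots> = (\<Sum>i<N. \<Sum>j<N. x i * y j / real (i + j + 1))"
      by (simp add: sum.cartesian_product)
    also have "\<dots> \<le> 2 * (\<Sum>i<N. (x i)\<^sup>2) + 2 * (\<Sum>j<N. (y j)\<^sup>2)" by (rule hilbert_inequality)
    also have "\<dots> \<le> 2 * ?m + 2 * ?m"
    proof (intro add_mono mult_left_mono)
      show "(\<Sum>i<N. (x i)\<^sup>2) \<le> ?m"
        unfolding x_def by (rule coeff_bound[OF \<sigma>(1)]) (use \<sigma>(2) s_sq in fastforce)
      show "(\<Sum>j<N. (y j)\<^sup>2) \<le> ?m"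
        unfolding y_def by (rule coeff_bound[OF \<tau>(1)]) (use \<tau>(2) t_sq in fastforce)
    qed auto
    finally show ?thesis unfolding mean by simp
  qed
qed

text \<open>Both radii of the partial inequality tend to 1 along the same sequence, for a fixed
  number of terms. The terms are nonnegative, so the bounded partial sums converge.\<close>

theorem hardy_inequality:
  assumes b: "analytic_series b"
    and M: "\<And>r. 0 < r \<Longrightarrow> r < 1 \<Longrightarrow> circle_mean (\<lambda>z. norm (series_fun b z)) r \<le> M"
  shows "summable (\<lambda>n. norm (b n) / real (n + 1))" "(\<Sum>n. norm (b n) / real (n + 1)) \<le> 4 * M"
proof -
  have partial: "(\<Sum>n<N. norm (b n) / real (n + 1)) \<le> 4 * M" for N
  proof -
    define \<rho> where "\<rho> n = 1 - 1 / real (n + 2)" for n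
    have \<rho>: "0 < \<rho> n" "\<rho> n < 1" for n by (auto simp: \<rho>_def field_simps)
    have "(\<lambda>n. 1 - 1 / real (n + 2)) \<longlonglongrightarrow> 1 - 0"
      by (intro tendsto_diff tendsto_const LIMSEQ_ignore_initial_segment[OF lim_1_over_n])
    then have \<rho>_lim: "\<rho> \<longlonglongrightarrow> 1" by (simp add: \<rho>_def[abs_def])
    have "(\<lambda>k. \<Sum>n<N. norm (b n) * (\<rho> k * \<rho> k) ^ n / real (n + 1)) \<longlonglongrightarrow> (\<Sum>n<N. norm (b n) * (1 * 1) ^ n / real (n + 1))"
      by (intro tendsto_sum tendsto_divide tendsto_mult tendsto_power tendsto_const \<rho>_lim) auto
    moreover have "(\<Sum>n<N. norm (b n) * (\<rho> k * \<rho> k) ^ n / real (n + 1)) \<le> 4 * M" for k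
      using hardy_inequality_partial[OF b \<rho>[of k] less_imp_le[OF \<rho>(1)[of k]] \<rho>(2)[of k], of N] M[OF \<rho>, of k] by linarith
    ultimately have "(\<Sum>n<N. norm (b n) * (1 * 1) ^ n / real (n + 1)) \<le> 4 * M"
      by (intro LIMSEQ_le_const2) auto
    then show ?thesis by simp
  qed
  show "summable (\<lambda>n. norm (b n) / real (n + 1))"
    by (rule summableI_nonneg_bounded[OF _ partial]) auto
  then show "(\<Sum>n. norm (b n) / real (n + 1)) \<le> 4 * M"
    by (rule suminf_le_const) (rule partial)
qed

section \<open>Hardy spaces\<close>

lemma integral_mean_circle_mean:
  "integral_mean p f r = circle_mean (\<lambda>z. norm (f z) powr p) r powr (1 / p)"
  by (simp add: integral_mean_def circle_mean_def)

text \<open>This lemma and its converse \<open>hardy_spaceD\<close> translate between uniform bounds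
  on means of p-th powers and the norm, which is a supremum of p-th roots. The radius 1/2 is a
  sample of the nonempty range.\<close>

lemma hardy_spaceI:
  assumes f: "f holomorphic_on ball 0 1" and p: "0 < p"
    and M: "\<And>r. 0 < r \<Longrightarrow> r < 1 \<Longrightarrow> circle_mean (\<lambda>z. norm (f z) powr p) r \<le> M"
  shows "f \<in> hardy_space p" "0 \<le> hardy_norm p f" "hardy_norm p f powr p \<le> M"
proof -
  have mean0: "0 \<le> circle_mean (\<lambda>z. norm (f z) powr p) r" if "0 < r" "r < 1" for r
    by (rule circle_mean_nonneg)
       (use that p in \<open>auto intro!: continuous_on_norm_powr holomorphic_on_sphere_continuous[OF f]\<close>)
  have M0: "0 \<le> M" using mean0[of "1/2"] M[of "1/2"] by simp
  have le: "integral_mean p f r \<le> M powr (1 / p)" if "r \<in> {0<..<1}" for r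
    unfolding integral_mean_circle_mean using that M mean0 p by (intro powr_mono2) auto
  have bdd: "bdd_above (integral_mean p f ` {0<..<1})"
    unfolding bdd_above_def using le by blast
  then show "f \<in> hardy_space p" using f by (simp add: hardy_space_def)
  have "integral_mean p f (1/2) \<le> hardy_norm p f"
    unfolding hardy_norm_def by (rule cSUP_upper[OF _ bdd]) simp
  moreover have "0 \<le> integral_mean p f (1/2)" by (simp add: integral_mean_circle_mean)
  ultimately show N0: "0 \<le> hardy_norm p f" by simp
  have "hardy_norm p f \<le> M powr (1 / p)"
    unfolding hardy_norm_def by (rule cSUP_least) (use le in auto)
  then have "hardy_norm p f powr p \<le> (M powr (1 / p)) powr p"
    using N0 p by (intro powr_mono2) auto
  also have "\<dots> = M" using M0 p by (simp add: powr_powr)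
  finally show "hardy_norm p f powr p \<le> M" .
qed

lemma hardy_spaceD:
  assumes f: "f \<in> hardy_space p" and p: "0 < p"
  shows "f holomorphic_on ball 0 1" "0 \<le> hardy_norm p f"
    "\<And>r. 0 < r \<Longrightarrow> r < 1 \<Longrightarrow> circle_mean (\<lambda>z. norm (f z) powr p) r \<le> hardy_norm p f powr p"
proof -
  show hol: "f holomorphic_on ball 0 1" using f by (simp add: hardy_space_def)
  have le: "integral_mean p f r \<le> hardy_norm p f" if "0 < r" "r < 1" for r
    unfolding hardy_norm_def by (rule cSUP_upper) (use f that in \<open>auto simp: hardy_space_def\<close>)
  have i0: "0 \<le> integral_mean p f r" for r by (simp add: integral_mean_circle_mean)
  show "0 \<le> hardy_norm p f" using le[of "1/2"] i0[of "1/2"] by simp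
  fix r :: real assume r: "0 < r" "r < 1"
  have "0 \<le> circle_mean (\<lambda>z. norm (f z) powr p) r"
    by (rule circle_mean_nonneg)
       (use r p in \<open>auto intro!: continuous_on_norm_powr holomorphic_on_sphere_continuous[OF hol]\<close>)
  then have "circle_mean (\<lambda>z. norm (f z) powr p) r = integral_mean p f r powr p"
    using p by (simp add: integral_mean_circle_mean powr_powr)
  also have "\<dots> \<le> hardy_norm p f powr p" using le[OF r] i0 p by (intro powr_mono2) auto
  finally show "circle_mean (\<lambda>z. norm (f z) powr p) r \<le> hardy_norm p f powr p" .
qed

text \<open>Jensen's inequality on each circle; it reduces every p >= 1 to the H^1 setting of
  Hardy's inequality.\<close>

lemma hardy_space_mean_le:
  assumes f: "f \<in> hardy_space p" and p: "1 \<le> p" and r: "0 < r" "r < 1"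
  shows "circle_mean (\<lambda>z. norm (f z)) r \<le> hardy_norm p f"
proof (rule ccontr)
  have p0: "0 < p" using p by simp
  note D = hardy_spaceD[OF f p0]
  assume "\<not> circle_mean (\<lambda>z. norm (f z)) r \<le> hardy_norm p f"
  then have "hardy_norm p f powr p < circle_mean (\<lambda>z. norm (f z)) r powr p"
    using D(2) p by (intro powr_less_mono2) auto
  also have "\<dots> \<le> circle_mean (\<lambda>z. norm (f z) powr p) r"
    by (rule circle_mean_jensen)
       (use r p in \<open>auto intro!: continuous_intros holomorphic_on_sphere_continuous[OF D(1)]\<close>)
  finally show False using D(3)[OF r] by simp
qed

text \<open>Elements are total functions, but identities between power series hold in the disc only.
  The derivative at a point of the open disc depends on nearby values, so such identities determine
  the norm.\<close>

lemma deriv_hardy_norm_cong: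
  assumes "\<And>z. norm z < 1 \<Longrightarrow> f z = g z"
  shows "deriv_hardy_norm p f = deriv_hardy_norm p g"
proof -
  have "deriv f z = deriv g z" if "norm z < 1" for z
  proof (rule deriv_cong_ev[OF _ refl])
    have "eventually (\<lambda>x. x \<in> ball 0 1) (nhds z)"
      using that by (intro eventually_nhds_in_open) auto
    then show "eventually (\<lambda>x. f x = g x) (nhds z)"
      by eventually_elim (use assms in auto)
  qed
  then have "integral_mean p (deriv f) r = integral_mean p (deriv g) r" if "r \<in> {0<..<1}" for r
    unfolding integral_mean_circle_mean using that
    by (intro arg_cong[where f = "\<lambda>x. x powr (1 / p)"] circle_mean_cong) auto
  then have "hardy_norm p (deriv f) = hardy_norm p (deriv g)"
    unfolding hardy_norm_def by (intro SUP_cong) auto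
  then show ?thesis using assms[of 0] by (simp add: deriv_hardy_norm_def)
qed

text \<open>The coefficients of f' are (n+1) a_(n+1), so the weight 1/(n+1) in Hardy's inequality
  turns their moduli into |a_n| for n >= 1. The constant 5 is the 4 of that inequality plus 1 for
  |f(0)|.\<close>

lemma taylor_coefficients_summable:
  assumes f: "f \<in> deriv_hardy_space p" and p: "1 \<le> p"
  defines "a \<equiv> \<lambda>n. fps_nth (fps_expansion f 0) n"
  shows "summable (\<lambda>n. norm (a n))" "(\<Sum>n. norm (a n)) \<le> 5 * deriv_hardy_norm p f"
proof -
  have p0: "0 < p" using p by simp
  have hol: "f holomorphic_on ball 0 1" and f': "deriv f \<in> hardy_space p"
    using f by (auto simp: deriv_hardy_space_def)
  note a = holomorphic_series[OF hol, folded a_def]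
  have df: "deriv f z = series_fun (diffs a) z" if "norm z < 1" for z
  proof -
    have "deriv f z = deriv (series_fun a) z"
    proof (rule deriv_cong_ev[OF _ refl])
      have "eventually (\<lambda>x. x \<in> ball 0 1) (nhds z)"
        using that by (intro eventually_nhds_in_open) auto
      then show "eventually (\<lambda>x. f x = series_fun a x) (nhds z)"
        by eventually_elim (use a(2) in auto)
    qed
    then show ?thesis using deriv_series_fun[OF a(1) that] by simp
  qed
  let ?N = "hardy_norm p (deriv f)"
  have M: "circle_mean (\<lambda>z. norm (series_fun (diffs a) z)) r \<le> ?N" if "0 < r" "r < 1" for r
  proof -
    have "circle_mean (\<lambda>z. norm (series_fun (diffs a) z)) r = circle_mean (\<lambda>z. norm (deriv f z)) r"
      by (rule circle_mean_cong) (use df that in auto)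
    then show ?thesis using hardy_space_mean_le[OF f' p that] by simp
  qed
  have diffs: "norm (diffs a n) / real (n + 1) = norm (a (Suc n))" for n
  proof -
    have "norm (diffs a n) = real (Suc n) * norm (a (Suc n))"
      unfolding diffs_def norm_mult norm_of_nat ..
    then show ?thesis by simp
  qed
  have "summable (\<lambda>n. norm (diffs a n) / real (n + 1))" "(\<Sum>n. norm (diffs a n) / real (n + 1)) \<le> 4 * ?N"
    using hardy_inequality[OF analytic_series_diffs[OF a(1)], of ?N] M by blast+
  note H = this[unfolded diffs]
  show s: "summable (\<lambda>n. norm (a n))" using H(1) by (subst (asm) summable_Suc_iff)
  have f0: "f 0 = a 0" by (simp add: a_def fps_expansion_def)
  have N0: "0 \<le> ?N" by (rule hardy_spaceD[OF f' p0])
  have "(\<Sum>n. norm (a n)) = norm (a 0) + (\<Sum>n. norm (a (Suc n)))"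
    using suminf_split_head[OF s] by simp
  also have "\<dots> \<le> norm (f 0) + 4 * ?N" using H(2) f0 by simp
  also have "\<dots> \<le> deriv_hardy_norm p f + 4 * deriv_hardy_norm p f"
  proof (intro add_mono mult_left_mono)
    have eq: "x = (x powr p) powr (1 / p)" if "0 \<le> x" for x
      using that p by (simp add: powr_powr)
    show "norm (f 0) \<le> deriv_hardy_norm p f" unfolding deriv_hardy_norm_def
      by (subst eq, simp, intro powr_mono2) (use p in auto)
    show "?N \<le> deriv_hardy_norm p f" unfolding deriv_hardy_norm_def
      by (subst eq[OF N0], intro powr_mono2) (use p in auto)
  qed auto
  finally show "(\<Sum>n. norm (a n)) \<le> 5 * deriv_hardy_norm p f" by simp
qed

section \<open>Series with partial sums as multipliers\<close>

lemma analytic_series_partial_sums: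
  assumes "analytic_series \<eta>" "summable (\<lambda>k. norm (\<alpha> k))"
  shows "analytic_series (\<lambda>n. \<eta> n * (\<Sum>k\<le>n. \<alpha> k))"
proof (rule analytic_seriesI_le[OF assms(1)])
  fix n
  have "norm (\<Sum>k\<le>n. \<alpha> k) \<le> (\<Sum>k\<le>n. norm (\<alpha> k))" by (rule norm_sum)
  also have "\<dots> \<le> (\<Sum>k. norm (\<alpha> k))" by (rule sum_le_suminf[OF assms(2)]) auto
  finally show "norm (\<eta> n * (\<Sum>k\<le>n. \<alpha> k)) \<le> (\<Sum>k. norm (\<alpha> k)) * norm (\<eta> n)"
    by (simp add: norm_mult mult.commute mult_left_mono)
qed

text \<open>Differentiation shifts the partial sums by one, so the first two increments merge.\<close>

definition merge_head :: "(nat \<Rightarrow> complex) \<Rightarrow> nat \<Rightarrow> complex" where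
  "merge_head \<alpha> k = (if k = 0 then \<alpha> 0 + \<alpha> 1 else \<alpha> (Suc k))"

lemma sum_merge_head: "(\<Sum>k\<le>n. merge_head \<alpha> k) = (\<Sum>k\<le>Suc n. \<alpha> k)"
  by (induction n) (auto simp: merge_head_def)

lemma merge_head_summable:
  assumes "summable (\<lambda>k. norm (\<alpha> k))"
  shows "summable (\<lambda>k. norm (merge_head \<alpha> k))" "(\<Sum>k. norm (merge_head \<alpha> k)) \<le> (\<Sum>k. norm (\<alpha> k))"
proof -
  have s2: "summable (\<lambda>k. norm (\<alpha> (Suc (Suc k))))"
    using assms by (simp add: summable_Suc_iff[of "\<lambda>k. norm (\<alpha> k)"] summable_Suc_iff[of "\<lambda>k. norm (\<alpha> (Suc k))"])
  have "summable (\<lambda>k. norm (merge_head \<alpha> (Suc k)))"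
    using s2 by (simp add: merge_head_def)
  then show s: "summable (\<lambda>k. norm (merge_head \<alpha> k))" by (subst (asm) summable_Suc_iff)
  have s1: "summable (\<lambda>k. norm (\<alpha> (Suc k)))" using assms by (subst summable_Suc_iff)
  have "(\<Sum>k. norm (merge_head \<alpha> k)) = norm (merge_head \<alpha> 0) + (\<Sum>k. norm (merge_head \<alpha> (Suc k)))"
    using suminf_split_head[OF s] by simp
  also have "\<dots> \<le> norm (\<alpha> 0) + (norm (\<alpha> 1) + (\<Sum>k. norm (\<alpha> (Suc (Suc k)))))"
    using norm_triangle_ineq[of "\<alpha> 0" "\<alpha> 1"] by (simp add: merge_head_def)
  also have "\<dots> = (\<Sum>k. norm (\<alpha> k))"
    using suminf_split_head[OF assms] suminf_split_head[OF s1] by simp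
  finally show "(\<Sum>k. norm (merge_head \<alpha> k)) \<le> (\<Sum>k. norm (\<alpha> k))" .
qed

text \<open>\<open>\<alpha>\<close> is an arbitrary summable sequence, not the Taylor coefficients
  of a function in S^p, because compactness applies the estimate to limits and differences of
  coefficient sequences. The first term of the bound is the value at 0; the second is the multiplier
  theorem applied to \<open>diffs \<eta>\<close>.\<close>

lemma partial_sums_deriv_hardy:
  assumes \<eta>: "analytic_series \<eta>" and q: "1 < q"
    and m: "\<And>k. 0 \<le> m k" "\<And>k. m k \<le> B"
      "\<And>k r. 0 < r \<Longrightarrow> r < 1 \<Longrightarrow> circle_mean (\<lambda>z. norm (series_fun (tail_coeff k (diffs \<eta>)) z) powr q) r \<le> m k"
    and \<alpha>: "summable (\<lambda>k. norm (\<alpha> k))" "(\<Sum>k. norm (\<alpha> k)) \<le> A"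
  defines "G \<equiv> series_fun (\<lambda>n. \<eta> n * (\<Sum>k\<le>n. \<alpha> k))"
  shows "G \<in> deriv_hardy_space q"
    "deriv_hardy_norm q G \<le> ((norm (\<eta> 0) * norm (\<alpha> 0)) powr q + A powr (q - 1) * (\<Sum>k. norm (merge_head \<alpha> k) * m k)) powr (1 / q)"
    "summable (\<lambda>k. norm (merge_head \<alpha> k) * m k)"
proof -
  note an = analytic_series_partial_sums[OF \<eta> \<alpha>(1)]
  have G: "G holomorphic_on ball 0 1" unfolding G_def by (rule series_fun_holomorphic[OF an])
  have diffs: "diffs (\<lambda>n. \<eta> n * (\<Sum>k\<le>n. \<alpha> k)) = (\<lambda>n. diffs \<eta> n * (\<Sum>k\<le>n. merge_head \<alpha> k))"
    by (rule ext) (simp only: diffs_def sum_merge_head mult.assoc)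
  have dG: "deriv G z = series_fun (\<lambda>n. diffs \<eta> n * (\<Sum>k\<le>n. merge_head \<alpha> k)) z" if "norm z < 1" for z
    unfolding G_def deriv_series_fun[OF an that] diffs ..
  note s = merge_head_summable[OF \<alpha>(1)]
  show sm: "summable (\<lambda>k. norm (merge_head \<alpha> k) * m k)"
    by (rule summable_comparison_test'[OF summable_mult2[OF s(1), of B], of 0])
       (use m in \<open>auto simp: abs_mult intro!: mult_left_mono\<close>)
  have mean: "circle_mean (\<lambda>z. norm (deriv G z) powr q) r \<le> A powr (q - 1) * (\<Sum>k. norm (merge_head \<alpha> k) * m k)"
    if r: "0 < r" "r < 1" for r
  proof -
    have "circle_mean (\<lambda>z. norm (deriv G z) powr q) r =
        circle_mean (\<lambda>z. norm (series_fun (\<lambda>n. diffs \<eta> n * (\<Sum>k\<le>n. merge_head \<alpha> k)) z) powr q) r"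
      by (rule circle_mean_cong) (use dG r in auto)
    also have "\<dots> \<le> A powr (q - 1) * (\<Sum>k. norm (merge_head \<alpha> k) * m k)"
      by (rule multiplier_mean_le[OF analytic_series_diffs[OF \<eta>] _ r s(1) _ m(3)[OF r] m(1) sm])
         (use s(2) \<alpha>(2) q in auto)
    finally show ?thesis .
  qed
  have G': "deriv G holomorphic_on ball 0 1" by (rule holomorphic_deriv[OF G]) simp
  have q0: "0 < q" using q by simp
  have H: "deriv G \<in> hardy_space q"
      "hardy_norm q (deriv G) powr q \<le> A powr (q - 1) * (\<Sum>k. norm (merge_head \<alpha> k) * m k)"
    using hardy_spaceI[OF G' q0, of "A powr (q - 1) * (\<Sum>k. norm (merge_head \<alpha> k) * m k)"] mean by blast+
  show "G \<in> deriv_hardy_space q" using G H(1) by (simp add: deriv_hardy_space_def)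
  have "norm (G 0) = norm (\<eta> 0) * norm (\<alpha> 0)"
    by (simp add: G_def series_fun_def norm_mult)
  then show "deriv_hardy_norm q G \<le> ((norm (\<eta> 0) * norm (\<alpha> 0)) powr q + A powr (q - 1) * (\<Sum>k. norm (merge_head \<alpha> k) * m k)) powr (1 / q)"
    unfolding deriv_hardy_norm_def using H(2) q by (intro powr_mono2 add_mono) auto
qed

text \<open>Split at an index K: the finitely many terms before it tend to 0 one by one, and beyond
  it \<open>m k\<close> is small while the total mass stays at most A.\<close>

lemma weighted_sums_tendsto_0:
  fixes \<delta> :: "nat \<Rightarrow> nat \<Rightarrow> complex"
  assumes s: "\<And>n. summable (\<lambda>k. norm (\<delta> n k))" "\<And>n. (\<Sum>k. norm (\<delta> n k)) \<le> A"
    and \<delta>: "\<And>k. (\<lambda>n. \<delta> n k) \<longlonglongrightarrow> 0"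
    and m: "m \<longlonglongrightarrow> 0" "\<And>k. 0 \<le> m k" and sm: "\<And>n. summable (\<lambda>k. norm (\<delta> n k) * m k)"
  shows "(\<lambda>n. \<Sum>k. norm (\<delta> n k) * m k) \<longlonglongrightarrow> 0"
proof (rule LIMSEQ_I)
  fix \<epsilon> :: real assume \<epsilon>: "\<epsilon> > 0"
  have "0 \<le> (\<Sum>k. norm (\<delta> 0 k))" by (rule suminf_nonneg[OF s(1)]) simp
  then have A: "0 \<le> A" using s(2)[of 0] by simp
  define e where "e = \<epsilon> / (2 * (A + 1))"
  have e: "e > 0" "A * e \<le> \<epsilon> / 2"
  proof -
    show "e > 0" using A \<epsilon> by (simp add: e_def)
    have "A * e = A / (A + 1) * (\<epsilon> / 2)" by (simp add: e_def)
    also have "\<dots> \<le> 1 * (\<epsilon> / 2)" using A \<epsilon> by (intro mult_right_mono) auto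
    finally show "A * e \<le> \<epsilon> / 2" by simp
  qed
  obtain K where K: "\<And>k. k \<ge> K \<Longrightarrow> m k < e"
    using order_tendstoD(2)[OF m(1) e(1)] unfolding eventually_sequentially by blast
  have "(\<lambda>n. \<Sum>k<K. norm (\<delta> n k) * m k) \<longlonglongrightarrow> (\<Sum>k<K. norm (0::complex) * m k)"
    by (intro tendsto_intros \<delta>)
  then have "eventually (\<lambda>n. (\<Sum>k<K. norm (\<delta> n k) * m k) < \<epsilon> / 2) sequentially"
    using \<epsilon> by (intro order_tendstoD(2)[where a = "\<epsilon> / 2"]) auto
  then obtain N where N: "\<And>n. n \<ge> N \<Longrightarrow> (\<Sum>k<K. norm (\<delta> n k) * m k) < \<epsilon> / 2"
    unfolding eventually_sequentially by blast
  show "\<exists>N. \<forall>n\<ge>N. norm ((\<Sum>k. norm (\<delta> n k) * m k) - 0) < \<epsilon>"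
  proof (intro exI allI impI)
    fix n assume n: "N \<le> n"
    have "(\<Sum>k. norm (\<delta> n k) * m k) = (\<Sum>k. norm (\<delta> n (k + K)) * m (k + K)) + (\<Sum>k<K. norm (\<delta> n k) * m k)"
      by (rule suminf_split_initial_segment[OF sm])
    also have "(\<Sum>k. norm (\<delta> n (k + K)) * m (k + K)) \<le> (\<Sum>k. norm (\<delta> n (k + K)) * e)"
    proof (rule suminf_le)
      show "norm (\<delta> n (k + K)) * m (k + K) \<le> norm (\<delta> n (k + K)) * e" for k
        using K[of "k + K"] by (intro mult_left_mono) auto
      show "summable (\<lambda>k. norm (\<delta> n (k + K)) * m (k + K))"
        by (rule summable_ignore_initial_segment[OF sm])
      show "summable (\<lambda>k. norm (\<delta> n (k + K)) * e)"
        by (intro summable_mult2 summable_ignore_initial_segment[OF s(1)])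
    qed
    also have "\<dots> = (\<Sum>k. norm (\<delta> n (k + K))) * e"
      by (rule suminf_mult2[symmetric]) (rule summable_ignore_initial_segment[OF s(1)])
    also have "\<dots> \<le> A * e"
    proof (rule mult_right_mono)
      have "(\<Sum>k. norm (\<delta> n k)) = (\<Sum>k. norm (\<delta> n (k + K))) + (\<Sum>k<K. norm (\<delta> n k))"
        by (rule suminf_split_initial_segment[OF s(1)])
      moreover have "0 \<le> (\<Sum>k<K. norm (\<delta> n k))" by (rule sum_nonneg) simp
      ultimately show "(\<Sum>k. norm (\<delta> n (k + K))) \<le> A" using s(2)[of n] by simp
    qed (use e in simp)
    finally have "(\<Sum>k. norm (\<delta> n k) * m k) < \<epsilon>" using N[OF n] e(2) by simp
    moreover have "0 \<le> (\<Sum>k. norm (\<delta> n k) * m k)"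
      by (rule suminf_nonneg[OF sm]) (use m(2) in simp)
    ultimately show "norm ((\<Sum>k. norm (\<delta> n k) * m k) - 0) < \<epsilon>" by simp
  qed
qed

lemma constant_in_deriv_hardy_space: "(\<lambda>_. 1) \<in> deriv_hardy_space p"
proof -
  have "integral_mean p (\<lambda>_. 0) r = 0" for r by (simp add: integral_mean_def)
  then have "(\<lambda>_. 0) \<in> hardy_space p" by (auto simp: hardy_space_def bdd_above_def)
  then show ?thesis by (simp add: deriv_hardy_space_def)
qed

lemma fps_nth_expansion_const_1: "fps_nth (fps_expansion (\<lambda>_. 1) 0) k = (if k = 0 then 1 else 0)"
  by (cases k) (simp_all add: fps_expansion_def funpow_Suc_right del: funpow.simps)

lemma rhaly_coeff_one: "rhaly_coeff \<eta> (\<lambda>_. 1) = \<eta>"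
  by (rule ext) (simp add: rhaly_coeff_def fps_nth_expansion_const_1)

text \<open>The coefficients are linear in f because iterated derivatives at 0 are; convergence of
  the series in the disc carries this over to their sums.\<close>

lemma rhaly_linear_operator:
  assumes \<eta>: "analytic_series \<eta>" and p: "1 \<le> p"
    and into: "\<And>f. f \<in> deriv_hardy_space p \<Longrightarrow> rhaly \<eta> f \<in> Y"
  shows "linear_operator (deriv_hardy_space p) Y (rhaly \<eta>)"
proof -
  have an: "analytic_series (rhaly_coeff \<eta> f)" if "f \<in> deriv_hardy_space p" for f
    unfolding rhaly_coeff_def
    by (rule analytic_series_partial_sums[OF \<eta> taylor_coefficients_summable(1)[OF that p]])
  have hol: "f holomorphic_on ball 0 1" if "f \<in> deriv_hardy_space p" for f
    using that by (simp add: deriv_hardy_space_def)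
  have add: "rhaly \<eta> (\<lambda>w. f w + g w) z = rhaly \<eta> f z + rhaly \<eta> g z"
    if "f \<in> deriv_hardy_space p" "g \<in> deriv_hardy_space p" "z \<in> ball 0 1" for f g z
  proof -
    have z: "norm z < 1" using that(3) by simp
    have "rhaly_coeff \<eta> (\<lambda>w. f w + g w) n = rhaly_coeff \<eta> f n + rhaly_coeff \<eta> g n" for n
      unfolding rhaly_coeff_def fps_expansion_def
      by (simp add: higher_deriv_add[OF hol[OF that(1)] hol[OF that(2)]] add_divide_distrib sum.distrib distrib_left)
    then show ?thesis
      unfolding rhaly_def
      using sums_add[OF analytic_series_sums[OF an[OF that(1)] z] analytic_series_sums[OF an[OF that(2)] z]]
      by (simp add: series_fun_def sums_iff algebra_simps)
  qed
  have scale: "rhaly \<eta> (\<lambda>w. c * f w) z = c * rhaly \<eta> f z"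
    if "f \<in> deriv_hardy_space p" "z \<in> ball 0 1" for c f z
  proof -
    have z: "norm z < 1" using that(2) by simp
    have "rhaly_coeff \<eta> (\<lambda>w. c * f w) n = c * rhaly_coeff \<eta> f n" for n
      unfolding rhaly_coeff_def fps_expansion_def
      by (simp add: higher_deriv_cmult[OF hol[OF that(1)]] sum_distrib_left mult_ac)
    then show ?thesis
      unfolding rhaly_def
      using sums_mult[OF analytic_series_sums[OF an[OF that(1)] z], of c]
      by (simp add: series_fun_def sums_iff algebra_simps)
  qed
  show ?thesis unfolding linear_operator_def using into add scale by blast
qed

section \<open>The Rhaly operator\<close>

context
  fixes p q :: real and \<eta> :: "nat \<Rightarrow> complex"
  assumes p: "1 \<le> p" and q: "1 < q"
    and \<eta>: "analytic_series \<eta>" and F: "series_fun \<eta> \<in> deriv_hardy_space q"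
begin

text \<open>Boundedness and compactness see the tails of F' only through \<open>m\<close>: the bound
  \<open>B\<close> enters the operator norm, and the decay gives compactness.\<close>

lemma tail_means:
  obtains m :: "nat \<Rightarrow> real" and B where "m \<longlonglongrightarrow> 0" "\<And>k. 0 \<le> m k" "\<And>k. m k \<le> B"
    "\<And>k r. 0 < r \<Longrightarrow> r < 1 \<Longrightarrow> circle_mean (\<lambda>z. norm (series_fun (tail_coeff k (diffs \<eta>)) z) powr q) r \<le> m k"
proof -
  have q0: "0 < q" using q by simp
  have F': "deriv (series_fun \<eta>) \<in> hardy_space q" using F by (simp add: deriv_hardy_space_def)
  have M: "circle_mean (\<lambda>z. norm (series_fun (diffs \<eta>) z) powr q) r
      \<le> hardy_norm q (deriv (series_fun \<eta>)) powr q" if "0 < r" "r < 1" for r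
  proof -
    have "circle_mean (\<lambda>z. norm (series_fun (diffs \<eta>) z) powr q) r
        = circle_mean (\<lambda>z. norm (deriv (series_fun \<eta>) z) powr q) r"
      by (rule circle_mean_cong) (use deriv_series_fun[OF \<eta>] that in auto)
    then show ?thesis using hardy_spaceD(3)[OF F' q0 that] by simp
  qed
  show thesis
  proof (rule tail_means_tendsto_0[OF q analytic_series_diffs[OF \<eta>]])
    show "circle_mean (\<lambda>z. norm (series_fun (diffs \<eta>) z) powr q) r
        \<le> hardy_norm q (deriv (series_fun \<eta>)) powr q" if "0 < r" "r < 1" for r
      by (rule M[OF that])
  next
    fix m :: "nat \<Rightarrow> real"
    assume m: "m \<longlonglongrightarrow> 0" "\<And>k. 0 \<le> m k"
      "\<And>k r. 0 < r \<Longrightarrow> r < 1 \<Longrightarrow> circle_mean (\<lambda>z. norm (series_fun (tail_coeff k (diffs \<eta>)) z) powr q) r \<le> m k"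
    obtain B where B: "\<forall>k. norm (m k) \<le> B"
      using convergent_imp_Bseq[OF convergentI[OF m(1)]] unfolding Bseq_def by blast
    have "m k \<le> B" for k using B[rule_format, of k] by simp
    with m show thesis by (intro that)
  qed
qed

lemma rhaly_series: "rhaly \<eta> f = series_fun (\<lambda>n. \<eta> n * (\<Sum>k\<le>n. fps_nth (fps_expansion f 0) k))"
  by (simp add: rhaly_def rhaly_coeff_def[abs_def])

lemma rhaly_in_deriv_hardy_space:
  assumes "f \<in> deriv_hardy_space p"
  shows "rhaly \<eta> f \<in> deriv_hardy_space q"
proof -
  obtain m :: "nat \<Rightarrow> real" and B where m: "m \<longlonglongrightarrow> 0" "\<And>k. 0 \<le> m k" "\<And>k. m k \<le> B"
    "\<And>k r. 0 < r \<Longrightarrow> r < 1 \<Longrightarrow> circle_mean (\<lambda>z. norm (series_fun (tail_coeff k (diffs \<eta>)) z) powr q) r \<le> m k"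
    using tail_means by blast
  show ?thesis
    unfolding rhaly_series
    by (rule partial_sums_deriv_hardy(1)[OF \<eta> q m(2-4) taylor_coefficients_summable[OF assms p]])
qed

lemma rhaly_defined: "rhaly_defined_on \<eta> (deriv_hardy_space p)"
  unfolding rhaly_defined_on_def rhaly_coeff_def
  using analytic_series_partial_sums[OF \<eta> taylor_coefficients_summable(1)[OF _ p]] by blast

lemma rhaly_linear: "linear_operator (deriv_hardy_space p) (deriv_hardy_space q) (rhaly \<eta>)"
  by (rule rhaly_linear_operator[OF \<eta> p rhaly_in_deriv_hardy_space])

lemma rhaly_bounded_if_symbol_in_space: "rhaly_bounded \<eta> p q"
proof -
  obtain m :: "nat \<Rightarrow> real" and B where m: "m \<longlonglongrightarrow> 0" "\<And>k. 0 \<le> m k" "\<And>k. m k \<le> B"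
    "\<And>k r. 0 < r \<Longrightarrow> r < 1 \<Longrightarrow> circle_mean (\<lambda>z. norm (series_fun (tail_coeff k (diffs \<eta>)) z) powr q) r \<le> m k"
    using tail_means by blast
  have B: "0 \<le> B" using m(2,3) order_trans by blast
  have "deriv_hardy_norm q (rhaly \<eta> f) \<le> ((norm (\<eta> 0) powr q + B) powr (1 / q) * 5) * deriv_hardy_norm p f"
    if f: "f \<in> deriv_hardy_space p" for f
  proof -
    define \<alpha> where "\<alpha> n = fps_nth (fps_expansion f 0) n" for n
    define A where "A = 5 * deriv_hardy_norm p f"
    have \<alpha>: "summable (\<lambda>k. norm (\<alpha> k))" "(\<Sum>k. norm (\<alpha> k)) \<le> A"
      using taylor_coefficients_summable[OF f p] by (simp_all add: \<alpha>_def A_def)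
    have \<alpha>0: "norm (\<alpha> 0) \<le> A"
      using sum_le_suminf[OF \<alpha>(1), of "{0}"] \<alpha>(2) by simp
    then have A: "0 \<le> A" using norm_ge_zero[of "\<alpha> 0"] by linarith
    note G = partial_sums_deriv_hardy[OF \<eta> q m(2-4) \<alpha>]
    have "(\<Sum>k. norm (merge_head \<alpha> k) * m k) \<le> (\<Sum>k. norm (merge_head \<alpha> k) * B)"
      by (intro suminf_le G(3) summable_mult2 merge_head_summable(1)[OF \<alpha>(1)] mult_left_mono m) auto
    also have "\<dots> = (\<Sum>k. norm (merge_head \<alpha> k)) * B"
      by (rule suminf_mult2[symmetric]) (rule merge_head_summable(1)[OF \<alpha>(1)])
    also have "\<dots> \<le> A * B"
      using merge_head_summable(2)[OF \<alpha>(1)] \<alpha>(2) B by (intro mult_right_mono) auto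
    finally have "A powr (q - 1) * (\<Sum>k. norm (merge_head \<alpha> k) * m k) \<le> A powr (q - 1) * (A * B)"
      by (rule mult_left_mono) simp
    \<comment> \<open>The mass of the increments supplies the missing power of A. The bound is then
      homogeneous of degree q, and the q-th root returns a multiple of the norm of f.\<close>
    also have "\<dots> = A powr q * B"
    proof (cases "A = 0")
      case False
      then show ?thesis using A powr_add[of A "q - 1" 1] by simp
    qed simp
    finally have head: "A powr (q - 1) * (\<Sum>k. norm (merge_head \<alpha> k) * m k) \<le> A powr q * B" .
    have "(norm (\<eta> 0) * norm (\<alpha> 0)) powr q \<le> (norm (\<eta> 0) * A) powr q"
      using \<alpha>0 q by (intro powr_mono2 mult_left_mono) auto
    also have "\<dots> = norm (\<eta> 0) powr q * A powr q" using A by (simp add: powr_mult)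
    finally have "(norm (\<eta> 0) * norm (\<alpha> 0)) powr q + A powr (q - 1) * (\<Sum>k. norm (merge_head \<alpha> k) * m k)
        \<le> (norm (\<eta> 0) powr q + B) * A powr q"
      using head by (simp add: algebra_simps)
    then have "((norm (\<eta> 0) * norm (\<alpha> 0)) powr q + A powr (q - 1) * (\<Sum>k. norm (merge_head \<alpha> k) * m k)) powr (1 / q)
        \<le> ((norm (\<eta> 0) powr q + B) * A powr q) powr (1 / q)"
      using q by (intro powr_mono2) (auto intro!: add_nonneg_nonneg mult_nonneg_nonneg suminf_nonneg[OF G(3)] m(2))
    also have "\<dots> = (norm (\<eta> 0) powr q + B) powr (1 / q) * A"
      using A B q by (simp add: powr_mult powr_powr)
    finally show ?thesis
      using G(2) unfolding rhaly_series \<alpha>_def[symmetric] by (simp add: A_def mult.assoc)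
  qed
  then show ?thesis
    unfolding rhaly_bounded_def bounded_operator_def using rhaly_defined rhaly_linear by blast
qed

lemma rhaly_compact_if_symbol_in_space: "rhaly_compact \<eta> p q"
proof -
  obtain m :: "nat \<Rightarrow> real" and B where m: "m \<longlonglongrightarrow> 0" "\<And>k. 0 \<le> m k" "\<And>k. m k \<le> B"
    "\<And>k r. 0 < r \<Longrightarrow> r < 1 \<Longrightarrow> circle_mean (\<lambda>z. norm (series_fun (tail_coeff k (diffs \<eta>)) z) powr q) r \<le> m k"
    using tail_means by blast
  have "\<exists>(s :: nat \<Rightarrow> nat) g. strict_mono s \<and> g \<in> deriv_hardy_space q \<and>
      (\<lambda>n. deriv_hardy_norm q (\<lambda>z. rhaly \<eta> (f (s n)) z - g z)) \<longlonglongrightarrow> 0"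
    if f: "\<And>n. f n \<in> deriv_hardy_space p" and C: "\<And>n. deriv_hardy_norm p (f n) \<le> C"
    for f :: "nat \<Rightarrow> complex \<Rightarrow> complex" and C
  proof -
    define \<alpha> where "\<alpha> n k = fps_nth (fps_expansion (f n) 0) k" for n k
    define A where "A = 5 * C"
    have \<alpha>: "summable (\<lambda>k. norm (\<alpha> n k))" "(\<Sum>k. norm (\<alpha> n k)) \<le> A" for n
      using taylor_coefficients_summable[OF f p, of n] C[of n] by (simp_all add: \<alpha>_def A_def)
    have \<alpha>_partial: "(\<Sum>k\<in>I. norm (\<alpha> n k)) \<le> A" if "finite I" for n I
      using sum_le_suminf[OF \<alpha>(1) that, of n] \<alpha>(2)[of n] by simp
    have \<alpha>_le: "norm (\<alpha> n k) \<le> A" for n k using \<alpha>_partial[of "{k}"] by simp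
    \<comment> \<open>A diagonal subsequence along which every coefficient converges; it exists
      because all coefficients are bounded by A.\<close>
    obtain s :: "nat \<Rightarrow> nat" where s: "strict_mono s" "\<And>k. k \<in> UNIV \<Longrightarrow> \<exists>l. (\<lambda>n. \<alpha> (s n) k) \<longlonglongrightarrow> l"
    proof (rule function_convergent_subsequence[of UNIV \<alpha> A])
      show "norm (\<alpha> n k) \<le> A" for n k by (rule \<alpha>_le)
    qed (simp, blast)
    define a where "a k = lim (\<lambda>n. \<alpha> (s n) k)" for k
    have a: "(\<lambda>n. \<alpha> (s n) k) \<longlonglongrightarrow> a k" for k
      using s(2)[of k] unfolding a_def convergent_LIMSEQ_iff[symmetric] convergent_def by blast
    have a_partial: "(\<Sum>k<N. norm (a k)) \<le> A" for N
    proof (rule LIMSEQ_le_const2)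
      show "(\<lambda>n. \<Sum>k<N. norm (\<alpha> (s n) k)) \<longlonglongrightarrow> (\<Sum>k<N. norm (a k))"
        by (intro tendsto_sum tendsto_norm a)
    qed (use \<alpha>_partial in auto)
    have a_sum: "summable (\<lambda>k. norm (a k))" "(\<Sum>k. norm (a k)) \<le> A"
    proof -
      show "summable (\<lambda>k. norm (a k))"
        by (rule summableI_nonneg_bounded[OF _ a_partial]) auto
      then show "(\<Sum>k. norm (a k)) \<le> A" by (rule suminf_le_const) (rule a_partial)
    qed
    \<comment> \<open>The limit is built from the limit coefficients themselves, whose summability
      is enough, so no limit function in S^p has to be produced.\<close>
    define g where "g = series_fun (\<lambda>n. \<eta> n * (\<Sum>k\<le>n. a k))"
    have g: "g \<in> deriv_hardy_space q"
      unfolding g_def by (rule partial_sums_deriv_hardy(1)[OF \<eta> q m(2-4) a_sum])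
    define \<delta> where "\<delta> n k = \<alpha> (s n) k - a k" for n k
    have \<delta>: "summable (\<lambda>k. norm (\<delta> n k))" "(\<Sum>k. norm (\<delta> n k)) \<le> 2 * A" for n
    proof -
      note sm = summable_add[OF \<alpha>(1)[of "s n"] a_sum(1)]
      have le: "norm (\<delta> n k) \<le> norm (\<alpha> (s n) k) + norm (a k)" for k
        unfolding \<delta>_def by (rule norm_triangle_ineq4)
      show s: "summable (\<lambda>k. norm (\<delta> n k))"
        by (rule summable_comparison_test'[OF sm, of 0]) (use le in auto)
      have "(\<Sum>k. norm (\<delta> n k)) \<le> (\<Sum>k. norm (\<alpha> (s n) k) + norm (a k))"
        by (rule suminf_le[OF le s sm])
      also have "\<dots> \<le> 2 * A"
        using suminf_add[OF \<alpha>(1)[of "s n"] a_sum(1)] \<alpha>(2)[of "s n"] a_sum(2) by simp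
      finally show "(\<Sum>k. norm (\<delta> n k)) \<le> 2 * A" .
    qed
    have \<delta>_lim: "(\<lambda>n. \<delta> n k) \<longlonglongrightarrow> 0" for k
      unfolding \<delta>_def using tendsto_diff[OF a[of k] tendsto_const[of "a k"]] by simp
    define D where "D n = series_fun (\<lambda>j. \<eta> j * (\<Sum>k\<le>j. \<delta> n k))" for n
    have diff: "rhaly \<eta> (f (s n)) z - g z = D n z" if z: "norm z < 1" for n z
    proof -
      have "(\<lambda>j. \<eta> j * (\<Sum>k\<le>j. \<alpha> (s n) k) * z ^ j - \<eta> j * (\<Sum>k\<le>j. a k) * z ^ j) sums (rhaly \<eta> (f (s n)) z - g z)"
        unfolding rhaly_series g_def \<alpha>_def[symmetric]
        by (intro sums_diff analytic_series_sums[OF analytic_series_partial_sums[OF \<eta>] z] \<alpha>(1) a_sum(1))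
      then show ?thesis
        unfolding D_def series_fun_def \<delta>_def sum_subtractf by (simp add: sums_iff algebra_simps)
    qed
    \<comment> \<open>A bound for the q-th power of the norm of the difference. The first term tends
      to 0 with the coefficient of index 0, the second by the decay of the tails.\<close>
    let ?e = "\<lambda>n. (norm (\<eta> 0) * norm (\<delta> n 0)) powr q + (2 * A) powr (q - 1) * (\<Sum>k. norm (merge_head (\<delta> n) k) * m k)"
    have D: "deriv_hardy_norm q (D n) \<le> ?e n powr (1 / q)" "summable (\<lambda>k. norm (merge_head (\<delta> n) k) * m k)" for n
      unfolding D_def using partial_sums_deriv_hardy(2,3)[OF \<eta> q m(2-4) \<delta>] by blast+
    have D0: "0 \<le> deriv_hardy_norm q (D n)" for n by (simp add: deriv_hardy_norm_def)
    have "(\<lambda>n. \<Sum>k. norm (merge_head (\<delta> n) k) * m k) \<longlonglongrightarrow> 0"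
    proof (rule weighted_sums_tendsto_0[OF merge_head_summable(1)[OF \<delta>(1)] _ _ m(1,2) D(2)])
      show "(\<Sum>k. norm (merge_head (\<delta> n) k)) \<le> 2 * A" for n
        using merge_head_summable(2)[OF \<delta>(1)[of n]] \<delta>(2)[of n] by linarith
      show "(\<lambda>n. merge_head (\<delta> n) k) \<longlonglongrightarrow> 0" for k
        using \<delta>_lim[of "Suc k"] tendsto_add[OF \<delta>_lim[of 0] \<delta>_lim[of 1]]
        by (cases "k = 0") (simp_all add: merge_head_def)
    qed
    then have "?e \<longlonglongrightarrow> (norm (\<eta> 0) * norm (0::complex)) powr q + (2 * A) powr (q - 1) * 0"
      using q by (intro tendsto_add tendsto_mult tendsto_powr' tendsto_norm tendsto_const \<delta>_lim) auto
    then have e: "?e \<longlonglongrightarrow> 0" by simp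
    have "(\<lambda>n. ?e n powr (1 / q)) \<longlonglongrightarrow> 0 powr (1 / q)"
      using q by (intro tendsto_powr'[OF e tendsto_const])
        (auto intro!: always_eventually add_nonneg_nonneg mult_nonneg_nonneg suminf_nonneg[OF D(2)] m(2))
    then have lim: "(\<lambda>n. ?e n powr (1 / q)) \<longlonglongrightarrow> 0" by simp
    have "(\<lambda>n. deriv_hardy_norm q (D n)) \<longlonglongrightarrow> 0"
      by (rule tendsto_sandwich[OF _ _ tendsto_const lim])
         (auto intro!: always_eventually D(1) D0)
    moreover have "deriv_hardy_norm q (\<lambda>z. rhaly \<eta> (f (s n)) z - g z) = deriv_hardy_norm q (D n)" for n
      by (rule deriv_hardy_norm_cong) (rule diff)
    ultimately show ?thesis using s(1) g by (intro exI[of _ s] exI[of _ g]) simp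
  qed
  then have "\<forall>f :: nat \<Rightarrow> complex \<Rightarrow> complex.
      (\<forall>n. f n \<in> deriv_hardy_space p) \<and> (\<exists>C. \<forall>n. deriv_hardy_norm p (f n) \<le> C) \<longrightarrow>
      (\<exists>(s :: nat \<Rightarrow> nat) g. strict_mono s \<and> g \<in> deriv_hardy_space q \<and>
         (\<lambda>n. deriv_hardy_norm q (\<lambda>z. rhaly \<eta> (f (s n)) z - g z)) \<longlonglongrightarrow> 0)"
    by blast
  then show ?thesis
    unfolding rhaly_compact_def compact_operator_def using rhaly_defined rhaly_linear by blast
qed

end

text \<open>All coefficient partial sums of the constant 1 equal 1. Well-definedness at this
  function yields the analytic series and the mapping property yields the membership, so one
  argument serves both (i) and (ii).\<close>

lemma rhaly_well_defined_imp_symbol_in_space: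
  assumes "rhaly_defined_on \<eta> (deriv_hardy_space p)"
    and "linear_operator (deriv_hardy_space p) (deriv_hardy_space q) (rhaly \<eta>)"
  shows "analytic_series \<eta> \<and> series_fun \<eta> \<in> deriv_hardy_space q"
proof -
  note one = constant_in_deriv_hardy_space[of p]
  have "analytic_series (rhaly_coeff \<eta> (\<lambda>_. 1))" using assms(1) one unfolding rhaly_defined_on_def by blast
  moreover have "rhaly \<eta> (\<lambda>_. 1) \<in> deriv_hardy_space q" using assms(2) one unfolding linear_operator_def by blast
  ultimately show ?thesis by (simp add: rhaly_def rhaly_coeff_one)
qed

theorem theorem6:
  fixes p q :: real and \<eta> :: "nat \<Rightarrow> complex"
  assumes "1 \<le> p" and "1 < q"
  shows "(rhaly_bounded \<eta> p q \<longleftrightarrow> rhaly_compact \<eta> p q) \<and>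
         (rhaly_compact \<eta> p q \<longleftrightarrow>
            analytic_series \<eta> \<and> series_fun \<eta> \<in> deriv_hardy_space q)"
proof -
  have "analytic_series \<eta> \<and> series_fun \<eta> \<in> deriv_hardy_space q" if "rhaly_bounded \<eta> p q"
    using that rhaly_well_defined_imp_symbol_in_space unfolding rhaly_bounded_def bounded_operator_def by blast
  moreover have "analytic_series \<eta> \<and> series_fun \<eta> \<in> deriv_hardy_space q" if "rhaly_compact \<eta> p q"
    using that rhaly_well_defined_imp_symbol_in_space unfolding rhaly_compact_def compact_operator_def by blast
  ultimately show ?thesis
    using rhaly_bounded_if_symbol_in_space[OF assms] rhaly_compact_if_symbol_in_space[OF assms] by blast
qed

end
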